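(* Let $N\ge2$, let $\Omega\subset\mathbb{R}^N$ be a bounded domain with boundary of class $C^2$, and let $s\in(0,1)$. Assume that $f\in L^m(\Omega)$ for some $m>N/s$, that $f\ge 0$ and $f\not\equiv0$ in $\Omega$, and that $\mu\in L^\infty(\Omega)$ satisfies $\mu(x)\ge\mu_1>0$ in $\Omega$ for some constant $\mu_1$. Then there exists $\lambda^{\star\star}>0$ such that, for all $\lambda>\lambda^{\star\star}$, the problem $$(-\Delta)^su=\mu(x)\,|(-\Delta)^{\frac s2}u|^2+\lambda f(x)\ \text{ in }\Omega,\qquad u=0\ \text{ in }\mathbb{R}^N\setminus\Omega,$$ has no weak solution in $W^{s,2}(\mathbb{R}^N)$.
   Context: For $\sigma\in(0,1)$, $(-\Delta)^{\sigma}u(x)=a_{N,\sigma}\,\mathrm{P.V.}\int_{\mathbb{R}^N}\frac{u(x)-u(y)}{|x-y|^{N+2\sigma}}\,dy$ with $a_{N,\sigma}=-\frac{2^{2\sigma}\Gamma(\frac N2+\sigma)}{\pi^{N/2}\Gamma(-\sigma)}$; this makes sense for $u\in C_c^\infty(\mathbb{R}^N)$. For $u\in L^1(\mathbb{R}^N)$ vanishing outside $\Omega$, $(-\Delta)^{\frac s2}u$ is understood in the sense of distributions, $\langle(-\Delta)^{\frac s2}u,\varphi\rangle=\int u\,(-\Delta)^{\frac s2}\varphi\,dx$ for $\varphi\in C_c^\infty(\Omega)$. Weak solution: $u$ is a weak solution of the problem if $u$ and $|(-\Delta)^{\frac s2}u|^2$ belong to $L^1(\Omega)$ (including that $(-\Delta)^{\frac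 s2}u$ is represented in $\Omega$ by a function), $u\equiv0$ a.e. in $\mathbb{R}^N\setminus\Omega$, and $$\int_\Omega u\,(-\Delta)^s\phi\,dx=\int_\Omega\big(\mu(x)|(-\Delta)^{\frac s2}u|^2+\lambda f(x)\big)\phi\,dx$$ for all $\phi\in\mathbb{X}^s(\Omega):=\{\phi\in C^s(\mathbb{R}^N):\phi(x)=0 \text{ for all } x\in\mathbb{R}^N\setminus\Omega,\ (-\Delta)^s\phi\in L^\infty(\Omega)\}$. $W^{s,2}(\mathbb{R}^N)=\{u\in L^2(\mathbb{R}^N):\iint_{\mathbb{R}^{2N}}\frac{|u(x)-u(y)|^2}{|x-y|^{N+2s}}dx\,dy<+\infty\}$. *)

theory Defs
  imports "HOL-Analysis.Analysis"
begin

section \<open>Function spaces\<close>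

text \<open>All functions are total on the ambient Euclidean space. A function given on \<open>\<Omega>\<close> only is
  represented by any extension; its values outside \<open>\<Omega>\<close> are never used.\<close>

definition Lp_space :: "real \<Rightarrow> 'b measure \<Rightarrow> ('b \<Rightarrow> real) set" where
  "Lp_space p M = {f \<in> borel_measurable M. integrable M (\<lambda>x. \<bar>f x\<bar> powr p)}"

definition Linf_space :: "'b measure \<Rightarrow> ('b \<Rightarrow> real) set" where
  "Linf_space M = {f \<in> borel_measurable M. \<exists>C. AE x in M. \<bar>f x\<bar> \<le> C}"

definition frac_sobolev_2 :: "real \<Rightarrow> ('a::euclidean_space \<Rightarrow> real) set" where
  "frac_sobolev_2 s = {u \<in> Lp_space 2 lebesgue.
     (\<integral>\<^sup>+x. \<integral>\<^sup>+y. ennreal (\<bar>u x - u y\<bar>\<^sup>2 / dist x y powr (real DIM('a) + 2 * s))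
        \<partial>lebesgue \<partial>lebesgue) < \<infinity>}"

text \<open>The space \<open>C\<^sup>s(\<real>\<^sup>N)\<close> for \<open>0 < s < 1\<close>: bounded functions with finite Hoelder seminorm.\<close>

definition holder_space :: "real \<Rightarrow> ('a::euclidean_space \<Rightarrow> real) set" where
  "holder_space s = {\<phi>. bounded (range \<phi>) \<and> (\<exists>C. \<forall>x y. \<bar>\<phi> x - \<phi> y\<bar> \<le> C * dist x y powr s)}"

text \<open>Class \<open>C\<^sup>k\<close> on a set \<open>S\<close>, which is meant to be open.\<close>

primrec Ck_on :: "nat \<Rightarrow> 'a::euclidean_space set \<Rightarrow> ('a \<Rightarrow> real) \<Rightarrow> bool" where
  "Ck_on 0 S f \<longleftrightarrow> continuous_on S f"
| "Ck_on (Suc k) S f \<longleftrightarrow> (\<forall>x\<in>S. f differentiable (at x)) \<and>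
     (\<forall>b\<in>Basis. Ck_on k S (\<lambda>x. frechet_derivative f (at x) b))"

text \<open>\<open>C\<^sub>c\<^sup>\<infinity>(\<Omega>)\<close>, with its elements extended by zero to the whole space.\<close>

definition test_functions :: "'a::euclidean_space set \<Rightarrow> ('a \<Rightarrow> real) set" where
  "test_functions \<Omega> = {\<phi>. (\<forall>k. Ck_on k UNIV \<phi>) \<and>
     compact (closure {x. \<phi> x \<noteq> 0}) \<and> closure {x. \<phi> x \<noteq> 0} \<subseteq> \<Omega>}"

section \<open>Domains with boundary of class \<open>C\<^sup>2\<close>\<close>

text \<open>Near each boundary point, \<open>\<Omega>\<close> lies on one side of the graph of a \<open>C\<^sup>2\<close> function over a
  hyperplane. The unit vector \<open>e\<close> plays the role of the last coordinate axis after a rigid motion;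
  a function of the remaining \<open>N - 1\<close> coordinates is a function \<open>\<gamma>\<close> evaluated at the orthogonal
  projection of \<open>x\<close> to the hyperplane orthogonal to \<open>e\<close> (and every \<open>C\<^sup>2\<close> function on that hyperplane
  is the restriction of a \<open>C\<^sup>2\<close> function on the whole space).\<close>

definition C2_boundary :: "'a::euclidean_space set \<Rightarrow> bool" where
  "C2_boundary \<Omega> \<longleftrightarrow> (\<forall>x\<^sub>0 \<in> frontier \<Omega>. \<exists>r>0. \<exists>e. norm e = 1 \<and> (\<exists>\<gamma>. Ck_on 2 UNIV \<gamma> \<and>
     \<Omega> \<inter> ball x\<^sub>0 r = {x \<in> ball x\<^sub>0 r. x \<bullet> e > \<gamma> (x - (x \<bullet> e) *\<^sub>R e)}))"

section \<open>The fractional Laplacian\<close>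

definition frac_lap_const :: "real \<Rightarrow> real \<Rightarrow> real" where
  "frac_lap_const N \<sigma> = - (2 powr (2 * \<sigma>) * Gamma (N / 2 + \<sigma>)) / (pi powr (N / 2) * Gamma (- \<sigma>))"

text \<open>The pointwise operator \<open>(-\<Delta>)\<^sup>\<sigma>\<close>, with the principal value as a limit of truncated integrals.
  It is only applied to \<open>C\<^sub>c\<^sup>\<infinity>\<close> functions, for which the limit exists everywhere.\<close>

definition frac_lap :: "real \<Rightarrow> ('a::euclidean_space \<Rightarrow> real) \<Rightarrow> 'a \<Rightarrow> real" where
  "frac_lap \<sigma> u x = frac_lap_const (real DIM('a)) \<sigma> *
     Lim (at_right 0) (\<lambda>\<epsilon>. LINT y:- ball x \<epsilon>|lebesgue.
       (u x - u y) / dist x y powr (real DIM('a) + 2 * \<sigma>))"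

text \<open>For \<open>u \<in> L\<^sup>1(\<real>\<^sup>N)\<close> vanishing outside \<open>\<Omega>\<close>: the distribution \<open>(-\<Delta>)\<^sup>\<sigma> u\<close> on \<open>\<Omega>\<close> is represented
  by the locally integrable function \<open>g\<close> (which is then unique up to null sets of \<open>\<Omega>\<close>).
  The left-hand integral may be taken over the whole space since \<open>u\<close> vanishes outside \<open>\<Omega>\<close>.\<close>

definition has_frac_lap_on ::
  "real \<Rightarrow> 'a::euclidean_space set \<Rightarrow> ('a \<Rightarrow> real) \<Rightarrow> ('a \<Rightarrow> real) \<Rightarrow> bool" where
  "has_frac_lap_on \<sigma> \<Omega> u g \<longleftrightarrow>
     (\<forall>K. compact K \<and> K \<subseteq> \<Omega> \<longrightarrow> set_integrable lebesgue K g) \<and>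
     (\<forall>\<phi> \<in> test_functions \<Omega>.
        (LINT x|lebesgue. u x * frac_lap \<sigma> \<phi> x) = (LINT x:\<Omega>|lebesgue. g x * \<phi> x))"

section \<open>Weak solutions\<close>

text \<open>The test space \<open>\<X>\<^sup>s(\<Omega>)\<close>. The condition \<open>(-\<Delta>)\<^sup>s \<phi> \<in> L\<^sup>\<infinity>(\<Omega>)\<close> is distributional: a \<open>C\<^sup>s\<close> function
  need not admit a pointwise principal value, and a principal value existing merely almost
  everywhere would ignore singular parts of \<open>(-\<Delta>)\<^sup>s \<phi>\<close>.\<close>

definition test_space_X :: "real \<Rightarrow> 'a::euclidean_space set \<Rightarrow> ('a \<Rightarrow> real) set" where
  "test_space_X s \<Omega> = {\<phi> \<in> holder_space s. (\<forall>x. x \<notin> \<Omega> \<longrightarrow> \<phi> x = 0) \<and>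
     (\<exists>h \<in> Linf_space (lebesgue_on \<Omega>). has_frac_lap_on s \<Omega> \<phi> h)}"

text \<open>In the definition below \<open>g\<close> is \<open>(-\<Delta>)\<^bsup>s/2\<^esup> u\<close> and \<open>h\<close> is \<open>(-\<Delta>)\<^sup>s \<phi>\<close>.\<close>

definition weak_solution :: "real \<Rightarrow> 'a::euclidean_space set \<Rightarrow> ('a \<Rightarrow> real) \<Rightarrow> real \<Rightarrow>
    ('a \<Rightarrow> real) \<Rightarrow> ('a \<Rightarrow> real) \<Rightarrow> bool" where
  "weak_solution s \<Omega> \<mu> lam f u \<longleftrightarrow>
     integrable (lebesgue_on \<Omega>) u \<and>
     (AE x in lebesgue. x \<notin> \<Omega> \<longrightarrow> u x = 0) \<and>
     (\<exists>g. has_frac_lap_on (s / 2) \<Omega> u g \<and>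
       integrable (lebesgue_on \<Omega>) (\<lambda>x. \<bar>g x\<bar>\<^sup>2) \<and>
       (\<forall>\<phi> \<in> test_space_X s \<Omega>. \<forall>h. has_frac_lap_on s \<Omega> \<phi> h \<longrightarrow>
          (LINT x|lebesgue_on \<Omega>. u x * h x) =
          (LINT x|lebesgue_on \<Omega>. (\<mu> x * \<bar>g x\<bar>\<^sup>2 + lam * f x) * \<phi> x)))"

end

theory Submission
  imports Defs "HOL-Computational_Algebra.Polynomial"
begin

text \<open>
  Let \<open>\<delta>\<close> be the distance to the complement of \<open>\<Omega>\<close> and \<open>g = (-\<Delta>)\<^sup>s\<^sup>/\<^sup>2 u\<close> in \<open>\<Omega>\<close>.
  Testing the equation with a bump of radius \<open>\<delta>(x\<^sub>0)/4\<close> around \<open>x\<^sub>0\<close>, weighted by \<open>\<delta>(x\<^sub>0)\<^sup>s\<^sup>-\<^sup>N\<close> and integrated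
  over \<open>x\<^sub>0 \<in> \<Omega>\<close>, gives \<open>\<integral>(\<mu>\<^sub>1 g\<^sup>2 + \<lambda> f) \<delta>\<^sup>s \<le> C \<integral>\<bar>u\<bar> \<delta>\<^sup>-\<^sup>s\<close>, because the fractional Laplacian of a
  bump of radius \<open>r\<close> decays like \<open>r\<^sup>N \<bar>x - x\<^sub>0\<bar>\<^sup>-\<^sup>N\<^sup>-\<^sup>2\<^sup>s\<close>.
  Testing \<open>g\<close> with approximations of the sign of \<open>u\<close> and using only that \<open>u\<close> vanishes outside \<open>\<Omega>\<close>, where
  the kernel \<open>\<bar>x - y\<bar>\<^sup>-\<^sup>N\<^sup>-\<^sup>s\<close> has mass at least \<open>c \<delta>(x)\<^sup>-\<^sup>s\<close>, gives \<open>\<integral>\<bar>u\<bar> \<delta>\<^sup>-\<^sup>s \<le> C \<integral>\<bar>g\<bar>\<close>; the hypothesis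
  \<open>u \<in> W\<^sup>s\<^sup>,\<^sup>2\<close> is what makes the approximation converge.
  Since \<open>s < 1\<close>, the integral of \<open>\<delta>\<^sup>-\<^sup>s\<close> over \<open>\<Omega>\<close> is finite, and \<open>\<bar>g\<bar> \<le> t g\<^sup>2 \<delta>\<^sup>s + \<delta>\<^sup>-\<^sup>s / t\<close> with small \<open>t\<close>
  absorbs the term with \<open>g\<^sup>2\<close>, which leaves a bound on \<open>\<lambda> \<integral> f \<delta>\<^sup>s\<close> independent of \<open>u\<close>.
\<close>

section \<open>Radial integrals\<close>

text \<open>The usual test function would be a positive solution of a Dirichlet problem, of size
  \<delta>^s, whose boundary behaviour needs regularity theory. Averaging over bumps avoids it:
  radius comparable to \<delta> and weight \<delta>^(s-N) produce \<delta>^(s-N) \<delta>^N =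
  \<delta>^s, and an operator of order 2s turns this into at most a multiple of \<delta>^(-s). The
  same power is the mass that the kernel |x-y|^(-N-s) gives to the complement, so the right-hand
  side is what the sign test on g controls, and splitting |g| with the weights \<delta>^s and
  \<delta>^(-s) closes the circle. The obstacle is that g is known only through tests in
  C_c^infinity(\<Omega>), while the sign of u is neither continuous nor zero near the boundary. It
  is replaced by \<zeta> T(u) with a Lipschitz cutoff \<zeta> and a continuous monotone T, mollified
  in such a way that the energy form keeps its sign. Mollification is removed first, at fixed
  cutoff. The cutoff is removed afterwards; its increments inside \<Omega> are dominated by means of
  the Gagliardo integrand of u and the integrability of \<delta>^(-s).\<close>

lemma nn_integral_powr_tail:
  fixes R \<alpha> :: real assumes "0 < \<alpha>" "0 < R"
  shows "(\<integral>\<^sup>+t. ennreal (t powr (-\<alpha> - 1)) * indicator {R..} t \<partial>lborel) = ennreal (R powr (-\<alpha>) / \<alpha>)"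
proof -
  have "(\<integral>\<^sup>+t. ennreal (t powr (-\<alpha> - 1)) * indicator {R..} t \<partial>lborel) = ennreal (0 - (- (R powr (-\<alpha>) / \<alpha>)))"
  proof (rule nn_integral_FTC_atLeast)
    show "((\<lambda>t. - (t powr (-\<alpha>) / \<alpha>)) \<longlongrightarrow> 0) at_top"
    proof -
      have "((\<lambda>t::real. t powr (-\<alpha>)) \<longlongrightarrow> 0) at_top"
        using assms by (intro tendsto_neg_powr filterlim_ident) auto
      from tendsto_minus[OF tendsto_divide[OF this tendsto_const[of \<alpha>]]] assms show ?thesis by simp
    qed
    show "DERIV (\<lambda>t. - (t powr (-\<alpha>) / \<alpha>)) t :> t powr (-\<alpha> - 1)" if "R \<le> t" for t
      using that assms by (auto intro!: derivative_eq_intros)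
  qed auto
  then show ?thesis by simp
qed

lemma nn_integral_powr_head:
  fixes R \<alpha> :: real assumes "0 < \<alpha>" "0 < R"
  shows "(\<integral>\<^sup>+t. ennreal (t powr (\<alpha> - 1)) * indicator {0..R} t \<partial>lborel) = ennreal (R powr \<alpha> / \<alpha>)"
proof -
  have "(\<integral>\<^sup>+t. ennreal (t powr (\<alpha> - 1)) * indicator {0..R} t \<partial>lborel) = ennreal (R powr \<alpha> / \<alpha>)"
  proof -
    have 1: "((\<lambda>t. t powr (\<alpha> - 1)) has_integral (R powr \<alpha> / \<alpha> - 0 powr \<alpha> / \<alpha>)) {0..R}"
    proof (rule fundamental_theorem_of_calculus_interior)
      show "continuous_on {0..R} (\<lambda>t. t powr \<alpha> / \<alpha>)"
        using assms by (intro continuous_intros continuous_on_powr') auto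
      show "((\<lambda>t. t powr \<alpha> / \<alpha>) has_vector_derivative x powr (\<alpha> - 1)) (at x)" if "x \<in> {0<..<R}" for x
        using that assms by (auto intro!: derivative_eq_intros simp: has_real_derivative_iff_has_vector_derivative[symmetric])
    qed (use assms in auto)
    show ?thesis
      using nn_integral_has_integral_lebesgue[OF _ 1] 
      by (simp add: nn_integral_completion indicator_mult_ennreal[symmetric] mult.commute)
  qed
  then show ?thesis .
qed

text \<open>Layer cake: \<open>\<bar>z\<bar>\<^sup>-\<^sup>p\<close> is the integral of \<open>p t\<^sup>-\<^sup>p\<^sup>-\<^sup>1\<close> over \<open>t \<ge> \<bar>z\<bar>\<close>.\<close>
lemma layer_cake:
  fixes p :: real and A :: "'a::euclidean_space set"
  assumes p: "0 < p" and A: "A \<in> sets borel" "0 \<notin> A"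
  shows "(\<integral>\<^sup>+z. ennreal (norm z powr (-p)) * indicator A z \<partial>lborel)
    = (\<integral>\<^sup>+t. ennreal (p * t powr (-p - 1)) * emeasure lborel (A \<inter> cball 0 t) * indicator {0<..} t \<partial>lborel)"
proof -
  have "(\<integral>\<^sup>+z. ennreal (norm z powr (-p)) * indicator A z \<partial>lborel)
    = (\<integral>\<^sup>+z. (\<integral>\<^sup>+t. ennreal (p * t powr (-p - 1)) * (indicator A z * indicator (cball 0 t) z * indicator {0<..} t) \<partial>lborel) \<partial>lborel)"
  proof (rule nn_integral_cong)
    fix z :: 'a
    show "ennreal (norm z powr (-p)) * indicator A z
      = (\<integral>\<^sup>+t. ennreal (p * t powr (-p - 1)) * (indicator A z * indicator (cball 0 t) z * indicator {0<..} t) \<partial>lborel)"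
    proof (cases "z \<in> A")
      case True
      then have z: "norm z > 0" using A(2) by auto
      have "(\<integral>\<^sup>+t. ennreal (p * t powr (-p - 1)) * (indicator A z * indicator (cball 0 t) z * indicator {0<..} t) \<partial>lborel)
        = (\<integral>\<^sup>+t. ennreal p * (ennreal (t powr (-p - 1)) * indicator {norm z..} t) \<partial>lborel)"
        using z True p less_le_trans[OF z] by (intro nn_integral_cong) (auto simp: indicator_def ennreal_mult)
      also have "\<dots> = ennreal p * ennreal (norm z powr (-p) / p)"
        using nn_integral_powr_tail[OF p z] by (subst nn_integral_cmult) auto
      also have "\<dots> = ennreal (norm z powr (-p))"
        using p by (simp add: ennreal_mult[symmetric])
      finally show ?thesis using True by simp
    qed simp
  qed
  also have "\<dots> = (\<integral>\<^sup>+t. (\<integral>\<^sup>+z. ennreal (p * t powr (-p - 1)) * (indicator A z * indicator (cball 0 t) z * indicator {0<..} t) \<partial>lborel) \<partial>lborel)"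
  proof (rule lborel_pair.Fubini'[symmetric])
    have "(\<lambda>x. indicator (cball 0 (snd x)) (fst x) :: ennreal) = (\<lambda>x::'a\<times>real. indicator {x. norm (fst x) \<le> snd x} x)"
      by (auto simp: indicator_def fun_eq_iff)
    then have [measurable]: "(\<lambda>x::'a\<times>real. indicator (cball 0 (snd x)) (fst x) :: ennreal) \<in> borel_measurable (lborel \<Otimes>\<^sub>M lborel)"
      by simp
    show "(\<lambda>(z::'a, t). ennreal (p * t powr (- p - 1)) * (indicator A z * indicator (cball 0 t) z * indicator {0<..} t))
      \<in> borel_measurable (lborel \<Otimes>\<^sub>M lborel)"
      using A by (simp add: split_beta') 
  qed
  also have "\<dots> = (\<integral>\<^sup>+t. ennreal (p * t powr (-p - 1)) * emeasure lborel (A \<inter> cball 0 t) * indicator {0<..} t \<partial>lborel)"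
  proof (rule nn_integral_cong)
    fix t :: real
    have "(\<integral>\<^sup>+z. ennreal (p * t powr (-p - 1)) * (indicator A z * indicator (cball 0 t) z * indicator {0<..} t) \<partial>lborel)
      = (\<integral>\<^sup>+z. (ennreal (p * t powr (-p - 1)) * indicator {0<..} t) * indicator (A \<inter> cball 0 t) z \<partial>lborel)"
      by (intro nn_integral_cong) (auto simp: indicator_def)
    also have "\<dots> = (ennreal (p * t powr (-p - 1)) * indicator {0<..} t) * emeasure lborel (A \<inter> cball 0 t)"
      using A by (subst nn_integral_cmult_indicator) auto
    finally show "(\<integral>\<^sup>+z. ennreal (p * t powr (-p - 1)) * (indicator A z * indicator (cball 0 t) z * indicator {0<..} t) \<partial>lborel)
       = ennreal (p * t powr (-p - 1)) * emeasure lborel (A \<inter> cball 0 t) * indicator {0<..} t"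
      by (simp add: mult_ac)
  qed
  finally show ?thesis .
qed

lemma emeasure_cball_powr:
  assumes "0 < t"
  shows "emeasure lborel (cball (x::'a::euclidean_space) t) = ennreal (unit_ball_vol DIM('a) * t powr DIM('a))"
  using assms emeasure_cball[of t x] by (simp add: powr_realpow)

lemma emeasure_ball_powr:
  assumes "0 < t"
  shows "emeasure lborel (ball (x::'a::euclidean_space) t) = ennreal (unit_ball_vol DIM('a) * t powr DIM('a))"
  using assms emeasure_ball[of t x] by (simp add: powr_realpow)

text \<open>Layer cake replaces polar coordinates. The shell between radii \<open>R\<close> and
  \<open>t\<close> is estimated by the whole ball of radius \<open>t\<close>, hence the factor
  \<open>DIM('a) + \<alpha>\<close> where the exact value would have \<open>DIM('a)\<close>.\<close>

lemma nn_integral_norm_tail: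
  fixes R \<alpha> :: real
  assumes "0 < \<alpha>" "0 < R"
  shows "(\<integral>\<^sup>+z. ennreal (norm (z::'a::euclidean_space) powr (- (DIM('a) + \<alpha>))) * indicator {z. R \<le> norm z} z \<partial>lborel)
    \<le> ennreal ((DIM('a) + \<alpha>) * unit_ball_vol DIM('a) / \<alpha> * R powr (-\<alpha>))"
proof -
  let ?p = "DIM('a) + \<alpha>" and ?V = "unit_ball_vol DIM('a)"
  have "(\<integral>\<^sup>+z. ennreal (norm (z::'a) powr (- ?p)) * indicator {z. R \<le> norm z} z \<partial>lborel)
    = (\<integral>\<^sup>+t. ennreal (?p * t powr (-?p - 1)) * emeasure lborel ({z::'a. R \<le> norm z} \<inter> cball 0 t) * indicator {0<..} t \<partial>lborel)"
    using assms by (intro layer_cake) auto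
  also have "\<dots> \<le> (\<integral>\<^sup>+t. ennreal (?p * ?V) * (ennreal (t powr (-\<alpha> - 1)) * indicator {R..} t) \<partial>lborel)"
  proof (rule nn_integral_mono)
    fix t :: real
    show "ennreal (?p * t powr (-?p - 1)) * emeasure lborel ({z::'a. R \<le> norm z} \<inter> cball 0 t) * indicator {0<..} t
       \<le> ennreal (?p * ?V) * (ennreal (t powr (-\<alpha> - 1)) * indicator {R..} t)"
    proof (cases "R \<le> t")
      case True
      then have t: "0 < t" using assms by simp
      have "emeasure lborel ({z::'a. R \<le> norm z} \<inter> cball 0 t) \<le> emeasure lborel (cball (0::'a) t)"
        by (intro emeasure_mono) auto
      then have le: "emeasure lborel ({z::'a. R \<le> norm z} \<inter> cball 0 t) \<le> ennreal (?V * t powr DIM('a))"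
        using emeasure_cball_powr[OF t, of "0::'a"] by simp
      have "ennreal (?p * t powr (-?p - 1)) * emeasure lborel ({z::'a. R \<le> norm z} \<inter> cball 0 t)
        \<le> ennreal (?p * t powr (-?p - 1)) * ennreal (?V * t powr DIM('a))"
        by (intro mult_left_mono le) auto
      also have "\<dots> = ennreal (?p * ?V * (t powr (-?p - 1) * t powr DIM('a)))"
        using assms by (subst ennreal_mult[symmetric]) (auto simp: mult_ac)
      also have "t powr (-?p - 1) * t powr DIM('a) = t powr (-\<alpha> - 1)"
        by (simp add: powr_add[symmetric])
      also have "ennreal (?p * ?V * t powr (-\<alpha> - 1)) = ennreal (?p * ?V) * ennreal (t powr (-\<alpha> - 1))"
        using assms by (subst ennreal_mult) auto
      finally show ?thesis using True t by simp
    next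
      case False
      then have "{z::'a. R \<le> norm z} \<inter> cball 0 t = {}" by auto
      then show ?thesis using False by simp
    qed
  qed
  also have "\<dots> = ennreal (?p * ?V) * ennreal (R powr (-\<alpha>) / \<alpha>)"
    using nn_integral_powr_tail[OF assms] by (subst nn_integral_cmult) auto
  also have "\<dots> = ennreal ((DIM('a) + \<alpha>) * ?V / \<alpha> * R powr (-\<alpha>))"
    using assms by (subst ennreal_mult[symmetric]) auto
  finally show ?thesis .
qed

text \<open>With p = N - \<alpha> > 0 the layer cake integral splits at t = R: below, the set is a
  ball of radius t; above, it is the fixed ball of radius R. The two contributions add up to the
  exact constant.\<close>

lemma nn_integral_norm_head:
  fixes R \<alpha> :: real
  assumes "0 < \<alpha>" "\<alpha> < DIM('a)" "0 < R"
  shows "(\<integral>\<^sup>+z. ennreal (norm (z::'a::euclidean_space) powr (\<alpha> - DIM('a))) * indicator (cball 0 R) z \<partial>lborel)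
    \<le> ennreal (DIM('a) * unit_ball_vol DIM('a) / \<alpha> * R powr \<alpha>)"
proof -
  let ?p = "DIM('a) - \<alpha>" and ?V = "unit_ball_vol DIM('a)"
  \<comment> \<open>Since \<open>0 powr _ = 0\<close>, the origin can be removed from the ball
    without changing the integrand, as the layer cake formula demands.\<close>
  have "(\<integral>\<^sup>+z. ennreal (norm (z::'a) powr (\<alpha> - DIM('a))) * indicator (cball 0 R) z \<partial>lborel)
     = (\<integral>\<^sup>+z. ennreal (norm (z::'a) powr (- ?p)) * indicator (cball 0 R - {0}) z \<partial>lborel)"
    by (intro nn_integral_cong) (auto simp: indicator_def)
  also have "\<dots> = (\<integral>\<^sup>+t. ennreal (?p * t powr (-?p - 1)) * emeasure lborel ((cball (0::'a) R - {0}) \<inter> cball 0 t) * indicator {0<..} t \<partial>lborel)"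
    using assms by (intro layer_cake) auto
  also have "\<dots> \<le> (\<integral>\<^sup>+t. ennreal (?p * ?V) * (ennreal (t powr (\<alpha> - 1)) * indicator {0..R} t)
       + ennreal (?p * ?V * R powr DIM('a)) * (ennreal (t powr (-?p - 1)) * indicator {R..} t) \<partial>lborel)"
  proof (rule nn_integral_mono)
    fix t :: real
    consider "t \<le> 0" | "0 < t" "t \<le> R" | "R < t" by linarith
    then show "ennreal (?p * t powr (-?p - 1)) * emeasure lborel ((cball (0::'a) R - {0}) \<inter> cball 0 t) * indicator {0<..} t
       \<le> ennreal (?p * ?V) * (ennreal (t powr (\<alpha> - 1)) * indicator {0..R} t)
       + ennreal (?p * ?V * R powr DIM('a)) * (ennreal (t powr (-?p - 1)) * indicator {R..} t)"
    proof cases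
      case 2
      have "emeasure lborel ((cball (0::'a) R - {0}) \<inter> cball 0 t) \<le> emeasure lborel (cball (0::'a) t)"
        by (intro emeasure_mono) auto
      then have le: "emeasure lborel ((cball (0::'a) R - {0}) \<inter> cball 0 t) \<le> ennreal (?V * t powr DIM('a))"
        using emeasure_cball_powr[OF 2(1), of "0::'a"] by simp
      have "ennreal (?p * t powr (-?p - 1)) * emeasure lborel ((cball (0::'a) R - {0}) \<inter> cball 0 t)
        \<le> ennreal (?p * t powr (-?p - 1)) * ennreal (?V * t powr DIM('a))"
        by (intro mult_left_mono le) auto
      also have "\<dots> = ennreal (?p * ?V * (t powr (-?p - 1) * t powr DIM('a)))"
        using assms by (subst ennreal_mult[symmetric]) (auto simp: mult_ac)
      also have "t powr (-?p - 1) * t powr DIM('a) = t powr (\<alpha> - 1)"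
        by (simp add: powr_add[symmetric])
      also have "ennreal (?p * ?V * t powr (\<alpha> - 1)) = ennreal (?p * ?V) * ennreal (t powr (\<alpha> - 1))"
        using assms by (subst ennreal_mult) auto
      finally show ?thesis using 2 by (simp add: add_increasing2)
    next
      case 3
      have "emeasure lborel ((cball (0::'a) R - {0}) \<inter> cball 0 t) \<le> emeasure lborel (cball (0::'a) R)"
        by (intro emeasure_mono) auto
      then have le: "emeasure lborel ((cball (0::'a) R - {0}) \<inter> cball 0 t) \<le> ennreal (?V * R powr DIM('a))"
        using emeasure_cball_powr[OF assms(3), of "0::'a"] by simp
      have "ennreal (?p * t powr (-?p - 1)) * emeasure lborel ((cball (0::'a) R - {0}) \<inter> cball 0 t)
        \<le> ennreal (?p * t powr (-?p - 1)) * ennreal (?V * R powr DIM('a))"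
        by (intro mult_left_mono le) auto
      also have "\<dots> = ennreal (?p * ?V * R powr DIM('a)) * ennreal (t powr (-?p - 1))"
        using assms by (subst (1 2) ennreal_mult[symmetric]) (auto simp: mult_ac)
      finally show ?thesis using 3 assms by simp
    qed simp
  qed
  also have "\<dots> = ennreal (?p * ?V) * ennreal (R powr \<alpha> / \<alpha>) + ennreal (?p * ?V * R powr DIM('a)) * ennreal (R powr (-?p) / ?p)"
    using assms nn_integral_powr_tail[of ?p R] nn_integral_powr_head[of \<alpha> R]
    by (simp add: nn_integral_add nn_integral_cmult)
  also have "\<dots> = ennreal (?p * ?V * (R powr \<alpha> / \<alpha>) + ?p * ?V * R powr DIM('a) * (R powr (-?p) / ?p))"
    using assms by (simp add: ennreal_mult[symmetric] ennreal_plus[symmetric] del: ennreal_plus)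
  also have "?p * ?V * (R powr \<alpha> / \<alpha>) + ?p * ?V * R powr DIM('a) * (R powr (-?p) / ?p) = DIM('a) * ?V / \<alpha> * R powr \<alpha>"
  proof -
    have "R powr DIM('a) * R powr (-?p) = R powr \<alpha>" by (simp add: powr_add[symmetric])
    then have "?p * ?V * R powr DIM('a) * (R powr (-?p) / ?p) = ?V * R powr \<alpha>"
      using assms by (simp add: field_simps)
    moreover have "?p * ?V * (R powr \<alpha> / \<alpha>) = DIM('a) * ?V / \<alpha> * R powr \<alpha> - ?V * R powr \<alpha>"
      using assms by (simp add: field_simps)
    ultimately show ?thesis by simp
  qed
  finally show ?thesis .
qed

section \<open>Geometry of the domain\<close>

lemma Ck_on_imp_continuous: "Ck_on k S f \<Longrightarrow> continuous_on S f"
  by (cases k) (auto intro!: continuous_at_imp_continuous_on differentiable_imp_continuous_within)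

lemma frechet_derivative_sum_Basis:
  fixes f :: "'a::euclidean_space \<Rightarrow> real"
  assumes "f differentiable (at x)"
  shows "frechet_derivative f (at x) v = (\<Sum>b\<in>Basis. (v \<bullet> b) * frechet_derivative f (at x) b)"
proof -
  interpret linear "frechet_derivative f (at x)"
    using assms by (rule linear_frechet_derivative)
  have "frechet_derivative f (at x) v = frechet_derivative f (at x) (\<Sum>b\<in>Basis. (v \<bullet> b) *\<^sub>R b)"
    by (simp add: euclidean_representation)
  then show ?thesis by (simp add: sum scale)
qed

text \<open>\<open>Ck_on\<close> speaks of partial derivatives along \<open>Basis\<close> only. They
  are bounded on the compact set, the sum of their bounds dominates the operator norm, and convexity
  admits the mean value inequality.\<close>

lemma C1_lipschitz_on_compact:
  fixes f :: "'a::euclidean_space \<Rightarrow> real"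
  assumes f: "Ck_on (Suc k) UNIV f" and S: "compact S" "convex S"
  shows "\<exists>L. \<forall>x\<in>S. \<forall>y\<in>S. \<bar>f x - f y\<bar> \<le> L * dist x y"
proof -
  let ?D = "\<lambda>x b. frechet_derivative f (at x) b"
  have diff: "f differentiable (at x)" for x using f by simp
  have "\<exists>M. \<forall>x\<in>S. \<bar>?D x b\<bar> \<le> M" if "b \<in> Basis" for b
  proof -
    have "continuous_on S (\<lambda>x. ?D x b)"
      using f that by (auto intro: continuous_on_subset[OF Ck_on_imp_continuous])
    then have "bounded ((\<lambda>x. ?D x b) ` S)" using S compact_continuous_image compact_imp_bounded by blast
    then show ?thesis by (auto simp: bounded_iff)
  qed
  then obtain M where M: "\<And>b x. b \<in> Basis \<Longrightarrow> x \<in> S \<Longrightarrow> \<bar>?D x b\<bar> \<le> M b" by metis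
  let ?L = "\<Sum>b\<in>Basis. M b"
  have "norm (f x - f y) \<le> ?L * norm (x - y)" if "x \<in> S" "y \<in> S" for x y
  proof (rule differentiable_bound[OF S(2) _ _ that])
    show "(f has_derivative ?D x) (at x within S)" for x
      using diff[of x] by (simp add: frechet_derivative_works has_derivative_at_withinI)
    show "onorm (?D x) \<le> ?L" if "x \<in> S" for x
    proof (rule onorm_le)
      fix v :: 'a
      have "norm (?D x v) \<le> (\<Sum>b\<in>Basis. \<bar>(v \<bullet> b) * ?D x b\<bar>)"
        by (subst frechet_derivative_sum_Basis[OF diff]) (simp only: real_norm_def sum_abs)
      also have "\<dots> \<le> (\<Sum>b\<in>Basis. norm v * M b)"
        using M that by (intro sum_mono) (auto simp: abs_mult Basis_le_norm intro!: mult_mono)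
      finally show "norm (?D x v) \<le> ?L * norm v" by (simp add: sum_distrib_left mult.commute)
    qed
  qed
  then show ?thesis by (auto simp: dist_norm)
qed

text \<open>The function \<open>h\<close> is the signed height of a point above the graph.\<close>
lemma C2_boundary_height:
  fixes \<Omega> :: "'a::euclidean_space set"
  assumes "C2_boundary \<Omega>" "x\<^sub>0 \<in> frontier \<Omega>"
  obtains r e L h where "0 < r" "norm e = 1" "1 \<le> L" "continuous_on UNIV h"
    "\<forall>x t. h (x + t *\<^sub>R e) = h x + t"
    "\<forall>x\<in>ball x\<^sub>0 r. \<forall>y\<in>ball x\<^sub>0 r. h x - h y \<le> L * dist x y"
    "\<Omega> \<inter> ball x\<^sub>0 r = {x \<in> ball x\<^sub>0 r. h x > (0::real)}"
proof -
  obtain r e \<gamma> where r: "0 < r" and e: "norm e = 1" and \<gamma>: "Ck_on 2 UNIV \<gamma>"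
    and \<Omega>: "\<Omega> \<inter> ball x\<^sub>0 r = {x \<in> ball x\<^sub>0 r. x \<bullet> e > \<gamma> (x - (x \<bullet> e) *\<^sub>R e)}"
    using assms unfolding C2_boundary_def by blast
  let ?P = "\<lambda>x. x - (x \<bullet> e) *\<^sub>R e"
  define h where "h x = x \<bullet> e - \<gamma> (?P x)" for x
  have ee: "e \<bullet> e = 1" using e by (simp add: dot_square_norm)
  have contP: "continuous_on A ?P" for A by (intro continuous_intros)
  have linP: "linear ?P"
    by (rule linearI) (auto simp: inner_add_left algebra_simps)
  have PL: "dist (?P x) (?P y) \<le> 2 * dist x y" for x y
  proof -
    have "?P x - ?P y = (x - y) - ((x - y) \<bullet> e) *\<^sub>R e" by (simp add: algebra_simps inner_diff_left)
    also have "norm \<dots> \<le> norm (x - y) + \<bar>(x - y) \<bullet> e\<bar> * norm e"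
      by (metis norm_scaleR norm_triangle_ineq4)
    also have "\<dots> \<le> norm (x - y) + norm (x - y)"
      using Cauchy_Schwarz_ineq2[of "x - y" e] e by simp
    finally show ?thesis by (simp add: dist_norm)
  qed
  have "Ck_on (Suc 1) UNIV \<gamma>" using \<gamma> by (simp only: One_nat_def numeral_2_eq_2)
  \<comment> \<open>The function \<gamma> is evaluated at projected points, which need not lie near
    \<open>x\<^sub>0\<close>. The Lipschitz bound is therefore taken on the projection of the closed
    ball, again compact and convex.\<close>
  then obtain L where L: "\<And>x y. x \<in> ?P ` cball x\<^sub>0 r \<Longrightarrow> y \<in> ?P ` cball x\<^sub>0 r \<Longrightarrow> \<bar>\<gamma> x - \<gamma> y\<bar> \<le> L * dist x y"
  proof -
    have "compact (?P ` cball x\<^sub>0 r)" by (intro compact_continuous_image contP compact_cball)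
    moreover have "convex (?P ` cball x\<^sub>0 r)" by (intro convex_linear_image linP convex_cball)
    ultimately show ?thesis
      using C1_lipschitz_on_compact[OF \<open>Ck_on (Suc 1) UNIV \<gamma>\<close>, of "?P ` cball x\<^sub>0 r"] that by blast
  qed
  show thesis
  proof (rule that[OF r e])
    show "1 \<le> 1 + 2 * \<bar>L\<bar>" by simp
    have "continuous_on UNIV \<gamma>" using Ck_on_imp_continuous[OF \<gamma>] .
    then have "continuous_on UNIV (\<lambda>x. \<gamma> (?P x))"
      by (rule continuous_on_compose2[OF _ contP]) simp
    then show "continuous_on UNIV h" unfolding h_def
      by (intro continuous_on_diff continuous_on_inner continuous_on_id continuous_on_const)
    show "\<forall>x t. h (x + t *\<^sub>R e) = h x + t"
      unfolding h_def by (simp add: inner_add_left ee scaleR_add_left)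
    have "h x - h y \<le> (1 + 2 * \<bar>L\<bar>) * dist x y" if "x \<in> ball x\<^sub>0 r" "y \<in> ball x\<^sub>0 r" for x y
    proof -
      have "x \<bullet> e - y \<bullet> e \<le> dist x y"
        using Cauchy_Schwarz_ineq2[of "x - y" e] e by (simp add: inner_diff_left dist_norm)
      moreover have "\<bar>\<gamma> (?P x) - \<gamma> (?P y)\<bar> \<le> \<bar>L\<bar> * dist (?P x) (?P y)"
      proof -
        have "?P x \<in> ?P ` cball x\<^sub>0 r" "?P y \<in> ?P ` cball x\<^sub>0 r" using that by (auto intro!: imageI)
        then have "\<bar>\<gamma> (?P x) - \<gamma> (?P y)\<bar> \<le> L * dist (?P x) (?P y)" by (rule L)
        also have "\<dots> \<le> \<bar>L\<bar> * dist (?P x) (?P y)" by (intro mult_right_mono) auto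
        finally show ?thesis .
      qed
      moreover have "\<bar>L\<bar> * dist (?P x) (?P y) \<le> \<bar>L\<bar> * (2 * dist x y)"
        using PL by (intro mult_left_mono) auto
      ultimately show ?thesis unfolding h_def by (simp add: algebra_simps) 
    qed
    then show "\<forall>x\<in>ball x\<^sub>0 r. \<forall>y\<in>ball x\<^sub>0 r. h x - h y \<le> (1 + 2 * \<bar>L\<bar>) * dist x y"
      by blast
    show "\<Omega> \<inter> ball x\<^sub>0 r = {x \<in> ball x\<^sub>0 r. h x > 0}"
      unfolding h_def using \<Omega> by (simp only: diff_gt_0_iff_gt)
  qed
qed

text \<open>Averaging over translations in the direction \<open>e\<close> reduces the integral to one dimension
  without rotating coordinates.\<close>
lemma nn_integral_height_powr:
  fixes h :: "'a::euclidean_space \<Rightarrow> real" and e :: 'a and s :: real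
  assumes h: "continuous_on UNIV h" "\<And>x t. h (x + t *\<^sub>R e) = h x + t"
    and e: "norm e = 1" and s: "0 < s" "s < 1" 
  shows "(\<integral>\<^sup>+x. ennreal (h x powr (-s)) * indicator {x \<in> ball x\<^sub>0 R. 0 < h x} x \<partial>lborel) < \<infinity>"
proof -
  define F where "F x = ennreal (h x powr (-s)) * indicator {x \<in> ball x\<^sub>0 R. 0 < h x} x" for x
  have hb[measurable]: "h \<in> borel_measurable borel"
    using h(1) by (simp add: borel_measurable_continuous_onI)
  have "{x \<in> ball x\<^sub>0 R. 0 < h x} = ball x\<^sub>0 R \<inter> {x \<in> space borel. 0 < h x}" by auto
  also have "\<dots> \<in> sets borel" by measurable
  finally have [measurable]: "{x \<in> ball x\<^sub>0 R. 0 < h x} \<in> sets borel" .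
  have Fb[measurable]: "F \<in> borel_measurable borel" unfolding F_def by measurable
  let ?I = "\<integral>\<^sup>+x. F x \<partial>lborel"
  have shift: "(\<integral>\<^sup>+x. F (x + t *\<^sub>R e) \<partial>lborel) = ?I" for t
  proof -
    have "?I = (\<integral>\<^sup>+x. F x \<partial>(distr lborel borel ((+) (t *\<^sub>R e))))" by (simp add: lborel_distr_plus)
    also have "\<dots> = (\<integral>\<^sup>+x. F (t *\<^sub>R e + x) \<partial>lborel)" by (subst nn_integral_distr) auto
    finally show ?thesis by (simp add: add.commute)
  qed
  \<comment> \<open>By translation invariance all shifts by t e have the same integral, so averaging
    over t in [0,1] changes nothing. After Fubini the inner integral sees only the height h x +
    t.\<close>
  have "?I = (\<integral>\<^sup>+t. ?I * indicator {0..1} t \<partial>(lborel :: real measure))"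
    by (subst nn_integral_cmult_indicator) auto
  also have "\<dots> = (\<integral>\<^sup>+t. (\<integral>\<^sup>+x. F (x + t *\<^sub>R e) * indicator {0..1} t \<partial>lborel) \<partial>(lborel :: real measure))"
    by (subst nn_integral_multc) (auto simp: shift)
  also have "\<dots> = (\<integral>\<^sup>+x. (\<integral>\<^sup>+t. F (x + t *\<^sub>R e) * indicator {0..1} t \<partial>(lborel :: real measure)) \<partial>lborel)"
    by (rule lborel_pair.Fubini') (simp add: split_beta')
  also have "\<dots> \<le> (\<integral>\<^sup>+x. ennreal (1 / (1 - s)) * 2 * indicator (ball x\<^sub>0 (R + 1)) x \<partial>lborel)"
  proof (rule nn_integral_mono)
    fix x
    show "(\<integral>\<^sup>+t. F (x + t *\<^sub>R e) * indicator {0..1} t \<partial>(lborel :: real measure))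
      \<le> ennreal (1 / (1 - s)) * 2 * indicator (ball x\<^sub>0 (R + 1)) x"
    proof (cases "x \<in> ball x\<^sub>0 (R + 1)")
      case True
      have "(\<integral>\<^sup>+t. F (x + t *\<^sub>R e) * indicator {0..1} t \<partial>(lborel :: real measure))
        \<le> (\<integral>\<^sup>+t. ennreal ((h x + t) powr (-s)) * indicator {0..1} (h x + t) + indicator {0..1} t \<partial>(lborel :: real measure))"
      proof (rule nn_integral_mono)
        fix t :: real
        \<comment> \<open>Heights above 1 contribute at most 1; only heights in (0,1] meet the
          singularity, which is integrable because s < 1.\<close>
        have "ennreal ((h x + t) powr - s) \<le> 1" if "1 < h x + t"
          using powr_mono2'[of "-s" 1 "h x + t"] s that by (simp add: ennreal_le_1)
        then show "F (x + t *\<^sub>R e) * indicator {0..1} t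
          \<le> ennreal ((h x + t) powr (-s)) * indicator {0..1} (h x + t) + indicator {0..1} t"
          by (auto simp: F_def indicator_def h(2))
      qed
      also have "\<dots> = (\<integral>\<^sup>+t. ennreal ((h x + t) powr (-s)) * indicator {0..1} (h x + t) \<partial>(lborel :: real measure)) + 1"
        by (subst nn_integral_add) auto
      also have "(\<integral>\<^sup>+t. ennreal ((h x + t) powr (-s)) * indicator {0..1} (h x + t) \<partial>(lborel :: real measure))
        = (\<integral>\<^sup>+t. ennreal (t powr (-s)) * indicator {0..1} t \<partial>lborel)"
        by (subst nn_integral_real_affine[where c=1 and t="h x"]) auto
      also have "\<dots> = ennreal (1 / (1 - s))"
        using nn_integral_powr_head[of "1 - s" 1] s by simp
      also have "ennreal (1 / (1 - s)) + 1 \<le> ennreal (1 / (1 - s)) * 2"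
        using s by (simp add: ennreal_mult'[symmetric] mult_2_right ennreal_leI add_left_mono flip: ennreal_1)
      finally show ?thesis using True by simp
    next
      case False
      have "x + t *\<^sub>R e \<notin> ball x\<^sub>0 R" if "0 \<le> t" "t \<le> 1" for t
      proof
        assume "x + t *\<^sub>R e \<in> ball x\<^sub>0 R"
        then have "dist x\<^sub>0 x < R + 1"
          using dist_triangle[of x\<^sub>0 x "x + t *\<^sub>R e"] e that by (simp add: dist_norm)
        then show False using False by simp
      qed
      then have "F (x + t *\<^sub>R e) * indicator {0..1} t = 0" for t by (auto simp: F_def indicator_def)
      then show ?thesis by (simp only: nn_integral_const mult_zero_left zero_le)
    qed
  qed
  also have "\<dots> < \<infinity>"
    using emeasure_lborel_ball_finite[of x\<^sub>0 "R + 1"]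
    by (subst nn_integral_cmult_indicator) (auto simp: ennreal_mult_less_top)
  finally show ?thesis by (simp add: F_def)
qed

section \<open>Distance to the complement of the domain\<close>

abbreviation dist_compl :: "'a::euclidean_space set \<Rightarrow> 'a \<Rightarrow> real" where
  "dist_compl \<Omega> x \<equiv> infdist x (- \<Omega>)"

lemma dist_compl_ge:
  assumes "- \<Omega> \<noteq> {}" "\<And>z. z \<notin> \<Omega> \<Longrightarrow> c \<le> dist x z"
  shows "c \<le> dist_compl \<Omega> x"
  using assms by (auto simp: infdist_def intro!: cINF_greatest)

lemma dist_compl_pos:
  assumes "open \<Omega>" "- \<Omega> \<noteq> {}" "x \<in> \<Omega>"
  shows "0 < dist_compl \<Omega> x"
  using assms infdist_pos_not_in_closed[of "- \<Omega>" x] by auto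

text \<open>\<open>infdist\<close> to the empty set is 0 by convention, so every positivity
  statement about \<open>dist_compl\<close> rests on the complement having a point.\<close>

lemma bounded_compl_nonempty: "bounded \<Omega> \<Longrightarrow> - \<Omega> \<noteq> ({} :: 'a::euclidean_space set)"
  using not_bounded_UNIV by (metis Compl_UNIV_eq double_compl)

text \<open>Near a boundary point the distance is at least a multiple of the height over the graph,
  whose power -s is locally integrable. Finitely many such balls cover the compact boundary, and on
  the rest of \<Omega> the distance is bounded below.\<close>

lemma nn_integral_dist_compl_powr_finite:
  fixes \<Omega> :: "'a::euclidean_space set" and s :: real
  assumes \<Omega>: "open \<Omega>" "bounded \<Omega>" "C2_boundary \<Omega>" and s: "0 < s" "s < 1"
  shows "(\<integral>\<^sup>+x. ennreal (dist_compl \<Omega> x powr (-s)) * indicator \<Omega> x \<partial>lborel) < \<infinity>"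
proof -
  let ?d = "dist_compl \<Omega>"
  let ?J = "\<lambda>A. \<integral>\<^sup>+x. ennreal (?d x powr (-s)) * indicator (\<Omega> \<inter> A) x \<partial>lborel"
  have ne: "- \<Omega> \<noteq> {}" using bounded_compl_nonempty[OF \<Omega>(2)] .
  have [measurable]: "\<Omega> \<in> sets borel" using \<Omega> by auto
  have [measurable]: "?d \<in> borel_measurable borel"
    by (intro borel_measurable_continuous_onI continuous_intros)
  have loc: "\<exists>r>0. ?J (ball z r) < \<infinity>" if zf: "z \<in> frontier \<Omega>" for z
  proof -
    obtain r e L h where r: "0 < r" and e: "norm e = 1" and L: "1 \<le> L" and hc: "continuous_on UNIV h"
      and h': "\<forall>x t. h (x + t *\<^sub>R e) = h x + t"
      and lip': "\<forall>x\<in>ball z r. \<forall>y\<in>ball z r. h x - h y \<le> L * dist x y"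
      and eq: "\<Omega> \<inter> ball z r = {x \<in> ball z r. h x > (0::real)}"
      by (rule C2_boundary_height[OF \<Omega>(3) zf])
    have h: "h (x + t *\<^sub>R e) = h x + t" for x t using h' by blast
    have lip: "h x - h y \<le> L * dist x y" if "x \<in> ball z r" "y \<in> ball z r" for x y using lip' that by blast
    have [measurable]: "h \<in> borel_measurable borel"
      using hc by (simp add: borel_measurable_continuous_onI)
    have "{x \<in> ball z r. 0 < h x} = ball z r \<inter> {x \<in> space borel. 0 < h x}" by auto
    also have "\<dots> \<in> sets borel" by measurable
    finally have [measurable]: "{x \<in> ball z r. 0 < h x} \<in> sets borel" .
    have "?J (ball z (r/2)) \<le> (\<integral>\<^sup>+x. ennreal ((r/2) powr (-s)) * indicator (ball z r) x 
        + ennreal (L powr s) * (ennreal (h x powr (-s)) * indicator {x \<in> ball z r. 0 < h x} x) \<partial>lborel)"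
    proof (rule nn_integral_mono)
      fix x
      show "ennreal (?d x powr (-s)) * indicator (\<Omega> \<inter> ball z (r/2)) x \<le> ennreal ((r/2) powr (-s)) * indicator (ball z r) x 
        + ennreal (L powr s) * (ennreal (h x powr (-s)) * indicator {x \<in> ball z r. 0 < h x} x)"
      proof (cases "x \<in> \<Omega> \<inter> ball z (r/2)")
        case True
        then have x: "x \<in> ball z r" "x \<in> \<Omega>" using r by auto
        then have hx: "0 < h x" using eq by blast
        \<comment> \<open>A point outside \<Omega> is either far from x, or lies in the ball with
          height at most 0. In the second case the Lipschitz bound converts the drop of height from
          h x into a distance of at least h x / L.\<close>
        have "min (r/2) (h x / L) \<le> ?d x"
        proof (rule dist_compl_ge[OF ne])
          fix y assume y: "y \<notin> \<Omega>"
          show "min (r/2) (h x / L) \<le> dist x y"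
          proof (cases "y \<in> ball z r")
            case True
            then have "h y \<le> 0" using eq y by (metis (mono_tags, lifting) IntD1 mem_Collect_eq not_le)
            then have "h x \<le> L * dist x y" using lip[OF x(1) True] by simp
            then have "h x / L \<le> dist x y" using L by (simp add: field_simps)
            then show ?thesis by simp
          next
            case False
            then have "r/2 \<le> dist x y" using True dist_triangle[of z y x] by simp
            then show ?thesis by simp
          qed
        qed
        then have "?d x powr (-s) \<le> min (r/2) (h x / L) powr (-s)"
          using s r hx L by (intro powr_mono2') auto
        also have "\<dots> \<le> (r/2) powr (-s) + (h x / L) powr (-s)" by (auto simp: min_def)
        also have "(h x / L) powr (-s) = L powr s * h x powr (-s)"
          using L hx by (simp add: powr_divide powr_minus field_simps)
        finally have "ennreal (?d x powr (-s)) \<le> ennreal ((r/2) powr (-s)) + ennreal (L powr s) * ennreal (h x powr (-s))"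
          by (simp add: ennreal_mult[symmetric] ennreal_plus[symmetric] ennreal_leI del: ennreal_plus)
        then show ?thesis using True x hx by simp
      qed simp
    qed
    also have "\<dots> = ennreal ((r/2) powr (-s)) * emeasure lborel (ball z r)
       + ennreal (L powr s) * (\<integral>\<^sup>+x. ennreal (h x powr (-s)) * indicator {x \<in> ball z r. 0 < h x} x \<partial>lborel)"
      by (simp add: nn_integral_add nn_integral_cmult nn_integral_cmult_indicator del: mem_ball)
    also have "\<dots> < \<infinity>"
      using nn_integral_height_powr[OF hc h e s, of z r] emeasure_lborel_ball_finite[of z r]
      by (simp add: ennreal_mult_less_top del: mem_ball)
    finally show ?thesis using r by (intro exI[of _ "r/2"]) auto
  qed
  then obtain r where r: "\<And>z. z \<in> frontier \<Omega> \<Longrightarrow> 0 < r z \<and> ?J (ball z (r z)) < \<infinity>" by metis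
  have "compact (frontier \<Omega>)" using \<Omega> by (simp add: compact_frontier_bounded)
  moreover have "frontier \<Omega> \<subseteq> (\<Union>z\<in>frontier \<Omega>. ball z (r z))" using r by auto
  ultimately obtain Z where Z: "Z \<subseteq> frontier \<Omega>" "finite Z" "frontier \<Omega> \<subseteq> (\<Union>z\<in>Z. ball z (r z))"
    using compactE_image[of "frontier \<Omega>" "frontier \<Omega>" "\<lambda>z. ball z (r z)"] by (metis open_ball)
  let ?U = "\<Union>z\<in>Z. ball z (r z)"
  \<comment> \<open>What remains after removing the boundary balls is compact and contained in the
    open set \<Omega>, so the continuous positive function \<open>?d\<close> has a positive minimum
    there.\<close>
  have K: "compact (closure \<Omega> - ?U)"
    using \<Omega> by (intro compact_diff) (auto simp: compact_closure)
  have sub: "closure \<Omega> - ?U \<subseteq> \<Omega>"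
    using Z(3) \<Omega>(1) by (auto simp: frontier_def interior_open)
  have "\<exists>c>0. \<forall>x\<in>closure \<Omega> - ?U. c \<le> ?d x"
  proof (cases "closure \<Omega> - ?U = {}")
    case False
    have "continuous_on (closure \<Omega> - ?U) ?d" by (intro continuous_intros)
    from continuous_attains_inf[OF K False this] obtain x where
      "x \<in> closure \<Omega> - ?U" "\<forall>y\<in>closure \<Omega> - ?U. ?d x \<le> ?d y" by blast
    then show ?thesis using dist_compl_pos[OF \<Omega>(1) ne] sub by blast
  qed (auto intro: exI[of _ 1])
  then obtain c where c: "0 < c" "\<And>x. x \<in> closure \<Omega> - ?U \<Longrightarrow> c \<le> ?d x" by blast
  have "(\<integral>\<^sup>+x. ennreal (?d x powr (-s)) * indicator \<Omega> x \<partial>lborel)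
    \<le> (\<integral>\<^sup>+x. ennreal (c powr (-s)) * indicator \<Omega> x + (\<Sum>z\<in>Z. ennreal (?d x powr (-s)) * indicator (\<Omega> \<inter> ball z (r z)) x) \<partial>lborel)"
  proof (rule nn_integral_mono)
    fix x
    show "ennreal (?d x powr (-s)) * indicator \<Omega> x
      \<le> ennreal (c powr (-s)) * indicator \<Omega> x + (\<Sum>z\<in>Z. ennreal (?d x powr (-s)) * indicator (\<Omega> \<inter> ball z (r z)) x)"
    proof (cases "x \<in> \<Omega>")
      case True
      show ?thesis
      proof (cases "x \<in> ?U")
        case True
        then obtain z where z: "z \<in> Z" "x \<in> ball z (r z)" by auto
        have "ennreal (?d x powr (-s)) * indicator (\<Omega> \<inter> ball z (r z)) x
          \<le> (\<Sum>z\<in>Z. ennreal (?d x powr (-s)) * indicator (\<Omega> \<inter> ball z (r z)) x)"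
          using z Z(2) by (intro member_le_sum) auto
        then show ?thesis using \<open>x \<in> \<Omega>\<close> z by (auto intro: add_increasing)
      next
        case False
        then have "c \<le> ?d x" using c(2) \<open>x \<in> \<Omega>\<close> closure_subset by auto
        then have "?d x powr (-s) \<le> c powr (-s)" using c(1) s by (intro powr_mono2') auto
        then show ?thesis using \<open>x \<in> \<Omega>\<close> by (auto intro!: add_increasing2 ennreal_leI sum_nonneg)
      qed
    qed simp
  qed
  also have "\<dots> = ennreal (c powr (-s)) * emeasure lborel \<Omega> + (\<Sum>z\<in>Z. ?J (ball z (r z)))"
  proof -
    have [measurable]: "\<Omega> \<inter> ball i (r i) \<in> sets borel" for i using \<Omega> by auto
    have M: "(\<lambda>x. ennreal (?d x powr (-s)) * indicator (\<Omega> \<inter> ball i (r i)) x) \<in> borel_measurable lborel" for i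
      by measurable
    have "(\<lambda>x. \<Sum>z\<in>Z. ennreal (?d x powr (-s)) * indicator (\<Omega> \<inter> ball z (r z)) x) \<in> borel_measurable lborel"
      using M by (rule borel_measurable_sum)
    then show ?thesis
      by (simp add: nn_integral_add nn_integral_sum[OF M] nn_integral_cmult_indicator del: measurable_lborel1)
  qed
  also have "\<dots> < \<infinity>"
  proof -
    have "emeasure lborel \<Omega> < \<infinity>" using emeasure_bounded_finite[OF \<Omega>(2)] by simp
    moreover have "(\<Sum>z\<in>Z. ?J (ball z (r z))) < \<infinity>" using r Z by (auto simp: ennreal_sum_less_top)
    ultimately show ?thesis by (simp add: ennreal_mult_less_top)
  qed
  finally show ?thesis .
qed

text \<open>Going down by t e from a boundary point lowers the height by t, while a ball of radius t
  / (2 L) can regain at most t / 2. The ball stays at negative height, hence outside \<Omega>.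
  Compactness of the boundary makes the constants uniform.\<close>

lemma exterior_cone:
  fixes \<Omega> :: "'a::euclidean_space set"
  assumes \<Omega>: "bounded \<Omega>" "open \<Omega>" "C2_boundary \<Omega>"
  shows "\<exists>\<rho>>0. \<exists>c>0. c \<le> 1 \<and> (\<forall>z\<in>frontier \<Omega>. \<exists>e. norm e = 1 \<and> (\<forall>t. 0 < t \<and> t \<le> \<rho> \<longrightarrow> ball (z - t *\<^sub>R e) (c * t) \<inter> \<Omega> = {}))"
proof -
  let ?P = "\<lambda>\<rho> c z. \<exists>e. norm e = 1 \<and> (\<forall>t. 0 < t \<and> t \<le> \<rho> \<longrightarrow> ball (z - t *\<^sub>R e) (c * t) \<inter> \<Omega> = {})"
  have loc: "\<exists>\<rho>>0. \<exists>c>0. c \<le> 1 \<and> (\<forall>z\<in>frontier \<Omega> \<inter> ball x\<^sub>0 \<rho>. ?P \<rho> c z)" if x0: "x\<^sub>0 \<in> frontier \<Omega>" for x\<^sub>0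
  proof -
    obtain r e L h where r: "0 < r" and e: "norm e = 1" and L: "1 \<le> L" and hc: "continuous_on UNIV h"
      and h': "\<forall>x t. h (x + t *\<^sub>R e) = h x + t"
      and lip': "\<forall>x\<in>ball x\<^sub>0 r. \<forall>y\<in>ball x\<^sub>0 r. h x - h y \<le> L * dist x y"
      and eq: "\<Omega> \<inter> ball x\<^sub>0 r = {x \<in> ball x\<^sub>0 r. h x > (0::real)}"
      by (rule C2_boundary_height[OF \<Omega>(3) x0])
    have h: "h (x + t *\<^sub>R e) = h x + t" for x t using h' by blast
    have lip: "h x - h y \<le> L * dist x y" if "x \<in> ball x\<^sub>0 r" "y \<in> ball x\<^sub>0 r" for x y using lip' that by blast
    \<comment> \<open>Three displacements occur, from \<open>x\<^sub>0\<close> to z, from z down by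
      t, and within the small ball. Each is at most r / 4, so everything stays in the ball where the
      height describes \<Omega>.\<close>
    have "ball (z - t *\<^sub>R e) (1 / (2 * L) * t) \<inter> \<Omega> = {}"
      if z: "z \<in> frontier \<Omega>" "dist x\<^sub>0 z < r / 4" and t: "0 < t" "t \<le> r / 4" for z t
    proof (rule ccontr)
      assume "\<not> ?thesis"
      then obtain p where p: "p \<in> \<Omega>" "dist (z - t *\<^sub>R e) p < 1 / (2 * L) * t" by auto
      have le: "1 / (2 * L) * t \<le> t" using L t by (simp add: field_simps)
      have zt: "dist z (z - t *\<^sub>R e) = t" using e t by (simp add: dist_norm)
      have "dist x\<^sub>0 p \<le> dist x\<^sub>0 z + (dist z (z - t *\<^sub>R e) + dist (z - t *\<^sub>R e) p)"
        by (meson add_left_mono dist_triangle order_trans)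
      then have pb: "p \<in> ball x\<^sub>0 r" using zt z(2) t p(2) le r by simp
      have ztb: "z - t *\<^sub>R e \<in> ball x\<^sub>0 r" using dist_triangle[of x\<^sub>0 "z - t *\<^sub>R e" z] zt z t r by simp
      have zb: "z \<in> ball x\<^sub>0 r" using z r by simp
      have "z \<notin> \<Omega>" using z(1) \<Omega>(2) by (simp add: frontier_def interior_open)
      then have hz: "h z \<le> 0" using eq zb by (metis (mono_tags, lifting) IntD1 mem_Collect_eq not_le)
      have hzt: "h (z - t *\<^sub>R e) = h z - t" using h[of "z - t *\<^sub>R e" t] by simp
      have "h p - h (z - t *\<^sub>R e) \<le> L * dist p (z - t *\<^sub>R e)" by (rule lip[OF pb ztb])
      also have "\<dots> \<le> L * (1 / (2 * L) * t)" using p L by (intro mult_left_mono) (auto simp: dist_commute)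
      also have "\<dots> = t / 2" using L by simp
      finally have "h p < 0" using hz hzt t by simp
      moreover have "p \<in> {x \<in> ball x\<^sub>0 r. h x > 0}" using p(1) pb eq by blast
      ultimately show False by simp
    qed
    then have "?P (r/4) (1 / (2 * L)) z" if "z \<in> frontier \<Omega> \<inter> ball x\<^sub>0 (r/4)" for z
      using that e by (intro exI[of _ e] conjI allI impI) simp_all
    then have "\<forall>z\<in>frontier \<Omega> \<inter> ball x\<^sub>0 (r/4). ?P (r/4) (1 / (2 * L)) z" by blast
    moreover have "0 < r / 4" "0 < 1 / (2 * L)" "1 / (2 * L) \<le> 1" using r L by auto
    ultimately show ?thesis by blast
  qed
  then obtain \<rho> c where *: "\<And>x\<^sub>0. x\<^sub>0 \<in> frontier \<Omega> \<Longrightarrow> 0 < \<rho> x\<^sub>0 \<and> 0 < c x\<^sub>0 \<and> c x\<^sub>0 \<le> 1 \<and>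
      (\<forall>z\<in>frontier \<Omega> \<inter> ball x\<^sub>0 (\<rho> x\<^sub>0). ?P (\<rho> x\<^sub>0) (c x\<^sub>0) z)"
    by metis
  have "compact (frontier \<Omega>)" using \<Omega> by (simp add: compact_frontier_bounded)
  moreover have "frontier \<Omega> \<subseteq> (\<Union>z\<in>frontier \<Omega>. ball z (\<rho> z))" using * by auto
  ultimately obtain Z where Z: "Z \<subseteq> frontier \<Omega>" "finite Z" "frontier \<Omega> \<subseteq> (\<Union>z\<in>Z. ball z (\<rho> z))"
    using compactE_image[of "frontier \<Omega>" "frontier \<Omega>" "\<lambda>z. ball z (\<rho> z)"] by (metis open_ball)
  \<comment> \<open>The inserted 1 keeps \<open>Min\<close> meaningful for an empty cover and yields
    the bound c \<le> 1 at once.\<close>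
  let ?R = "Min (insert 1 (\<rho> ` Z))" and ?c = "Min (insert 1 (c ` Z))"
  have "0 < ?R" "0 < ?c" "?c \<le> 1" using Z * by (auto simp: subset_iff)
  moreover have "?P ?R ?c z" if "z \<in> frontier \<Omega>" for z
  proof -
    obtain x where x: "x \<in> Z" "z \<in> ball x (\<rho> x)" using Z(3) \<open>z \<in> frontier \<Omega>\<close> by auto
    then have "?P (\<rho> x) (c x) z" using *[of x] Z(1) that by blast
    moreover have "?R \<le> \<rho> x" "?c \<le> c x" using x Z by auto
    show ?thesis
    proof -
      obtain e where e: "norm e = 1" "\<And>t. 0 < t \<Longrightarrow> t \<le> \<rho> x \<Longrightarrow> ball (z - t *\<^sub>R e) (c x * t) \<inter> \<Omega> = {}"
        using \<open>?P (\<rho> x) (c x) z\<close> by blast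
      have "ball (z - t *\<^sub>R e) (?c * t) \<inter> \<Omega> = {}" if "0 < t" "t \<le> ?R" for t
      proof -
        have "ball (z - t *\<^sub>R e) (?c * t) \<subseteq> ball (z - t *\<^sub>R e) (c x * t)"
          using \<open>?c \<le> c x\<close> that(1) by (intro subset_ball mult_right_mono) auto
        moreover have "t \<le> \<rho> x" using that(2) \<open>?R \<le> \<rho> x\<close> by (rule order_trans)
        ultimately show ?thesis using e(2)[OF that(1)] by blast
      qed
      then show ?thesis using e(1) by blast
    qed
  qed
  ultimately show ?thesis by blast
qed

text \<open>A nearest point z of the complement is a limit of points of \<Omega>: moving from z
  slightly towards y makes the distance to y smaller than the distance of y to the
  complement.\<close>

lemma nearest_boundary_point:
  fixes \<Omega> :: "'a::euclidean_space set"
  assumes "open \<Omega>" "- \<Omega> \<noteq> {}" "y \<in> \<Omega>"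
  obtains z where "z \<in> frontier \<Omega>" "dist y z = dist_compl \<Omega> y"
proof -
  obtain z where z: "z \<in> - \<Omega>" "infdist y (- \<Omega>) = dist y z"
    using infdist_attains_inf[of "- \<Omega>" y] assms by auto
  have d: "0 < dist y z" using z assms by auto
  have "z \<in> closure \<Omega>" unfolding closure_approachable
  proof (intro allI impI)
    fix \<epsilon> :: real assume \<epsilon>: "0 < \<epsilon>"
    define t where "t = min 1 (\<epsilon> / (2 * dist y z))"
    have t: "0 < t" "t \<le> 1" "t * dist y z < \<epsilon>" using \<epsilon> d by (auto simp: t_def min_def field_simps)
    let ?w = "z + t *\<^sub>R (y - z)"
    have "dist y ?w = (1 - t) * dist y z"
    proof -
      have "y - ?w = (1 - t) *\<^sub>R (y - z)" by (simp add: algebra_simps)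
      then show ?thesis using t by (simp add: dist_norm)
    qed
    also have "\<dots> < infdist y (- \<Omega>)" using t d z by simp
    finally have "dist y ?w < infdist y (- \<Omega>)" .
    then have "?w \<in> \<Omega>" using infdist_le[of ?w "- \<Omega>" y] by auto
    moreover have "dist ?w z < \<epsilon>" using t by (simp add: dist_norm norm_minus_commute)
    ultimately show "\<exists>y\<in>\<Omega>. dist y z < \<epsilon>" by blast
  qed
  then have "z \<in> frontier \<Omega>" using z(1) assms(1) by (simp add: frontier_def interior_open)
  then show thesis using that z by auto
qed

text \<open>The exterior cone at the boundary point nearest to y contains a ball of radius
  comparable to \<delta>(y), at distance at most 3 \<delta>(y) from y. Volume \<delta>^N times
  kernel \<delta>^(-N-s) gives \<delta>^(-s).\<close>

lemma exterior_potential_lower_bound: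
  fixes \<Omega> :: "'a::euclidean_space set" and s :: real
  assumes \<Omega>: "open \<Omega>" "bounded \<Omega>" "C2_boundary \<Omega>" and s: "0 < s"
  shows "\<exists>c>0. \<forall>y\<in>\<Omega>. ennreal (c * dist_compl \<Omega> y powr (-s))
    \<le> (\<integral>\<^sup>+x. ennreal (norm (x - y) powr (- (DIM('a) + s))) * indicator (- \<Omega>) x \<partial>lborel)"
proof (cases "\<Omega> = {}")
  case True then show ?thesis by (auto intro: exI[of _ 1])
next
  case False
  let ?d = "dist_compl \<Omega>" and ?N = "real DIM('a)"
  have ne: "- \<Omega> \<noteq> {}" using bounded_compl_nonempty[OF \<Omega>(2)] .
  obtain \<rho> c where \<rho>: "0 < \<rho>" and c: "0 < c" "c \<le> 1" and cone: "\<And>z. z \<in> frontier \<Omega> \<Longrightarrow>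
    \<exists>e. norm e = 1 \<and> (\<forall>t. 0 < t \<and> t \<le> \<rho> \<longrightarrow> ball (z - t *\<^sub>R e) (c * t) \<inter> \<Omega> = {})"
    using exterior_cone[OF \<Omega>(2,1,3)] by blast
  obtain z\<^sub>0 where z0: "z\<^sub>0 \<notin> \<Omega>" using ne by auto
  obtain D where D: "\<And>y. y \<in> \<Omega> \<Longrightarrow> dist y z\<^sub>0 \<le> D" using \<Omega>(2) bounded_any_center[of \<Omega> z\<^sub>0] by (auto simp: dist_commute)
  have D0: "0 < D" 
  proof -
    obtain y where "y \<in> \<Omega>" using False by auto
    then have "0 < dist y z\<^sub>0" "dist y z\<^sub>0 \<le> D" using z0 D by auto
    then show ?thesis by linarith
  qed
  have dD: "?d y \<le> D" if "y \<in> \<Omega>" for y using infdist_le[of z\<^sub>0 "-\<Omega>" y] z0 D[OF that] by auto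
  \<comment> \<open>The cone has height \<rho> only, whereas \<delta>(y) may be as large as D. The
    factor \<tau> makes t = \<tau> \<delta>(y) admissible for every y at once, while t stays
    proportional to \<delta>(y).\<close>
  define \<tau> where "\<tau> = min 1 (\<rho> / D)"
  have \<tau>: "0 < \<tau>" "\<tau> \<le> 1" "\<tau> * D \<le> \<rho>" using D0 \<rho> by (auto simp: \<tau>_def min_def field_simps)
  define C where "C = unit_ball_vol ?N * (c * \<tau>) powr ?N * 3 powr (- (?N + s))"
  show ?thesis
  proof (intro exI[of _ C] conjI ballI)
    show "0 < C" using c \<tau> by (simp add: C_def)
    fix y assume y: "y \<in> \<Omega>"
    have d: "0 < ?d y" using dist_compl_pos[OF \<Omega>(1) ne y] .
    obtain z where z: "z \<in> frontier \<Omega>" "dist y z = ?d y"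
      using nearest_boundary_point[OF \<Omega>(1) ne y] .
    define t where "t = \<tau> * ?d y"
    have t: "0 < t" "t \<le> ?d y" using \<tau> d by (auto simp: t_def mult_left_le_one_le)
    have "t \<le> \<tau> * D" unfolding t_def using dD[OF y] \<tau> by (intro mult_left_mono) auto
    then have t\<rho>: "t \<le> \<rho>" using \<tau> by simp
    obtain e where e: "norm e = 1" "ball (z - t *\<^sub>R e) (c * t) \<inter> \<Omega> = {}" using cone[OF z(1)] t t\<rho> by blast
    let ?B = "ball (z - t *\<^sub>R e) (c * t)"
    have "ennreal (C * ?d y powr (-s)) = (\<integral>\<^sup>+x. ennreal ((3 * ?d y) powr (- (?N + s))) * indicator ?B x \<partial>lborel)"
    proof -
      have "(\<integral>\<^sup>+x. ennreal ((3 * ?d y) powr (- (?N + s))) * indicator ?B x \<partial>lborel)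
        = ennreal ((3 * ?d y) powr (- (?N + s))) * ennreal (unit_ball_vol ?N * (c * t) powr ?N)"
        using c t by (subst nn_integral_cmult_indicator) (auto simp: emeasure_ball_powr simp del: emeasure_ball)
      also have "\<dots> = ennreal ((3 * ?d y) powr (- (?N + s)) * (unit_ball_vol ?N * (c * t) powr ?N))"
        by (simp add: ennreal_mult)
      also have "(3 * ?d y) powr (- (?N + s)) * (unit_ball_vol ?N * (c * t) powr ?N) = C * ?d y powr (-s)"
      proof -
        have "(c * t) powr ?N = (c * \<tau>) powr ?N * ?d y powr ?N" using c \<tau> d by (simp add: t_def powr_mult)
        moreover have "(3 * ?d y) powr (- (?N + s)) = 3 powr (- (?N + s)) * ?d y powr (- (?N + s))"
          using d by (simp add: powr_mult)
        moreover have "?d y powr (- (?N + s)) * ?d y powr ?N = ?d y powr (-s)"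
          by (simp add: powr_add[symmetric])
        ultimately show ?thesis by (simp add: C_def algebra_simps)
      qed
      finally show ?thesis ..
    qed
    also have "\<dots> \<le> (\<integral>\<^sup>+x. ennreal (norm (x - y) powr (- (?N + s))) * indicator (- \<Omega>) x \<partial>lborel)"
    proof (rule nn_integral_mono)
      fix x
      show "ennreal ((3 * ?d y) powr (- (?N + s))) * indicator ?B x \<le> ennreal (norm (x - y) powr (- (?N + s))) * indicator (- \<Omega>) x"
      proof (cases "x \<in> ?B")
        case True
        then have x: "x \<notin> \<Omega>" using e by auto
        have "c * t \<le> t" using c t by simp
        then have "dist (z - t *\<^sub>R e) x < t" using True by simp
        moreover have "dist z (z - t *\<^sub>R e) = t" using e t by (simp add: dist_norm)
        \<comment> \<open>From y to its boundary point, down the cone axis, then inside the small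
          ball: \<delta>(y) + t + t with t \<le> \<delta>(y). This is the factor 3 in the
          constant.\<close>
        ultimately have "dist y x \<le> ?d y + (t + t)"
          using z(2) dist_triangle[of y x z] dist_triangle[of z x "z - t *\<^sub>R e"] by simp
        then have "norm (x - y) \<le> 3 * ?d y" using t by (simp add: dist_norm norm_minus_commute)
        moreover have "0 < norm (x - y)" using x y by auto
        ultimately have "(3 * ?d y) powr (- (?N + s)) \<le> norm (x - y) powr (- (?N + s))"
          using s by (intro powr_mono2') auto
        then show ?thesis using True x by (simp add: ennreal_leI)
      qed simp
    qed
    finally show "ennreal (C * ?d y powr (-s)) \<le> \<dots>" .
  qed
qed

section \<open>Taylor expansion of test functions\<close>

lemma has_derivativeI_quadratic:
  fixes f :: "'a::real_normed_vector \<Rightarrow> real"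
  assumes "bounded_linear D" "\<And>h. \<bar>f (x + h) - f x - D h\<bar> \<le> C * norm h ^ 2"
  shows "(f has_derivative D) (at x)"
  unfolding has_derivative_at
proof (intro conjI assms(1))
  have "((\<lambda>h::'a. C * norm h) \<longlongrightarrow> C * 0) (at 0)"
    by (intro tendsto_mult tendsto_const tendsto_norm_zero tendsto_ident_at)
  then have lim: "((\<lambda>h::'a. C * norm h) \<longlongrightarrow> 0) (at 0)" by simp
  show "(\<lambda>h. norm (f (x + h) - f x - D h) / norm h) \<midarrow>0\<rightarrow> 0"
  proof (rule tendsto_sandwich[OF _ _ tendsto_const lim])
    have "norm (f (x + h) - f x - D h) / norm h \<le> C * norm h" for h
      using assms(2)[of h] by (cases "h = 0") (auto simp: field_simps power2_eq_square)
    then show "\<forall>\<^sub>F h in at 0. norm (f (x + h) - f x - D h) / norm h \<le> C * norm h" by simp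
  qed simp
qed

lemma frechet_derivative_eq_0_outside:
  fixes f :: "'a::euclidean_space \<Rightarrow> real"
  assumes "\<And>x. norm x > R \<Longrightarrow> f x = 0" "norm x > R"
  shows "frechet_derivative f (at x) = (\<lambda>_. 0)"
proof -
  have "open {x::'a. R < norm x}" by (intro open_Collect_less continuous_intros)
  then have "(f has_derivative (\<lambda>_. 0)) (at x)"
    using assms by (intro has_derivative_transform_within_open[OF has_derivative_const[of 0]]) auto
  then show ?thesis by (rule frechet_derivative_at[symmetric])
qed

lemma C1_compact_support_lipschitz:
  fixes f :: "'a::euclidean_space \<Rightarrow> real"
  assumes f: "Ck_on (Suc k) UNIV f" and supp: "\<And>x. norm x > R \<Longrightarrow> f x = 0"
  shows "\<exists>L\<ge>0. \<forall>x y. \<bar>f x - f y\<bar> \<le> L * dist x y"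
proof -
  let ?D = "\<lambda>x b. frechet_derivative f (at x) b"
  have "\<exists>M. \<forall>x. \<bar>?D x b\<bar> \<le> M" if "b \<in> Basis" for b
  proof -
    have "continuous_on (cball 0 R) (\<lambda>x. ?D x b)"
      using f that by (auto intro: continuous_on_subset[OF Ck_on_imp_continuous])
    then have "compact ((\<lambda>x. ?D x b) ` cball 0 R)" by (intro compact_continuous_image compact_cball)
    then have "bounded ((\<lambda>x. ?D x b) ` cball 0 R)" by (rule compact_imp_bounded)
    then obtain M where "\<forall>t\<in>(\<lambda>x. ?D x b) ` cball 0 R. norm t \<le> M"
      unfolding bounded_iff by (rule exE)
    then have M: "\<bar>?D x b\<bar> \<le> M" if "norm x \<le> R" for x using that by simp
    have "\<bar>?D x b\<bar> \<le> max M 0" for x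
    proof (cases "norm x \<le> R")
      case False
      then show ?thesis using frechet_derivative_eq_0_outside[of R f x] supp by simp
    qed (use M in force)
    then show ?thesis by blast
  qed
  then obtain M where M: "\<And>b x. b \<in> Basis \<Longrightarrow> \<bar>?D x b\<bar> \<le> M b" by metis
  let ?L = "\<Sum>b\<in>Basis. M b"
  have "norm (f x - f y) \<le> ?L * norm (x - y)" for x y
  proof (rule differentiable_bound[OF convex_UNIV])
    show "(f has_derivative ?D x) (at x within UNIV)" for x
      using f by (simp add: frechet_derivative_works)
    show "onorm (?D x) \<le> ?L" for x
    proof (rule onorm_le)
      fix v :: 'a
      have "norm (?D x v) \<le> (\<Sum>b\<in>Basis. \<bar>(v \<bullet> b) * ?D x b\<bar>)"
        using f by (subst frechet_derivative_sum_Basis) (simp_all only: real_norm_def sum_abs Ck_on.simps UNIV_I)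
      also have "\<dots> \<le> (\<Sum>b\<in>Basis. norm v * M b)"
        using M by (intro sum_mono) (auto simp: abs_mult Basis_le_norm intro!: mult_mono)
      finally show "norm (?D x v) \<le> ?L * norm v" by (simp add: sum_distrib_left mult.commute)
    qed
  qed auto
  moreover have "0 \<le> ?L" using M by (intro sum_nonneg) (meson abs_ge_zero order_trans)
  ultimately show ?thesis by (intro exI[of _ ?L]) (auto simp: dist_norm)
qed

text \<open>Mean value inequality for f minus its linearisation at x, on the ball of radius |h|:
  there the derivative is O(|h|) because the first partial derivatives are globally Lipschitz. The
  uniform quadratic remainder serves both to bound second differences and to differentiate
  convolutions.\<close>

lemma C2_compact_support_taylor:
  fixes f :: "'a::euclidean_space \<Rightarrow> real"
  assumes f: "Ck_on 2 UNIV f" and supp: "\<And>x. norm x > R \<Longrightarrow> f x = 0"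
  shows "\<exists>C\<ge>0. \<forall>x h. \<bar>f (x + h) - f x - frechet_derivative f (at x) h\<bar> \<le> C * norm h ^ 2"
proof -
  let ?D = "\<lambda>x b. frechet_derivative f (at x) b"
  have f2: "Ck_on (Suc 1) UNIV f" using f by (simp only: One_nat_def numeral_2_eq_2)
  have diff: "f differentiable (at x)" for x using f2 by (simp only: Ck_on.simps UNIV_I)
  have "\<exists>L\<ge>0. \<forall>x y. \<bar>?D x b - ?D y b\<bar> \<le> L * dist x y" if "b \<in> Basis" for b
  proof (rule C1_compact_support_lipschitz)
    show "Ck_on (Suc 0) UNIV (\<lambda>x. ?D x b)" using f2 that unfolding One_nat_def Ck_on.simps by blast
    show "?D x b = 0" if "R < norm x" for x using frechet_derivative_eq_0_outside[of R f x] supp that by simp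
  qed
  then obtain L where L: "\<And>b. b \<in> Basis \<Longrightarrow> 0 \<le> L b" "\<And>b x y. b \<in> Basis \<Longrightarrow> \<bar>?D x b - ?D y b\<bar> \<le> L b * dist x y"
    by metis
  let ?L = "\<Sum>b\<in>Basis. L b"
  have L0: "0 \<le> ?L" using L by (intro sum_nonneg) auto
  have "\<bar>f (x + h) - f x - ?D x h\<bar> \<le> ?L * norm h ^ 2" for x h
  proof -
    let ?g = "\<lambda>y. f y - ?D x y"
    have blin: "bounded_linear (?D x)" using diff[of x] frechet_derivative_works has_derivative_bounded_linear by blast
    have "norm (?g (x + h) - ?g x) \<le> (?L * norm h) * norm (x + h - x)"
    proof (rule differentiable_bound[of "cball x (norm h)" ?g "\<lambda>y v. ?D y v - ?D x v"])
      show "(?g has_derivative (\<lambda>v. ?D y v - ?D x v)) (at y within cball x (norm h))" for y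
        using diff[of y] blin
        by (intro has_derivative_diff bounded_linear_imp_has_derivative)
           (auto simp: frechet_derivative_works intro: has_derivative_at_withinI)
      show "onorm (\<lambda>v. ?D y v - ?D x v) \<le> ?L * norm h" if y: "y \<in> cball x (norm h)" for y
      proof (rule onorm_le)
        fix v :: 'a
        have "?D y v - ?D x v = (\<Sum>b\<in>Basis. (v \<bullet> b) * (?D y b - ?D x b))"
          using frechet_derivative_sum_Basis[OF diff, of y v] frechet_derivative_sum_Basis[OF diff, of x v]
          by (simp add: sum_subtractf right_diff_distrib)
        also have "norm \<dots> \<le> (\<Sum>b\<in>Basis. \<bar>(v \<bullet> b) * (?D y b - ?D x b)\<bar>)" by (simp only: real_norm_def sum_abs)
        also have "\<dots> \<le> (\<Sum>b\<in>Basis. norm v * (L b * norm h))"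
        proof (rule sum_mono)
          fix b :: 'a assume b: "b \<in> Basis"
          have "\<bar>?D y b - ?D x b\<bar> \<le> L b * dist y x" using L b by blast
          also have "\<dots> \<le> L b * norm h" using y L(1)[OF b] by (intro mult_left_mono) (auto simp: dist_commute)
          finally show "\<bar>(v \<bullet> b) * (?D y b - ?D x b)\<bar> \<le> norm v * (L b * norm h)"
            using b by (auto simp: abs_mult Basis_le_norm intro!: mult_mono)
        qed
        finally show "norm (?D y v - ?D x v) \<le> ?L * norm h * norm v"
          by (simp add: sum_distrib_left sum_distrib_right mult_ac)
      qed
    qed (auto simp: dist_norm)
    moreover have "?g (x + h) - ?g x = f (x + h) - f x - ?D x h"
      using blin by (simp add: linear_add bounded_linear.linear)
    ultimately show ?thesis by (simp add: power2_eq_square mult.assoc)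
  qed
  then show ?thesis using L0 by blast
qed

section \<open>Smooth bumps\<close>

text \<open>The polynomial parameter makes the family closed under differentiation: the derivative
  of p(1/t) exp(-1/t) is q(1/t) exp(-1/t) with q = X^2 (p - p'). Smoothness at 0 then needs only
  that every member tends to 0.\<close>

definition flat :: "real poly \<Rightarrow> real \<Rightarrow> real" where
  "flat p t = (if 0 < t then poly p (1 / t) * exp (- (1 / t)) else 0)"

lemma poly_exp_tendsto_0: "((\<lambda>y::real. poly p y * exp (- y)) \<longlongrightarrow> 0) at_top"
proof -
  have "((\<lambda>y. \<Sum>i\<le>degree p. coeff p i * (y ^ i / exp y)) \<longlongrightarrow> (\<Sum>i\<le>degree p. coeff p i * 0)) at_top"
    by (intro tendsto_intros tendsto_power_div_exp_0)
  then show ?thesis by (simp add: poly_altdef sum_distrib_right sum_divide_distrib exp_minus field_simps)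
qed

lemma flat_tendsto_0: "(flat p \<longlongrightarrow> 0) (at 0)"
proof -
  have "((\<lambda>t. poly p (inverse t) * exp (- inverse t)) \<longlongrightarrow> 0) (at_right 0)"
    using filterlim_compose[OF poly_exp_tendsto_0 filterlim_inverse_at_top_right] .
  then have "(flat p \<longlongrightarrow> 0) (at_right 0)"
    by (rule Lim_transform_eventually) (auto simp: eventually_at_right_field flat_def inverse_eq_divide intro: exI[of _ 1])
  moreover have "(flat p \<longlongrightarrow> 0) (at_left 0)"
    by (rule Lim_transform_eventually[OF tendsto_const]) (auto simp: eventually_at_left_field flat_def intro!: exI[of _ "-1"])
  ultimately show ?thesis by (simp add: filterlim_at_split)
qed

lemma flat_DERIV: "(flat p has_real_derivative flat ([:0, 0, 1:] * (p - pderiv p)) t) (at t)"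
proof -
  consider "t < 0" | "t = 0" | "0 < t" by linarith
  then show ?thesis
  proof cases
    case 1
    have "((\<lambda>_. 0) has_real_derivative 0) (at t)" by simp
    then have "(flat p has_real_derivative 0) (at t)"
      by (rule has_field_derivative_transform_within_open[of _ _ _ "{..<0}"]) (use 1 in \<open>auto simp: flat_def\<close>)
    then show ?thesis using 1 by (simp add: flat_def)
  next
    case 2
    \<comment> \<open>Dividing by h multiplies the polynomial in 1/h by X, so the difference
      quotient at 0 is again a member of the family.\<close>
    have eq: "(flat p (0 + h) - flat p 0) / h = flat ([:0, 1:] * p) h" for h
      by (auto simp: flat_def)
    have "((\<lambda>h. (flat p (0 + h) - flat p 0) / h) \<longlongrightarrow> 0) (at 0)"
      unfolding eq by (rule flat_tendsto_0)
    then show ?thesis using 2 by (simp add: DERIV_def flat_def)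
  next
    case 3
    have "((\<lambda>t. poly p (1 / t) * exp (- (1 / t))) has_real_derivative
        poly ([:0, 0, 1:] * (p - pderiv p)) (1 / t) * exp (- (1 / t))) (at t)"
      using 3 by (auto intro!: derivative_eq_intros DERIV_chain2[OF poly_DERIV] simp: field_simps power2_eq_square)
    then have "(flat p has_real_derivative poly ([:0, 0, 1:] * (p - pderiv p)) (1 / t) * exp (- (1 / t))) (at t)"
      by (rule has_field_derivative_transform_within_open[of _ _ _ "{0<..}"]) (use 3 in \<open>auto simp: flat_def\<close>)
    then show ?thesis using 3 by (simp add: flat_def)
  qed
qed

text \<open>A space of functions supported in the unit ball that is closed under partial derivatives.\<close>
inductive_set bumps :: "('a::euclidean_space \<Rightarrow> real) set" where
  flat: "(\<lambda>x. flat p (1 - x \<bullet> x)) \<in> bumps"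
| coord: "f \<in> bumps \<Longrightarrow> (\<lambda>x. (x \<bullet> b) * f x) \<in> bumps"
| scale: "f \<in> bumps \<Longrightarrow> (\<lambda>x. c * f x) \<in> bumps"
| add: "f \<in> bumps \<Longrightarrow> g \<in> bumps \<Longrightarrow> (\<lambda>x. f x + g x) \<in> bumps"

lemma bumps_eq_0: "f \<in> bumps \<Longrightarrow> 1 \<le> norm x \<Longrightarrow> f x = 0"
proof (induction rule: bumps.induct)
  case (flat p)
  then have "1 \<le> x \<bullet> x" by (simp add: dot_square_norm one_le_power)
  then show ?case by (simp add: flat_def)
qed auto

lemma bumps_deriv:
  "f \<in> bumps \<Longrightarrow> \<exists>D. (\<forall>x. (f has_derivative D x) (at x)) \<and> (\<forall>b. (\<lambda>x. D x b) \<in> bumps)"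
proof (induction rule: bumps.induct)
  case (flat p)
  let ?q = "[:0, 0, 1:] * (p - pderiv p)"
  let ?D = "\<lambda>(x::'a) v. (-2) * ((x \<bullet> v) * flat ?q (1 - x \<bullet> x))"
  show ?case
  proof (intro exI[of _ ?D] conjI allI)
    fix x :: 'a
    have "((\<lambda>x. 1 - x \<bullet> x) has_derivative (\<lambda>v. - (2 * (x \<bullet> v)))) (at x)"
      by (auto intro!: derivative_eq_intros simp: inner_commute)
    from has_derivative_compose[OF this flat_DERIV[unfolded has_field_derivative_def]]
    show "((\<lambda>x. flat p (1 - x \<bullet> x)) has_derivative ?D x) (at x)"
      by (rule has_derivative_eq_rhs) (simp add: fun_eq_iff)
  next
    fix b :: 'a
    show "(\<lambda>x. ?D x b) \<in> bumps" by (intro bumps.scale bumps.coord bumps.flat)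
  qed
next
  case (coord f c)
  then obtain D where D: "\<And>x. (f has_derivative D x) (at x)" "\<And>b. (\<lambda>x. D x b) \<in> bumps" by blast
  show ?case
  proof (intro exI[of _ "\<lambda>x v. (x \<bullet> c) * D x v + (v \<bullet> c) * f x"] conjI allI)
    show "((\<lambda>x. (x \<bullet> c) * f x) has_derivative (\<lambda>v. (x \<bullet> c) * D x v + (v \<bullet> c) * f x)) (at x)" for x
      by (auto intro!: derivative_eq_intros D)
    show "(\<lambda>x. (x \<bullet> c) * D x b + (b \<bullet> c) * f x) \<in> bumps" for b
      by (intro bumps.add bumps.coord bumps.scale D coord)
  qed
next
  case (scale f c)
  then obtain D where D: "\<And>x. (f has_derivative D x) (at x)" "\<And>b. (\<lambda>x. D x b) \<in> bumps" by blast
  show ?case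
    by (intro exI[of _ "\<lambda>x v. c * D x v"] conjI allI bumps.scale D) (auto intro!: derivative_eq_intros D)
next
  case (add f g)
  then obtain D E where D: "\<And>x. (f has_derivative D x) (at x)" "\<And>b. (\<lambda>x. D x b) \<in> bumps"
    and E: "\<And>x. (g has_derivative E x) (at x)" "\<And>b. (\<lambda>x. E x b) \<in> bumps" by blast
  show ?case
    by (intro exI[of _ "\<lambda>x v. D x v + E x v"] conjI allI bumps.add D E has_derivative_add)
qed

lemma bumps_frechet:
  assumes "f \<in> bumps"
  shows "f differentiable (at x)" "(\<lambda>x. frechet_derivative f (at x) b) \<in> bumps"
proof -
  obtain D where D: "\<And>x. (f has_derivative D x) (at x)" "\<And>b. (\<lambda>x. D x b) \<in> bumps"
    using bumps_deriv[OF assms] by blast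
  then have "frechet_derivative f (at x) = D x" for x by (metis frechet_derivative_at)
  then show "(\<lambda>x. frechet_derivative f (at x) b) \<in> bumps" using D by simp
  show "f differentiable (at x)" using D by (auto simp: differentiable_def)
qed

text \<open>The recursion in \<open>Ck_on\<close> passes from a function to its partial derivatives,
  so induction on k works for a whole class closed under them rather than for a single
  function.\<close>

lemma Ck_on_derivative_closed:
  assumes "\<And>f x. f \<in> S \<Longrightarrow> f differentiable (at x)"
    "\<And>f b. f \<in> S \<Longrightarrow> b \<in> Basis \<Longrightarrow> (\<lambda>x. frechet_derivative f (at x) b) \<in> S"
    and "f \<in> S"
  shows "Ck_on k UNIV f"
  using assms(3)
proof (induction k arbitrary: f)
  case 0
  then show ?case using assms(1)
    by (auto intro!: continuous_at_imp_continuous_on differentiable_imp_continuous_within)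
qed (use assms(1,2) in auto)

lemma bumps_Ck: "f \<in> bumps \<Longrightarrow> Ck_on k UNIV f"
  by (rule Ck_on_derivative_closed[of bumps]) (auto intro: bumps_frechet)

text \<open>The derivative passes under the integral because the Taylor remainder of a bump is
  quadratic uniformly in y and \<psi> is integrable. Each partial derivative is again a convolution
  with a bump, which puts the class of all such convolutions under
  \<open>Ck_on_derivative_closed\<close>. No regularity of \<psi> enters.\<close>

lemma bumps_convolution_Ck:
  fixes f :: "'a::euclidean_space \<Rightarrow> real"
  assumes f: "f \<in> bumps" and r: "0 < r" and \<psi>: "integrable lborel \<psi>"
  shows "Ck_on k UNIV (\<lambda>x. \<integral>y. f ((x - y) /\<^sub>R r) * \<psi> y \<partial>lborel)"
proof -
  let ?F = "\<lambda>f x. \<integral>y. f ((x - y) /\<^sub>R r) * \<psi> y \<partial>lborel"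
  have int: "integrable lborel (\<lambda>y. f ((x - y) /\<^sub>R r) * \<psi> y)" if f: "f \<in> bumps" for f :: "'a \<Rightarrow> real" and x
  proof -
    have cont: "continuous_on UNIV f" using bumps_Ck[OF f, of 0] by simp
    have [measurable]: "f \<in> borel_measurable borel" "\<psi> \<in> borel_measurable borel"
      using cont \<psi> by (auto intro: borel_measurable_continuous_onI)
    have "bounded (f ` cball 0 1)"
      using cont by (intro compact_imp_bounded compact_continuous_image) (auto intro: continuous_on_subset)
    then obtain M where "\<forall>y\<in>f ` cball 0 1. norm y \<le> M" unfolding bounded_iff by blast
    then have M: "\<And>x. norm x \<le> 1 \<Longrightarrow> \<bar>f x\<bar> \<le> M" by simp
    have M': "\<bar>f x\<bar> \<le> \<bar>M\<bar>" for x
      using M[of x] bumps_eq_0[OF f, of x] by (cases "norm x \<le> 1") auto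
    show ?thesis
    proof (rule Bochner_Integration.integrable_bound[of _ "\<lambda>y. \<bar>M\<bar> * \<psi> y"])
      show "integrable lborel (\<lambda>y. \<bar>M\<bar> * \<psi> y)" using \<psi> by simp
      show "AE y in lborel. norm (f ((x - y) /\<^sub>R r) * \<psi> y) \<le> norm (\<bar>M\<bar> * \<psi> y)"
        using M' by (auto simp: abs_mult intro!: mult_right_mono)
    qed measurable
  qed
  have deriv: "(?F f has_derivative (\<lambda>h. \<Sum>b\<in>Basis. (h \<bullet> b) * ?F (\<lambda>z. inverse r * frechet_derivative f (at z) b) x)) (at x)"
    if f: "f \<in> bumps" for f :: "'a \<Rightarrow> real" and x
  proof -
    let ?D = "\<lambda>x b. frechet_derivative f (at x) b"
    obtain C where C: "0 \<le> C" "\<And>x h. \<bar>f (x + h) - f x - ?D x h\<bar> \<le> C * norm h ^ 2"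
      using C2_compact_support_taylor[OF bumps_Ck[OF f], of 1] bumps_eq_0[OF f] less_imp_le by metis
    have Db: "(\<lambda>z. inverse r * ?D z b) \<in> bumps" for b by (intro bumps.scale bumps_frechet f)
    show ?thesis
    proof (rule has_derivativeI_quadratic)
      show "bounded_linear (\<lambda>h. \<Sum>b\<in>Basis. (h \<bullet> b) * ?F (\<lambda>z. inverse r * ?D z b) x)"
        by (intro bounded_linear_sum bounded_linear_mult_const bounded_linear_inner_left)
      fix h :: 'a
      let ?e = "\<lambda>y. (f ((x + h - y) /\<^sub>R r) * \<psi> y - f ((x - y) /\<^sub>R r) * \<psi> y)
          - (\<Sum>b\<in>Basis. (h \<bullet> b) * (inverse r * ?D ((x - y) /\<^sub>R r) b * \<psi> y))"
      have "?F f (x + h) - ?F f x - (\<Sum>b\<in>Basis. (h \<bullet> b) * ?F (\<lambda>z. inverse r * ?D z b) x) = (\<integral>y. ?e y \<partial>lborel)"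
        using int[OF f] int[OF Db] by (subst Bochner_Integration.integral_diff; simp)
      also have "\<bar>\<dots>\<bar> \<le> (\<integral>y. (C / r\<^sup>2 * norm h ^ 2) * \<bar>\<psi> y\<bar> \<partial>lborel)"
      proof (rule integral_abs_bound_integral)
        show "integrable lborel ?e" using int[OF f] int[OF Db] by simp
        show "integrable lborel (\<lambda>y. C / r\<^sup>2 * norm h ^ 2 * \<bar>\<psi> y\<bar>)" using \<psi> by simp
        fix y
        let ?z = "(x - y) /\<^sub>R r"
        have z: "(x + h - y) /\<^sub>R r = ?z + h /\<^sub>R r" by (simp add: algebra_simps)
        have "?D ?z (h /\<^sub>R r) = (\<Sum>b\<in>Basis. (h \<bullet> b) * (inverse r * ?D ?z b))"
          by (subst frechet_derivative_sum_Basis[OF bumps_frechet(1)[OF f]]) (simp add: mult_ac)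
        then have "?e y = (f (?z + h /\<^sub>R r) - f ?z - ?D ?z (h /\<^sub>R r)) * \<psi> y"
          by (simp only: z left_diff_distrib sum_distrib_right mult.assoc)
        then have "\<bar>?e y\<bar> = \<bar>f (?z + h /\<^sub>R r) - f ?z - ?D ?z (h /\<^sub>R r)\<bar> * \<bar>\<psi> y\<bar>" by (simp add: abs_mult)
        also have "\<dots> \<le> (C * norm (h /\<^sub>R r) ^ 2) * \<bar>\<psi> y\<bar>" by (intro mult_right_mono C) auto
        also have "C * norm (h /\<^sub>R r) ^ 2 = C / r\<^sup>2 * norm h ^ 2"
          using r by (simp add: power_mult_distrib power_inverse field_simps)
        finally show "\<bar>?e y\<bar> \<le> C / r\<^sup>2 * norm h ^ 2 * \<bar>\<psi> y\<bar>" .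
      qed
      also have "\<dots> = (C / r\<^sup>2 * (\<integral>y. \<bar>\<psi> y\<bar> \<partial>lborel)) * norm h ^ 2" by simp
      finally show "\<bar>?F f (x + h) - ?F f x - (\<Sum>b\<in>Basis. (h \<bullet> b) * ?F (\<lambda>z. inverse r * ?D z b) x)\<bar>
         \<le> (C / r\<^sup>2 * (\<integral>y. \<bar>\<psi> y\<bar> \<partial>lborel)) * norm h ^ 2" .
    qed
  qed
  show ?thesis
  proof (rule Ck_on_derivative_closed[of "?F ` bumps"])
    show "g differentiable (at x)" if "g \<in> ?F ` bumps" for g x
      using that deriv by (auto simp: differentiable_def)
    show "(\<lambda>x. frechet_derivative g (at x) b) \<in> ?F ` bumps" if g: "g \<in> ?F ` bumps" and b: "b \<in> Basis" for g b
    proof -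
      obtain f where f: "f \<in> bumps" "g = ?F f" using g by blast
      have "frechet_derivative g (at x) b = ?F (\<lambda>z. inverse r * frechet_derivative f (at z) b) x" for x
      proof -
        have "frechet_derivative g (at x) = (\<lambda>h. \<Sum>b\<in>Basis. (h \<bullet> b) * ?F (\<lambda>z. inverse r * frechet_derivative f (at z) b) x)"
          using frechet_derivative_at[OF deriv[OF f(1), of x]] unfolding f(2) by (rule sym)
        then show ?thesis using b by (simp add: inner_Basis if_distrib[of "\<lambda>t. t * _"] sum.delta cong: if_cong)
      qed
      then have "(\<lambda>x. frechet_derivative g (at x) b) = ?F (\<lambda>z. inverse r * frechet_derivative f (at z) b)" by auto
      moreover have "(\<lambda>z. inverse r * frechet_derivative f (at z) b) \<in> bumps"
        by (intro bumps.scale bumps_frechet f)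
      ultimately show ?thesis
        using image_eqI[of _ ?F "\<lambda>z. inverse r * frechet_derivative f (at z) b" bumps] by simp
    qed
    show "?F f \<in> ?F ` bumps" using f by blast
  qed
qed

section \<open>The classical bump exp(-1/(1-|x|^2)) and its rescalings\<close>

definition bump :: "'a::euclidean_space \<Rightarrow> real" where
  "bump x = flat [:1:] (1 - x \<bullet> x)"

lemma bump_in_bumps: "bump \<in> bumps"
  unfolding bump_def[abs_def] by (rule bumps.flat)

lemma bump_nonneg: "0 \<le> bump x"
  by (simp add: bump_def flat_def)

lemma bump_le_1: "bump x \<le> 1"
  by (simp add: bump_def flat_def)

lemma bump_minus: "bump (- x) = bump x"
  by (simp add: bump_def)

lemma bump_lower_bound: "norm x \<le> 1/2 \<Longrightarrow> exp (-2) \<le> bump x"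
proof -
  assume "norm x \<le> 1/2"
  then have "norm x ^ 2 \<le> (1/2)^2" by (intro power_mono) auto
  then have *: "1/2 \<le> 1 - x \<bullet> x" by (simp add: dot_square_norm power2_eq_square)
  then have "1 / (1 - x \<bullet> x) \<le> 2" by (simp add: field_simps)
  then show ?thesis using * by (simp add: bump_def flat_def)
qed

lemma continuous_bump: "continuous_on UNIV bump"
  using bumps_Ck[OF bump_in_bumps, of 0] by simp

lemma bump_measurable[measurable]: "bump \<in> borel_measurable borel"
  by (rule borel_measurable_continuous_onI[OF continuous_bump])

lemma bumps_affine_Ck:
  fixes f :: "'a::euclidean_space \<Rightarrow> real"
  assumes "f \<in> bumps"
  shows "Ck_on k UNIV (\<lambda>x. f ((x - x\<^sub>0) /\<^sub>R r))"
proof -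
  let ?F = "\<lambda>(f::'a\<Rightarrow>real) x. f ((x - x\<^sub>0) /\<^sub>R r)"
  have deriv: "(?F f has_derivative (\<lambda>h. inverse r * frechet_derivative f (at ((x - x\<^sub>0) /\<^sub>R r)) h)) (at x)"
    if f: "f \<in> bumps" for f :: "'a \<Rightarrow> real" and x
  proof -
    have D: "(f has_derivative frechet_derivative f (at z)) (at z)" for z
      using bumps_frechet(1)[OF f] frechet_derivative_works by blast
    have "((\<lambda>x. (x - x\<^sub>0) /\<^sub>R r) has_derivative (\<lambda>h. h /\<^sub>R r)) (at x)"
      by (auto intro!: derivative_eq_intros)
    from has_derivative_compose[OF this D] 
    have "(?F f has_derivative (\<lambda>h. frechet_derivative f (at ((x - x\<^sub>0) /\<^sub>R r)) (h /\<^sub>R r))) (at x)" .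
    moreover have "frechet_derivative f (at z) (h /\<^sub>R r) = inverse r * frechet_derivative f (at z) h" for z h
      using has_derivative_linear[OF D[of z]] by (simp add: linear_scale)
    ultimately show ?thesis by simp
  qed
  show ?thesis
  proof (rule Ck_on_derivative_closed[of "?F ` bumps"])
    show "g differentiable (at x)" if "g \<in> ?F ` bumps" for g x
      using that deriv by (auto simp: differentiable_def)
    show "(\<lambda>x. frechet_derivative g (at x) b) \<in> ?F ` bumps" if "g \<in> ?F ` bumps" for g b
    proof -
      obtain f where f: "f \<in> bumps" "g = ?F f" using \<open>g \<in> ?F ` bumps\<close> by blast
      have "(\<lambda>x. frechet_derivative g (at x) b) = ?F (\<lambda>z. inverse r * frechet_derivative f (at z) b)"
        using frechet_derivative_at[OF deriv[OF f(1)]] f(2) by (metis (no_types, lifting))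
      moreover have "(\<lambda>z. inverse r * frechet_derivative f (at z) b) \<in> bumps"
        by (intro bumps.scale bumps_frechet f)
      ultimately show ?thesis
        using image_eqI[of _ ?F "\<lambda>z. inverse r * frechet_derivative f (at z) b" bumps] by simp
    qed
    show "?F f \<in> ?F ` bumps" using assms by blast
  qed
qed

lemma test_functionsI:
  assumes "\<And>k. Ck_on k UNIV \<phi>" "compact K" "K \<subseteq> \<Omega>" "\<And>x. x \<notin> K \<Longrightarrow> \<phi> x = 0"
  shows "\<phi> \<in> test_functions \<Omega>"
proof -
  have "closure {x. \<phi> x \<noteq> 0} \<subseteq> K"
    using assms by (intro closure_minimal compact_imp_closed) auto
  then show ?thesis
    unfolding test_functions_def using assms
    by (auto simp: compact_eq_bounded_closed intro: bounded_subset)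
qed

lemma test_functions_supp:
  assumes "\<phi> \<in> test_functions \<Omega>"
  shows "compact (closure {x. \<phi> x \<noteq> 0})" "closure {x. \<phi> x \<noteq> 0} \<subseteq> \<Omega>" "Ck_on k UNIV \<phi>" "continuous_on UNIV \<phi>"
    "\<exists>R>0. \<forall>x. norm x > R \<longrightarrow> \<phi> x = 0"
proof -
  show *: "compact (closure {x. \<phi> x \<noteq> 0})" "closure {x. \<phi> x \<noteq> 0} \<subseteq> \<Omega>" "Ck_on k UNIV \<phi>" for k
    using assms by (auto simp: test_functions_def)
  show "continuous_on UNIV \<phi>" using *(3)[of 0] by simp
  have "bounded {x. \<phi> x \<noteq> 0}" using *(1) by (simp add: compact_eq_bounded_closed bounded_subset[OF _ closure_subset])
  then obtain R where "0 < R" "\<And>x. \<phi> x \<noteq> 0 \<Longrightarrow> norm x \<le> R" by (auto simp: bounded_pos)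
  then show "\<exists>R>0. \<forall>x. norm x > R \<longrightarrow> \<phi> x = 0" by (metis not_le)
qed

section \<open>The fractional Laplacian of smooth functions\<close>

lemma lborel_distr_reflect: "distr lborel borel (\<lambda>x. t - x) = (lborel :: 'a::euclidean_space measure)"
  by (subst (2) lborel_affine[of "-1" t]) (simp_all add: density_1 one_ennreal_def[symmetric])

lemma nn_integral_lborel_shift:
  assumes [measurable]: "f \<in> borel_measurable borel"
  shows "(\<integral>\<^sup>+x. f (a + x) \<partial>lborel) = (\<integral>\<^sup>+x. f x \<partial>(lborel :: 'a::euclidean_space measure))"
  by (subst (2) lborel_distr_plus[of a, symmetric]) (simp add: nn_integral_distr)

lemma integral_lborel_shift:
  fixes f :: "'a::euclidean_space \<Rightarrow> real"
  assumes [measurable]: "f \<in> borel_measurable borel"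
  shows "(\<integral>x. f (a + x) \<partial>lborel) = (\<integral>x. f x \<partial>lborel)"
  by (subst (2) lborel_distr_plus[of a, symmetric]) (simp add: integral_distr)

lemma integral_lborel_reflect:
  fixes f :: "'a::euclidean_space \<Rightarrow> real"
  assumes [measurable]: "f \<in> borel_measurable borel"
  shows "(\<integral>x. f (a - x) \<partial>lborel) = (\<integral>x. f x \<partial>lborel)"
  by (subst (2) lborel_distr_reflect[of a, symmetric]) (simp add: integral_distr)

lemma integrable_lborel_shift:
  fixes f :: "'a::euclidean_space \<Rightarrow> real"
  assumes "integrable lborel f"
  shows "integrable lborel (\<lambda>x. f (a + x))"
  by (rule integrable_distr[of "(+) a" lborel borel]) (use assms in \<open>simp_all add: lborel_distr_plus\<close>)

lemma integrable_lborel_reflect: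
  fixes f :: "'a::euclidean_space \<Rightarrow> real"
  assumes "integrable lborel f"
  shows "integrable lborel (\<lambda>x. f (a - x))"
  by (rule integrable_distr[of "(-) a" lborel borel]) (use assms in \<open>simp_all add: lborel_distr_reflect\<close>)

lemma integrable_lborel_product:
  fixes f :: "'a::euclidean_space \<Rightarrow> real" and g :: "'b::euclidean_space \<Rightarrow> real"
  assumes f: "integrable lborel f" and g: "integrable lborel g"
  shows "integrable (lborel \<Otimes>\<^sub>M lborel) (\<lambda>(x, y). f x * g y)"
proof (rule lborel_pair.Fubini_integrable)
  have [measurable]: "f \<in> borel_measurable borel" "g \<in> borel_measurable borel"
    using f g by auto
  show "(\<lambda>(x, y). f x * g y) \<in> borel_measurable (lborel \<Otimes>\<^sub>M lborel)" by measurable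
  show "integrable lborel (\<lambda>x. \<integral>y. norm (case (x, y) of (x, y) \<Rightarrow> f x * g y) \<partial>lborel)"
    using f by (simp add: abs_mult)
  show "AE x in lborel. integrable lborel (\<lambda>y. case (x, y) of (x, y) \<Rightarrow> f x * g y)"
    using g by simp
qed

text \<open>Here \<alpha> is the order of the operator and \<beta> the order to which the increment
  vanishes at z = 0: \<beta> = 2 for second differences, \<beta> = 1 for Lipschitz increments. The
  singularity at 0 is harmless since \<beta> > \<alpha>, the tail since \<alpha> > 0.\<close>

lemma kernel_min_integrable:
  fixes \<alpha> \<beta> :: real
  assumes "0 < \<alpha>" "\<alpha> < \<beta>" "\<beta> - \<alpha> < DIM('a)"
  shows "integrable lborel (\<lambda>z::'a::euclidean_space. min 1 (norm z powr \<beta>) * norm z powr (- (DIM('a) + \<alpha>)))"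
proof (rule integrableI_bounded)
  have [measurable]: "cball (0::'a) 1 \<in> sets borel" "{z::'a. 1 \<le> norm z} \<in> sets borel" by auto
  show "(\<lambda>z::'a. min 1 (norm z powr \<beta>) * norm z powr (- (DIM('a) + \<alpha>))) \<in> borel_measurable lborel" by measurable
  have "(\<integral>\<^sup>+z. ennreal (norm (min 1 (norm z powr \<beta>) * norm (z::'a) powr (- (DIM('a) + \<alpha>)))) \<partial>lborel)
    \<le> (\<integral>\<^sup>+z. ennreal (norm (z::'a) powr ((\<beta> - \<alpha>) - DIM('a))) * indicator (cball 0 1) z
      + ennreal (norm (z::'a) powr (- (DIM('a) + \<alpha>))) * indicator {z. 1 \<le> norm z} z \<partial>lborel)"
  proof (rule nn_integral_mono)
    fix z :: 'a
    show "ennreal (norm (min 1 (norm z powr \<beta>) * norm (z::'a) powr (- (DIM('a) + \<alpha>))))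
      \<le> ennreal (norm (z::'a) powr ((\<beta> - \<alpha>) - DIM('a))) * indicator (cball 0 1) z
      + ennreal (norm (z::'a) powr (- (DIM('a) + \<alpha>))) * indicator {z. 1 \<le> norm z} z"
    proof (cases "norm z < 1")
      case True
      have "norm (min 1 (norm z powr \<beta>) * norm z powr (- (DIM('a) + \<alpha>))) \<le> norm z powr \<beta> * norm z powr (- (DIM('a) + \<alpha>))"
        by (simp add: abs_mult mult_right_mono)
      also have "\<dots> = norm z powr ((\<beta> - \<alpha>) - DIM('a))" by (simp add: powr_add[symmetric] algebra_simps)
      finally show ?thesis using True by (simp add: ennreal_leI)
    next
      case False
      have "norm (min 1 (norm z powr \<beta>) * norm z powr (- (DIM('a) + \<alpha>))) \<le> 1 * norm z powr (- (DIM('a) + \<alpha>))"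
        unfolding norm_mult by (intro mult_mono) auto
      then show ?thesis using False by (auto simp: ennreal_leI intro!: add_increasing)
    qed
  qed
  also have "\<dots> = (\<integral>\<^sup>+z. ennreal (norm (z::'a) powr ((\<beta> - \<alpha>) - DIM('a))) * indicator (cball 0 1) z \<partial>lborel)
      + (\<integral>\<^sup>+z. ennreal (norm (z::'a) powr (- (DIM('a) + \<alpha>))) * indicator {z. 1 \<le> norm z} z \<partial>lborel)"
    by (rule nn_integral_add) measurable
  also have "\<dots> < \<infinity>"
    using nn_integral_norm_head[where 'a='a, of "\<beta> - \<alpha>" 1] nn_integral_norm_tail[where 'a='a, of \<alpha> 1] assms
    by (auto simp: less_top[symmetric] top_unique)
  finally show "(\<integral>\<^sup>+z. ennreal (norm (min 1 (norm z powr \<beta>) * norm (z::'a) powr (- (DIM('a) + \<alpha>)))) \<partial>lborel) < \<infinity>" .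
qed

text \<open>The sum of the increments \<phi>(x) - \<phi>(x + z) and \<phi>(x) - \<phi>(x - z).
  First-order terms cancel, which turns the principal value into an absolutely convergent
  integral.\<close>

definition second_diff :: "('a::euclidean_space \<Rightarrow> real) \<Rightarrow> 'a \<Rightarrow> 'a \<Rightarrow> real" where
  "second_diff \<phi> x z = 2 * \<phi> x - \<phi> (x + z) - \<phi> (x - z)"

text \<open>The regularity that makes the integral of second differences converge: the quadratic
  bound handles small z, boundedness large z, and continuity gives Borel measurability.\<close>

definition tame :: "('a::euclidean_space \<Rightarrow> real) \<Rightarrow> bool" where
  "tame \<phi> \<longleftrightarrow> continuous_on UNIV \<phi> \<and> (\<exists>M. \<forall>x. \<bar>\<phi> x\<bar> \<le> M) \<and> (\<exists>C. \<forall>x z. \<bar>second_diff \<phi> x z\<bar> \<le> C * norm z ^ 2)"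

lemma tame_measurable: "tame \<phi> \<Longrightarrow> \<phi> \<in> borel_measurable borel"
  by (auto simp: tame_def intro: borel_measurable_continuous_onI)

lemma tame_bound:
  assumes "tame \<phi>"
  obtains C where "0 \<le> C" "\<forall>x z. \<bar>second_diff \<phi> x z\<bar> \<le> C * min 1 (norm z powr 2)"
proof -
  obtain M C where M: "\<And>x. \<bar>\<phi> x\<bar> \<le> M" and C: "\<And>x z. \<bar>second_diff \<phi> x z\<bar> \<le> C * norm z ^ 2"
    using assms by (auto simp: tame_def)
  have M0: "0 \<le> M" using M[of 0] by linarith
  show thesis
  proof (rule that[of "\<bar>C\<bar> + 4 * M"], use M0 in simp, intro allI)
    fix x z
    have 1: "\<bar>second_diff \<phi> x z\<bar> \<le> (\<bar>C\<bar> + 4 * M) * 1"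
    proof -
      have "\<bar>second_diff \<phi> x z\<bar> \<le> 4 * M"
        using M[of x] M[of "x + z"] M[of "x - z"] by (auto simp: second_diff_def abs_le_iff)
      then show ?thesis by simp
    qed
    have "C * norm z ^ 2 \<le> (\<bar>C\<bar> + 4 * M) * norm z ^ 2" using M0 by (intro mult_right_mono) auto
    then have 2: "\<bar>second_diff \<phi> x z\<bar> \<le> (\<bar>C\<bar> + 4 * M) * norm z ^ 2" using C[of x z] by linarith
    have "norm z powr 2 = norm z ^ 2" by (cases "z = 0") (auto simp: powr_realpow)
    then show "\<bar>second_diff \<phi> x z\<bar> \<le> (\<bar>C\<bar> + 4 * M) * min 1 (norm z powr 2)"
      using 1 2 by (auto simp: min_def)
  qed
qed

lemma tame_second_diff_integrable:
  fixes \<phi> :: "'a::euclidean_space \<Rightarrow> real" and \<sigma> :: real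
  assumes \<phi>: "tame \<phi>" and \<sigma>: "0 < \<sigma>" "\<sigma> < 1" and dim: "2 \<le> DIM('a)"
  shows "integrable lborel (\<lambda>z. second_diff \<phi> x z * norm z powr (- (DIM('a) + 2 * \<sigma>)))"
proof -
  obtain C where C: "0 \<le> C" "\<forall>x z. \<bar>second_diff \<phi> x z\<bar> \<le> C * min 1 (norm z powr 2)"
    using tame_bound[OF \<phi>] .
  have [measurable]: "\<phi> \<in> borel_measurable borel" by (rule tame_measurable[OF \<phi>])
  have int: "integrable lborel (\<lambda>z::'a. C * (min 1 (norm z powr 2) * norm z powr (- (DIM('a) + 2 * \<sigma>))))"
    using kernel_min_integrable[where 'a='a, of "2 * \<sigma>" 2] \<sigma> dim by simp
  show ?thesis
    using int
  proof (rule Bochner_Integration.integrable_bound)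
    show "(\<lambda>z. second_diff \<phi> x z * norm z powr (- (DIM('a) + 2 * \<sigma>))) \<in> borel_measurable lborel"
      unfolding second_diff_def by measurable
    show "AE z in lborel. norm (second_diff \<phi> x z * norm z powr (- (DIM('a) + 2 * \<sigma>)))
      \<le> norm (C * (min 1 (norm z powr 2) * norm z powr (- (DIM('a) + 2 * \<sigma>))))"
    proof (rule AE_I2)
      fix z
      have "norm (second_diff \<phi> x z * norm z powr (- (DIM('a) + 2 * \<sigma>)))
        \<le> C * min 1 (norm z powr 2) * norm z powr (- (DIM('a) + 2 * \<sigma>))"
        using C by (simp add: abs_mult mult_right_mono)
      also have "\<dots> \<le> norm (C * (min 1 (norm z powr 2) * norm z powr (- (DIM('a) + 2 * \<sigma>))))"
        by (simp add: mult.assoc)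
      finally show "norm (second_diff \<phi> x z * norm z powr (- (DIM('a) + 2 * \<sigma>)))
        \<le> norm (C * (min 1 (norm z powr 2) * norm z powr (- (DIM('a) + 2 * \<sigma>))))" .
    qed
  qed
qed

text \<open>Away from the origin the kernel is integrable and even. Averaging the integral with its
  reflection replaces the increment by half the second difference.\<close>

lemma truncated_frac_lap:
  fixes \<phi> :: "'a::euclidean_space \<Rightarrow> real" and \<sigma> \<epsilon> M :: real
  assumes \<phi>: "\<phi> \<in> borel_measurable borel" "\<And>x. \<bar>\<phi> x\<bar> \<le> M" and \<sigma>: "0 < \<sigma>" and \<epsilon>: "0 < \<epsilon>"
  shows "(LINT y:- ball x \<epsilon>|lebesgue. (\<phi> x - \<phi> y) / dist x y powr (real DIM('a) + 2 * \<sigma>))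
    = (\<integral>z. indicator (- ball 0 \<epsilon>) z * (second_diff \<phi> x z * norm z powr (- (DIM('a) + 2 * \<sigma>))) \<partial>lborel) / 2"
proof -
  note [measurable] = \<phi>(1)
  let ?K = "\<lambda>z::'a. norm z powr (- (DIM('a) + 2 * \<sigma>))"
  define F where "F z = indicator (- ball 0 \<epsilon>) z * ((\<phi> x - \<phi> (x + z)) * ?K z)" for z
  have [measurable]: "F \<in> borel_measurable borel" unfolding F_def by measurable
  have M0: "0 \<le> M" using \<phi>(2)[of 0] by linarith
  have "(LINT y:- ball x \<epsilon>|lebesgue. (\<phi> x - \<phi> y) / dist x y powr (real DIM('a) + 2 * \<sigma>))
    = (\<integral>y. F (- x + y) \<partial>lebesgue)"
    unfolding set_lebesgue_integral_def
  proof (intro Bochner_Integration.integral_cong refl)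
    fix y
    have "norm (- x + y) = dist x y" "x + (- x + y) = y" "- x + y \<in> - ball 0 \<epsilon> \<longleftrightarrow> y \<in> - ball x \<epsilon>"
      by (simp_all add: dist_norm norm_minus_commute)
    then show "indicator (- ball x \<epsilon>) y *\<^sub>R ((\<phi> x - \<phi> y) / dist x y powr (real DIM('a) + 2 * \<sigma>)) = F (- x + y)"
      by (simp only: F_def indicator_def powr_minus_divide) simp
  qed
  also have "\<dots> = (\<integral>y. F (- x + y) \<partial>lborel)" by (rule integral_completion) measurable
  also have "\<dots> = (\<integral>z. F z \<partial>lborel)" by (rule integral_lborel_shift) measurable
  finally have 1: "(LINT y:- ball x \<epsilon>|lebesgue. (\<phi> x - \<phi> y) / dist x y powr (real DIM('a) + 2 * \<sigma>)) = (\<integral>z. F z \<partial>lborel)" .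
  have int: "integrable lborel F"
  proof (rule integrableI_bounded)
    have "(\<integral>\<^sup>+z. ennreal (norm (F z)) \<partial>lborel) \<le> (\<integral>\<^sup>+z. ennreal (2 * M) * (ennreal (?K z) * indicator {z. \<epsilon> \<le> norm z} z) \<partial>lborel)"
    proof (rule nn_integral_mono)
      fix z :: 'a
      have "\<bar>\<phi> x - \<phi> (x + z)\<bar> * ?K z \<le> 2 * M * ?K z"
        using \<phi>(2)[of x] \<phi>(2)[of "x + z"] by (intro mult_right_mono) auto
      then show "ennreal (norm (F z)) \<le> ennreal (2 * M) * (ennreal (?K z) * indicator {z. \<epsilon> \<le> norm z} z)"
        using M0 by (auto simp: F_def indicator_def abs_mult ennreal_mult[symmetric] intro!: ennreal_leI)
    qed
    also have "\<dots> = ennreal (2 * M) * (\<integral>\<^sup>+z. ennreal (?K z) * indicator {z. \<epsilon> \<le> norm z} z \<partial>lborel)"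
      by (rule nn_integral_cmult) measurable
    also have "\<dots> < \<infinity>"
    proof -
      have "(\<integral>\<^sup>+z. ennreal (?K z) * indicator {z. \<epsilon> \<le> norm z} z \<partial>lborel) < \<infinity>"
        by (rule le_less_trans[OF nn_integral_norm_tail[where 'a='a, of "2 * \<sigma>" \<epsilon>]]) (use \<sigma> \<epsilon> in auto)
      then show ?thesis by (simp only: ennreal_mult_less_top ennreal_less_top infinity_ennreal_def simp_thms)
    qed
    finally show "(\<integral>\<^sup>+z. ennreal (norm (F z)) \<partial>lborel) < \<infinity>" .
  qed measurable
  have int': "integrable lborel (\<lambda>z. F (0 - z))" using int by (rule integrable_lborel_reflect)
  have "2 * (\<integral>z. F z \<partial>lborel) = (\<integral>z. F z \<partial>lborel) + (\<integral>z. F (0 - z) \<partial>lborel)"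
    using integral_lborel_reflect[of F 0] by simp
  also have "\<dots> = (\<integral>z. F z + F (0 - z) \<partial>lborel)" using int int' by simp
  also have "\<dots> = (\<integral>z. indicator (- ball 0 \<epsilon>) z * (second_diff \<phi> x z * ?K z) \<partial>lborel)"
    by (intro Bochner_Integration.integral_cong) (auto simp: F_def second_diff_def indicator_def algebra_simps)
  finally show ?thesis using 1 by simp
qed

text \<open>The truncations in \<open>truncated_frac_lap\<close> are dominated by the full
  second-difference integrand, so the limit defining the principal value exists and equals the
  untruncated integral.\<close>

lemma frac_lap_tame:
  fixes \<phi> :: "'a::euclidean_space \<Rightarrow> real" and \<sigma> :: real
  assumes \<phi>: "tame \<phi>" and \<sigma>: "0 < \<sigma>" "\<sigma> < 1" and dim: "2 \<le> DIM('a)"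
  shows "frac_lap \<sigma> \<phi> x = frac_lap_const DIM('a) \<sigma> / 2 *
    (\<integral>z. second_diff \<phi> x z * norm z powr (- (DIM('a) + 2 * \<sigma>)) \<partial>lborel)"
proof -
  let ?G = "\<lambda>z. second_diff \<phi> x z * norm z powr (- (DIM('a) + 2 * \<sigma>))"
  obtain M where M: "\<And>x. \<bar>\<phi> x\<bar> \<le> M" using \<phi> by (auto simp: tame_def)
  have [measurable]: "\<phi> \<in> borel_measurable borel" by (rule tame_measurable[OF \<phi>])
  have int: "integrable lborel ?G" by (rule tame_second_diff_integrable[OF \<phi> \<sigma> dim])
  let ?T = "\<lambda>\<epsilon>. LINT y:- ball x \<epsilon>|lebesgue. (\<phi> x - \<phi> y) / dist x y powr (real DIM('a) + 2 * \<sigma>)"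
  have lim: "(?T \<longlongrightarrow> (\<integral>z. ?G z \<partial>lborel) / 2) (at_right 0)"
    unfolding tendsto_at_iff_sequentially
  proof (intro allI impI)
    fix X :: "nat \<Rightarrow> real" assume X: "\<forall>i. X i \<in> {0<..} - {0}" "X \<longlonglongrightarrow> 0"
    have "(\<lambda>n. \<integral>z. indicator (- ball 0 (X n)) z * ?G z \<partial>lborel) \<longlonglongrightarrow> (\<integral>z. ?G z \<partial>lborel)"
    proof (rule integral_dominated_convergence[where w="\<lambda>z. \<bar>?G z\<bar>"])
      show "?G \<in> borel_measurable lborel" using int by simp
      then show "(\<lambda>z. indicator (- ball 0 (X n)) z * ?G z) \<in> borel_measurable lborel" for n by measurable
      show "integrable lborel (\<lambda>z. \<bar>?G z\<bar>)" using int by simp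
      show "AE z in lborel. (\<lambda>n. indicator (- ball 0 (X n)) z * ?G z) \<longlonglongrightarrow> ?G z"
      proof (rule AE_I2)
        fix z
        show "(\<lambda>n. indicator (- ball 0 (X n)) z * ?G z) \<longlonglongrightarrow> ?G z"
        proof (cases "z = 0")
          case False
          then have "\<forall>\<^sub>F n in sequentially. X n < norm z" using X(2) by (intro order_tendstoD) auto
          then have "\<forall>\<^sub>F n in sequentially. ?G z = indicator (- ball 0 (X n)) z * ?G z"
            by eventually_elim (simp add: indicator_def)
          then show ?thesis by (rule Lim_transform_eventually[OF tendsto_const])
        qed simp
      qed
      show "AE z in lborel. norm (indicator (- ball 0 (X n)) z * ?G z) \<le> \<bar>?G z\<bar>" for n
        by (intro AE_I2) (auto simp: indicator_def)
    qed
    then have "(\<lambda>n. (\<integral>z. indicator (- ball 0 (X n)) z * ?G z \<partial>lborel) / 2) \<longlonglongrightarrow> (\<integral>z. ?G z \<partial>lborel) / 2"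
      by (intro tendsto_divide tendsto_const) auto
    moreover have "(?T \<circ> X) = (\<lambda>n. (\<integral>z. indicator (- ball 0 (X n)) z * ?G z \<partial>lborel) / 2)"
      unfolding comp_def using X(1) by (intro ext truncated_frac_lap[where M=M] M \<sigma>) auto
    ultimately show "(?T \<circ> X) \<longlonglongrightarrow> (\<integral>z. ?G z \<partial>lborel) / 2" by (simp only:)
  qed
  have "Lim (at_right 0) ?T = (\<integral>z. ?G z \<partial>lborel) / 2"
    by (rule tendsto_Lim[OF _ lim]) simp
  then show ?thesis unfolding frac_lap_def by simp
qed

lemma frac_lap_measurable:
  fixes \<phi> :: "'a::euclidean_space \<Rightarrow> real" and \<sigma> :: real
  assumes \<phi>: "tame \<phi>" and \<sigma>: "0 < \<sigma>" "\<sigma> < 1" and dim: "2 \<le> DIM('a)"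
  shows "frac_lap \<sigma> \<phi> \<in> borel_measurable borel"
proof -
  have [measurable]: "\<phi> \<in> borel_measurable borel" by (rule tame_measurable[OF \<phi>])
  have "(\<lambda>x. frac_lap_const DIM('a) \<sigma> / 2 *
    (\<integral>z. second_diff \<phi> x z * norm z powr (- (DIM('a) + 2 * \<sigma>)) \<partial>lborel)) \<in> borel_measurable borel"
    unfolding second_diff_def by measurable
  moreover have "frac_lap \<sigma> \<phi> = (\<lambda>x. frac_lap_const DIM('a) \<sigma> / 2 *
    (\<integral>z. second_diff \<phi> x z * norm z powr (- (DIM('a) + 2 * \<sigma>)) \<partial>lborel))"
    by (rule ext) (rule frac_lap_tame[OF \<phi> \<sigma> dim])
  ultimately show ?thesis by simp
qed

lemma frac_lap_bounded:
  fixes \<phi> :: "'a::euclidean_space \<Rightarrow> real" and \<sigma> :: real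
  assumes \<phi>: "tame \<phi>" and \<sigma>: "0 < \<sigma>" "\<sigma> < 1" and dim: "2 \<le> DIM('a)"
  shows "\<exists>B. \<forall>x. \<bar>frac_lap \<sigma> \<phi> x\<bar> \<le> B"
proof -
  let ?c = "frac_lap_const DIM('a) \<sigma> / 2" and ?K = "\<lambda>z::'a. norm z powr (- (DIM('a) + 2 * \<sigma>))"
  obtain C where C: "0 \<le> C" "\<forall>x z. \<bar>second_diff \<phi> x z\<bar> \<le> C * min 1 (norm z powr 2)"
    using tame_bound[OF \<phi>] .
  have "\<bar>frac_lap \<sigma> \<phi> x\<bar> \<le> \<bar>?c\<bar> * (\<integral>z. C * (min 1 (norm z powr 2) * ?K z) \<partial>lborel)" for x
  proof -
    have "\<bar>\<integral>z. second_diff \<phi> x z * ?K z \<partial>lborel\<bar> \<le> (\<integral>z. C * (min 1 (norm z powr 2) * ?K z) \<partial>lborel)"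
    proof (rule integral_abs_bound_integral)
      show "integrable lborel (\<lambda>z. second_diff \<phi> x z * ?K z)" by (rule tame_second_diff_integrable[OF \<phi> \<sigma> dim])
      show "integrable lborel (\<lambda>z::'a. C * (min 1 (norm z powr 2) * ?K z))"
        using kernel_min_integrable[where 'a='a, of "2 * \<sigma>" 2] \<sigma> dim by simp
      fix z :: 'a
      have "\<bar>second_diff \<phi> x z\<bar> * ?K z \<le> C * min 1 (norm z powr 2) * ?K z"
        using C by (intro mult_right_mono) auto
      then show "\<bar>second_diff \<phi> x z * ?K z\<bar> \<le> C * (min 1 (norm z powr 2) * ?K z)"
        by (simp add: abs_mult mult.assoc)
    qed
    then show ?thesis unfolding frac_lap_tame[OF \<phi> \<sigma> dim] abs_mult by (intro mult_left_mono) auto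
  qed
  then show ?thesis by blast
qed

text \<open>After Fubini the integral over x is inside. For each fixed z the second difference is a
  symmetric operator by translation invariance, and the kernel depends on z only.\<close>

lemma frac_lap_self_adjoint:
  fixes \<phi> \<psi> :: "'a::euclidean_space \<Rightarrow> real" and \<sigma> :: real
  assumes \<phi>: "tame \<phi>" "integrable lborel \<phi>" and \<psi>: "tame \<psi>" "integrable lborel \<psi>"
    and \<sigma>: "0 < \<sigma>" "\<sigma> < 1" and dim: "2 \<le> DIM('a)"
  shows "(\<integral>x. \<phi> x * frac_lap \<sigma> \<psi> x \<partial>lborel) = (\<integral>x. frac_lap \<sigma> \<phi> x * \<psi> x \<partial>lborel)"
proof -
  let ?c = "frac_lap_const DIM('a) \<sigma> / 2" and ?K = "\<lambda>z::'a. norm z powr (- (DIM('a) + 2 * \<sigma>))"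
  have *: "(\<integral>x. \<phi> x * frac_lap \<sigma> \<psi> x \<partial>lborel) = ?c * (\<integral>z. (\<integral>x. \<phi> x * second_diff \<psi> x z \<partial>lborel) * ?K z \<partial>lborel)"
    if \<phi>: "tame \<phi>" "integrable lborel \<phi>" and \<psi>: "tame \<psi>" for \<phi> \<psi> :: "'a \<Rightarrow> real"
  proof -
    have [measurable]: "\<phi> \<in> borel_measurable borel" "\<psi> \<in> borel_measurable borel"
      using tame_measurable \<phi> \<psi> by auto
    obtain C where C: "0 \<le> C" "\<forall>x z. \<bar>second_diff \<psi> x z\<bar> \<le> C * min 1 (norm z powr 2)"
      using tame_bound[OF \<psi>] .
    have int0: "integrable lborel (\<lambda>z::'a. C * (min 1 (norm z powr 2) * ?K z))"
      using kernel_min_integrable[where 'a='a, of "2 * \<sigma>" 2] \<sigma> dim by simp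
    have int: "integrable (lborel \<Otimes>\<^sub>M lborel) (\<lambda>(x, z). \<phi> x * (second_diff \<psi> x z * ?K z))"
      using integrable_lborel_product[OF \<phi>(2) int0]
    proof (rule Bochner_Integration.integrable_bound)
      show "(\<lambda>(x, z). \<phi> x * (second_diff \<psi> x z * ?K z)) \<in> borel_measurable (lborel \<Otimes>\<^sub>M lborel)"
        unfolding second_diff_def by measurable
      have "norm (\<phi> x * (second_diff \<psi> x z * ?K z)) \<le> norm (\<phi> x * (C * (min 1 (norm z powr 2) * ?K z)))" for x z
      proof -
        have "\<bar>second_diff \<psi> x z\<bar> * ?K z \<le> C * min 1 (norm z powr 2) * ?K z"
          using C by (intro mult_right_mono) auto
        then have "\<bar>\<phi> x\<bar> * (\<bar>second_diff \<psi> x z\<bar> * ?K z) \<le> \<bar>\<phi> x\<bar> * \<bar>C * min 1 (norm z powr 2) * ?K z\<bar>"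
          by (intro mult_left_mono) auto
        then show ?thesis by (simp add: abs_mult mult.assoc)
      qed
      then show "AE p in lborel \<Otimes>\<^sub>M lborel. norm (case p of (x, z) \<Rightarrow> \<phi> x * (second_diff \<psi> x z * ?K z))
         \<le> norm (case p of (x, z) \<Rightarrow> \<phi> x * (C * (min 1 (norm z powr 2) * ?K z)))"
        by (intro AE_I2) (auto split: prod.split)
    qed
    have "(\<integral>x. \<phi> x * frac_lap \<sigma> \<psi> x \<partial>lborel) = (\<integral>x. ?c * (\<integral>z. \<phi> x * (second_diff \<psi> x z * ?K z) \<partial>lborel) \<partial>lborel)"
      unfolding frac_lap_tame[OF \<psi> \<sigma> dim] by (simp add: mult_ac)
    also have "\<dots> = ?c * (\<integral>x. (\<integral>z. \<phi> x * (second_diff \<psi> x z * ?K z) \<partial>lborel) \<partial>lborel)" by simp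
    also have "(\<integral>x. (\<integral>z. \<phi> x * (second_diff \<psi> x z * ?K z) \<partial>lborel) \<partial>lborel)
        = (\<integral>z. (\<integral>x. \<phi> x * (second_diff \<psi> x z * ?K z) \<partial>lborel) \<partial>lborel)"
      by (rule lborel_pair.Fubini_integral[OF int, symmetric])
    also have "\<dots> = (\<integral>z. (\<integral>x. \<phi> x * second_diff \<psi> x z \<partial>lborel) * ?K z \<partial>lborel)"
      by (simp add: mult.assoc[symmetric])
    finally show ?thesis .
  qed
  have sym: "(\<integral>x. \<phi> x * second_diff \<psi> x z \<partial>lborel) = (\<integral>x. \<psi> x * second_diff \<phi> x z \<partial>lborel)" for z
  proof -
    have [measurable]: "\<phi> \<in> borel_measurable borel" "\<psi> \<in> borel_measurable borel"
      using tame_measurable \<phi> \<psi> by auto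
    have int: "integrable lborel (\<lambda>x. f x * g (x + a))" if fg: "integrable lborel f" "tame g" for f g :: "'a \<Rightarrow> real" and a
    proof -
      obtain M where M: "\<And>x. \<bar>g x\<bar> \<le> M" using fg by (auto simp: tame_def)
      have [measurable]: "g \<in> borel_measurable borel" "f \<in> borel_measurable borel" using tame_measurable fg by auto
      show ?thesis
      proof (rule Bochner_Integration.integrable_bound[of _ "\<lambda>x. M * f x"])
        show "integrable lborel (\<lambda>x. M * f x)" using fg by simp
        show "AE x in lborel. norm (f x * g (x + a)) \<le> norm (M * f x)"
        proof (rule AE_I2)
          fix x
          have "\<bar>f x\<bar> * \<bar>g (x + a)\<bar> \<le> \<bar>f x\<bar> * \<bar>M\<bar>" using M[of "x + a"] by (intro mult_left_mono) auto
          then show "norm (f x * g (x + a)) \<le> norm (M * f x)" by (simp add: abs_mult mult.commute)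
        qed
      qed measurable
    qed
    have expand: "(\<integral>x. f x * second_diff g x z \<partial>lborel)
      = 2 * (\<integral>x. f x * g x \<partial>lborel) - (\<integral>x. f x * g (x + z) \<partial>lborel) - (\<integral>x. f x * g (x + - z) \<partial>lborel)"
      if "integrable lborel f" "tame g" for f g :: "'a \<Rightarrow> real"
    proof -
      have "(\<integral>x. f x * second_diff g x z \<partial>lborel) = (\<integral>x. 2 * (f x * g (x + 0)) - f x * g (x + z) - f x * g (x + - z) \<partial>lborel)"
        by (intro Bochner_Integration.integral_cong) (auto simp: second_diff_def algebra_simps)
      also have "\<dots> = 2 * (\<integral>x. f x * g (x + 0) \<partial>lborel) - (\<integral>x. f x * g (x + z) \<partial>lborel) - (\<integral>x. f x * g (x + - z) \<partial>lborel)"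
        using int[OF that, of 0] int[OF that, of z] int[OF that, of "- z"] by simp
      finally show ?thesis by simp
    qed
    have shift: "(\<integral>x. \<phi> x * \<psi> (x + a) \<partial>lborel) = (\<integral>x. \<psi> x * \<phi> (x + - a) \<partial>lborel)" for a
    proof -
      have "(\<integral>x. \<phi> x * \<psi> (x + a) \<partial>lborel) = (\<integral>x. \<phi> (- a + x) * \<psi> (- a + x + a) \<partial>lborel)"
        using integral_lborel_shift[of "\<lambda>x. \<phi> x * \<psi> (x + a)" "- a"] by simp
      then show ?thesis by (simp add: add.commute mult.commute)
    qed
    show ?thesis
      unfolding expand[OF \<phi>(2) \<psi>(1)] expand[OF \<psi>(2) \<phi>(1)] using shift[of z] shift[of "- z"]
      by (simp add: mult.commute)
  qed
  have "(\<integral>x. \<phi> x * frac_lap \<sigma> \<psi> x \<partial>lborel) = (\<integral>x. \<psi> x * frac_lap \<sigma> \<phi> x \<partial>lborel)"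
    unfolding *[OF \<phi> \<psi>(1)] *[OF \<psi> \<phi>(1)] sym ..
  then show ?thesis by (simp add: mult.commute)
qed

section \<open>Smooth compactly supported functions as admissible tests\<close>

lemma test_function_tame:
  fixes \<phi> :: "'a::euclidean_space \<Rightarrow> real"
  assumes "\<phi> \<in> test_functions \<Omega>"
  shows "tame \<phi>" "integrable lborel \<phi>" "\<exists>L\<ge>0. \<forall>x y. \<bar>\<phi> x - \<phi> y\<bar> \<le> L * min 1 (dist x y)"
proof -
  have Ck: "Ck_on k UNIV \<phi>" and cont: "continuous_on UNIV \<phi>" for k
    using test_functions_supp[OF assms] by auto
  obtain R where R: "0 < R" "\<And>x. norm x > R \<Longrightarrow> \<phi> x = 0" using test_functions_supp(5)[OF assms] by blast
  obtain C where C: "0 \<le> C" "\<And>x h. \<bar>\<phi> (x + h) - \<phi> x - frechet_derivative \<phi> (at x) h\<bar> \<le> C * norm h ^ 2"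
    using C2_compact_support_taylor[OF Ck R(2)] by blast
  have "bounded (\<phi> ` cball 0 R)"
    using cont by (intro compact_imp_bounded compact_continuous_image) (auto intro: continuous_on_subset)
  then obtain M where "\<forall>y\<in>\<phi> ` cball 0 R. norm y \<le> M" unfolding bounded_iff by (rule exE)
  then have M: "\<And>x. norm x \<le> R \<Longrightarrow> \<bar>\<phi> x\<bar> \<le> M" by simp
  have M': "\<bar>\<phi> x\<bar> \<le> \<bar>M\<bar>" for x
    using M[of x] R(2)[of x] by (cases "norm x \<le> R") auto
  have "\<bar>second_diff \<phi> x z\<bar> \<le> (2 * C) * norm z ^ 2" for x z
  proof -
    \<comment> \<open>The second difference is minus the sum of the Taylor remainders for z and -z,
      because the linear terms cancel. This is where 2 C comes from.\<close>
    have "linear (frechet_derivative \<phi> (at x))"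
      using Ck[of "Suc 0"] by (intro linear_frechet_derivative) simp
    then have "frechet_derivative \<phi> (at x) (- z) = - frechet_derivative \<phi> (at x) z" by (rule linear_neg)
    then show ?thesis using C(2)[of x z] C(2)[of x "- z"] unfolding second_diff_def by simp
  qed
  then show "tame \<phi>" using cont M' unfolding tame_def by blast
  have "integrable lborel (\<lambda>x. indicator (cball 0 R) x *\<^sub>R \<phi> x)"
    by (rule borel_integrable_compact) (auto intro: continuous_on_subset[OF cont])
  moreover have "(\<lambda>x. indicator (cball 0 R) x *\<^sub>R \<phi> x) = \<phi>"
    using R(2) by (auto simp: indicator_def fun_eq_iff not_le)
  ultimately show "integrable lborel \<phi>" by simp
  obtain L where L: "0 \<le> L" "\<And>x y. \<bar>\<phi> x - \<phi> y\<bar> \<le> L * dist x y"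
    using C1_compact_support_lipschitz[OF Ck[of "Suc 0"] R(2)] by blast
  show "\<exists>L\<ge>0. \<forall>x y. \<bar>\<phi> x - \<phi> y\<bar> \<le> L * min 1 (dist x y)"
  proof (intro exI[of _ "L + 2 * \<bar>M\<bar>"] conjI allI)
    fix x y
    have "\<bar>\<phi> x - \<phi> y\<bar> \<le> (L + 2 * \<bar>M\<bar>) * 1" 
    proof -
      have "\<bar>\<phi> x - \<phi> y\<bar> \<le> 2 * \<bar>M\<bar>" using M'[of x] M'[of y] by (auto simp only: abs_le_iff)
      then show ?thesis using L(1) by simp
    qed
    moreover have "L * dist x y \<le> (L + 2 * \<bar>M\<bar>) * dist x y" by (intro mult_right_mono) auto
    ultimately show "\<bar>\<phi> x - \<phi> y\<bar> \<le> (L + 2 * \<bar>M\<bar>) * min 1 (dist x y)" using L(2)[of x y] by (auto simp: min_def)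
  qed (use L in auto)
qed

text \<open>Self-adjointness identifies the distributional fractional Laplacian of a test function
  with the pointwise one, which is bounded. Hence the weak formulation may be tested with
  C_c^infinity(\<Omega>), and the pointwise operator may be used for h.\<close>

lemma test_function_in_X:
  fixes \<phi> :: "'a::euclidean_space \<Rightarrow> real"
  assumes \<phi>: "\<phi> \<in> test_functions \<Omega>" and \<Omega>: "open \<Omega>" and s: "0 < s" "s < 1" and dim: "2 \<le> DIM('a)"
  shows "\<phi> \<in> test_space_X s \<Omega>" "has_frac_lap_on s \<Omega> \<phi> (frac_lap s \<phi>)"
proof -
  have tame: "tame \<phi>" and int: "integrable lborel \<phi>" using test_function_tame[OF \<phi>] by auto
  have zero: "\<phi> x = 0" if "x \<notin> \<Omega>" for x
    using test_functions_supp(2)[OF \<phi>] closure_subset[of "{x. \<phi> x \<noteq> 0}"] that by blast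
  obtain B where B: "\<And>x. \<bar>frac_lap s \<phi> x\<bar> \<le> B" using frac_lap_bounded[OF tame s dim] by blast
  have meas[measurable]: "frac_lap s \<phi> \<in> borel_measurable borel" by (rule frac_lap_measurable[OF tame s dim])
  have [measurable]: "\<Omega> \<in> sets borel" using \<Omega> by simp
  show hfl: "has_frac_lap_on s \<Omega> \<phi> (frac_lap s \<phi>)"
    unfolding has_frac_lap_on_def
  proof (intro conjI allI impI ballI)
    fix K assume K: "compact K \<and> K \<subseteq> \<Omega>"
    then have [measurable]: "K \<in> sets borel" by (auto intro: borel_compact)
    have "integrable lborel (\<lambda>x. indicator K x *\<^sub>R frac_lap s \<phi> x)"
    proof (rule Bochner_Integration.integrable_bound[of _ "\<lambda>x. B * indicator K x"])
      show "integrable lborel (\<lambda>x. B * indicator K x :: real)"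
        using K by (intro integrable_mult_right integrable_real_indicator emeasure_compact_finite) auto
      show "AE x in lborel. norm (indicator K x *\<^sub>R frac_lap s \<phi> x) \<le> norm (B * indicator K x)"
        using B by (intro AE_I2) (auto simp: indicator_def abs_mult intro: order_trans[OF B abs_ge_self])
    qed measurable
    then show "set_integrable lebesgue K (frac_lap s \<phi>)"
      unfolding set_integrable_def by (rule integrable_completion[THEN iffD2, rotated]) measurable
  next
    fix \<psi> assume \<psi>: "\<psi> \<in> test_functions \<Omega>"
    have tame': "tame \<psi>" and int': "integrable lborel \<psi>" using test_function_tame[OF \<psi>] by auto
    have [measurable]: "\<phi> \<in> borel_measurable borel" "\<psi> \<in> borel_measurable borel" "frac_lap s \<psi> \<in> borel_measurable borel"
      using tame_measurable tame tame' frac_lap_measurable[OF tame' s dim] by auto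
    have zero': "\<psi> x = 0" if "x \<notin> \<Omega>" for x
      using test_functions_supp(2)[OF \<psi>] closure_subset[of "{x. \<psi> x \<noteq> 0}"] that by blast
    have "(LINT x|lebesgue. \<phi> x * frac_lap s \<psi> x) = (\<integral>x. \<phi> x * frac_lap s \<psi> x \<partial>lborel)"
      by (rule integral_completion) measurable
    also have "\<dots> = (\<integral>x. frac_lap s \<phi> x * \<psi> x \<partial>lborel)"
      by (rule frac_lap_self_adjoint[OF tame int tame' int' s dim])
    also have "\<dots> = (\<integral>x. frac_lap s \<phi> x * \<psi> x \<partial>lebesgue)"
      by (rule integral_completion[symmetric]) measurable
    also have "\<dots> = (LINT x:\<Omega>|lebesgue. frac_lap s \<phi> x * \<psi> x)"
      unfolding set_lebesgue_integral_def
      by (intro Bochner_Integration.integral_cong) (auto simp: indicator_def zero')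
    finally show "(LINT x|lebesgue. \<phi> x * frac_lap s \<psi> x) = (LINT x:\<Omega>|lebesgue. frac_lap s \<phi> x * \<psi> x)" .
  qed
  have "\<phi> \<in> holder_space s"
  proof -
    obtain L where L: "0 \<le> L" "\<And>x y. \<bar>\<phi> x - \<phi> y\<bar> \<le> L * min 1 (dist x y)"
      using test_function_tame(3)[OF \<phi>] by blast
    obtain M where M: "\<And>x. \<bar>\<phi> x\<bar> \<le> M" using tame by (auto simp: tame_def)
    have "bounded (range \<phi>)" using M by (auto simp: bounded_iff)
    moreover have "\<bar>\<phi> x - \<phi> y\<bar> \<le> L * dist x y powr s" for x y
    proof -
      \<comment> \<open>A bounded Lipschitz function is Hoelder of any order s in (0,1): below
        distance 1 the smaller power is larger, above it both sides compare with 1.\<close>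
      have "min 1 (dist x y) \<le> dist x y powr s"
      proof (cases "dist x y \<le> 1")
        case True
        then show ?thesis using powr_mono'[of s 1 "dist x y"] s by auto
      next
        case False
        then show ?thesis using ge_one_powr_ge_zero[of "dist x y" s] s by auto
      qed
      then show ?thesis using L(2)[of x y] mult_left_mono[OF _ L(1)] by (meson order_trans)
    qed
    ultimately show ?thesis unfolding holder_space_def by blast
  qed
  moreover have "frac_lap s \<phi> \<in> Linf_space (lebesgue_on \<Omega>)"
  proof -
    have "frac_lap s \<phi> \<in> borel_measurable (lebesgue_on \<Omega>)"
      by (intro measurable_restrict_space1 measurable_completion) simp
    then show ?thesis unfolding Linf_space_def using B by auto
  qed
  ultimately show "\<phi> \<in> test_space_X s \<Omega>"
    unfolding test_space_X_def using zero hfl by blast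
qed

text \<open>The sign test bounds the pairing with (-\<Delta>)^(s/2), and the energy form is
  recovered by dividing by this constant. \<open>Gamma\<close> is 0 at its poles by convention, so
  -\<sigma> has to be shown not to be one.\<close>

lemma frac_lap_const_nonzero:
  assumes "0 < \<sigma>" "\<sigma> < 1"
  shows "frac_lap_const (real N) \<sigma> \<noteq> 0"
proof -
  have "Gamma (real N / 2 + \<sigma>) > 0" using assms by (intro Gamma_real_pos) (simp add: add_nonneg_pos)
  moreover have "- \<sigma> \<notin> \<int>\<^sub>\<le>\<^sub>0"
  proof
    assume "- \<sigma> \<in> \<int>\<^sub>\<le>\<^sub>0"
    then obtain n where "- \<sigma> = - real n" by (auto elim!: nonpos_Ints_cases')
    then show False using assms by auto
  qed
  ultimately have "Gamma (real N / 2 + \<sigma>) \<noteq> 0" "Gamma (- \<sigma>) \<noteq> 0"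
    by (linarith, simp only: Gamma_eq_zero_iff not_False_eq_True)
  then show ?thesis unfolding frac_lap_const_def by (simp del: Gamma_eq_zero_iff)
qed

section \<open>Estimates with scaled bumps\<close>

lemma nn_integral_lincomb:
  assumes "f \<in> borel_measurable M" "g \<in> borel_measurable M"
  shows "(\<integral>\<^sup>+x. c * f x + d * g x \<partial>M) = c * (\<integral>\<^sup>+x. f x \<partial>M) + d * (\<integral>\<^sup>+x. g x \<partial>M)"
  using assms by (simp add: nn_integral_add nn_integral_cmult)

lemma norm_scaled_diff: "0 < r \<Longrightarrow> norm ((x - y) /\<^sub>R r) = dist x y / r"
  by (simp add: dist_norm divide_inverse mult.commute)

lemma bump_scaled_test_function:
  assumes "0 < r" "cball x\<^sub>0 r \<subseteq> \<Omega>"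
  shows "(\<lambda>x. bump ((x - x\<^sub>0) /\<^sub>R r)) \<in> test_functions \<Omega>"
proof (rule test_functionsI[OF bumps_affine_Ck[OF bump_in_bumps] compact_cball assms(2)])
  fix x assume "x \<notin> cball x\<^sub>0 r"
  then have "1 \<le> norm ((x - x\<^sub>0) /\<^sub>R r)" using assms(1)
    unfolding norm_scaled_diff[OF assms(1)] by (simp add: dist_commute)
  then show "bump ((x - x\<^sub>0) /\<^sub>R r) = 0" by (rule bumps_eq_0[OF bump_in_bumps])
qed

lemma bump_scaled_tame: "0 < r \<Longrightarrow> tame (\<lambda>x::'a::euclidean_space. bump ((x - x\<^sub>0) /\<^sub>R r))"
  using test_function_tame(1)[OF bump_scaled_test_function[of r x\<^sub>0 UNIV]] by simp

text \<open>The power r^(-2s) is the scaling of an operator of order 2s. The kernel integral is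
  split at |z| = r: inside, the second difference is O(|z|^2 / r^2); outside, it is bounded.\<close>

lemma bump_frac_lap_near:
  fixes s :: real
  assumes s: "0 < s" "s < 1" and dim: "2 \<le> DIM('a::euclidean_space)"
  shows "\<exists>C\<ge>0. \<forall>(x\<^sub>0::'a) r x. 0 < r \<longrightarrow> \<bar>frac_lap s (\<lambda>x. bump ((x - x\<^sub>0) /\<^sub>R r)) x\<bar> \<le> C * r powr (- 2 * s)"
proof -
  let ?N = "real DIM('a)" and ?c = "frac_lap_const DIM('a) s / 2"
  let ?K = "\<lambda>z::'a. norm z powr (- (?N + 2 * s))"
  have "tame (bump :: 'a \<Rightarrow> real)" using bump_scaled_tame[of 1 "0::'a"] by simp
  then obtain A where A: "0 \<le> A" "\<And>x z::'a. \<bar>second_diff bump x z\<bar> \<le> A * min 1 (norm z powr 2)"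
    using tame_bound by metis
  \<comment> \<open>Constants of the radial integrals with exponent 2 - 2s inside the ball and 2s
    outside.\<close>
  define C\<^sub>1 where "C\<^sub>1 = ?N * unit_ball_vol ?N / (2 - 2 * s)"
  define C\<^sub>2 where "C\<^sub>2 = (?N + 2 * s) * unit_ball_vol ?N / (2 * s)"
  have C12: "0 \<le> C\<^sub>1" "0 \<le> C\<^sub>2" using s by (auto simp: C\<^sub>1_def C\<^sub>2_def)
  show ?thesis
  proof (intro exI[of _ "\<bar>?c\<bar> * (A * (C\<^sub>1 + C\<^sub>2))"] conjI allI impI)
    show "0 \<le> \<bar>?c\<bar> * (A * (C\<^sub>1 + C\<^sub>2))" using A C12 by simp
    fix x\<^sub>0 x :: 'a and r :: real assume r: "0 < r"
    let ?\<phi> = "\<lambda>x. bump ((x - x\<^sub>0) /\<^sub>R r)"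
    have tame: "tame ?\<phi>" using bump_scaled_tame[OF r] .
    have [measurable]: "cball (0::'a) r \<in> sets borel" "{z::'a. r \<le> norm z} \<in> sets borel" by auto
    have sd: "\<bar>second_diff ?\<phi> x z\<bar> \<le> A * min 1 ((norm z / r) powr 2)" for z
    proof -
      have "second_diff ?\<phi> x z = second_diff bump ((x - x\<^sub>0) /\<^sub>R r) (z /\<^sub>R r)"
        by (simp add: second_diff_def algebra_simps)
      then show ?thesis using A(2)[of "(x - x\<^sub>0) /\<^sub>R r" "z /\<^sub>R r"] r by (simp add: divide_inverse mult.commute)
    qed
    have "ennreal (norm (\<integral>z. second_diff ?\<phi> x z * ?K z \<partial>lborel)) \<le> (\<integral>\<^sup>+z. ennreal (norm (second_diff ?\<phi> x z * ?K z)) \<partial>lborel)"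
      by (rule integral_norm_bound_ennreal[OF tame_second_diff_integrable[OF tame s dim]])
    also have "\<dots> \<le> (\<integral>\<^sup>+z. ennreal (A * r powr (-2)) * (ennreal (norm (z::'a) powr ((2 - 2 * s) - ?N)) * indicator (cball 0 r) z)
        + ennreal A * (ennreal (norm z powr (- (?N + 2 * s))) * indicator {z. r \<le> norm z} z) \<partial>lborel)"
    proof (rule nn_integral_mono)
      fix z :: 'a
      show "ennreal (norm (second_diff ?\<phi> x z * ?K z))
        \<le> ennreal (A * r powr (-2)) * (ennreal (norm z powr ((2 - 2 * s) - ?N)) * indicator (cball 0 r) z)
        + ennreal A * (ennreal (norm z powr (- (?N + 2 * s))) * indicator {z. r \<le> norm z} z)"
      proof (cases "norm z < r")
        case True
        have "norm (second_diff ?\<phi> x z * ?K z) \<le> (A * (norm z / r) powr 2) * ?K z"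
          unfolding norm_mult using order_trans[OF sd[of z] mult_left_mono[OF min.cobounded2 A(1)]]
          by (intro mult_mono) auto
        also have "(norm z / r) powr 2 = r powr (-2) * norm z powr 2"
          using r by (simp add: powr_divide powr_minus_divide)
        also have "(A * (r powr (-2) * norm z powr 2)) * ?K z = A * r powr (-2) * (norm z powr 2 * ?K z)" by simp
        also have "norm z powr 2 * ?K z = norm z powr ((2 - 2 * s) - ?N)"
          by (subst powr_add[symmetric]) (simp add: algebra_simps)
        finally show ?thesis using True A by (simp add: ennreal_mult[symmetric] ennreal_leI)
      next
        case False
        have "norm (second_diff ?\<phi> x z * ?K z) \<le> A * ?K z"
          unfolding norm_mult using order_trans[OF sd[of z] mult_left_mono[OF min.cobounded1 A(1)]]
          by (intro mult_mono) auto
        then have "ennreal (norm (second_diff ?\<phi> x z * ?K z)) \<le> ennreal A * ennreal (?K z)"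
          using A by (simp add: ennreal_mult[symmetric] ennreal_leI)
        then show ?thesis using False by (auto intro!: add_increasing)
      qed
    qed
    also have "\<dots> = ennreal (A * r powr (-2)) * (\<integral>\<^sup>+z. ennreal (norm (z::'a) powr ((2 - 2 * s) - ?N)) * indicator (cball 0 r) z \<partial>lborel)
        + ennreal A * (\<integral>\<^sup>+z. ennreal (norm (z::'a) powr (- (?N + 2 * s))) * indicator {z. r \<le> norm z} z \<partial>lborel)"
      by (rule nn_integral_lincomb) measurable
    also have "\<dots> \<le> ennreal (A * r powr (-2)) * ennreal (C\<^sub>1 * r powr (2 - 2 * s)) + ennreal A * ennreal (C\<^sub>2 * r powr (- (2 * s)))"
      unfolding C\<^sub>1_def C\<^sub>2_def using s r dim
      by (intro add_mono mult_left_mono nn_integral_norm_head nn_integral_norm_tail) auto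
    also have "\<dots> = ennreal (A * r powr (-2) * (C\<^sub>1 * r powr (2 - 2 * s)) + A * (C\<^sub>2 * r powr (- (2 * s))))"
      using A C12 by (simp add: ennreal_mult[symmetric] ennreal_plus[symmetric] del: ennreal_plus)
    also have "A * r powr (-2) * (C\<^sub>1 * r powr (2 - 2 * s)) + A * (C\<^sub>2 * r powr (- (2 * s))) = A * (C\<^sub>1 + C\<^sub>2) * r powr (- 2 * s)"
    proof -
      have "r powr (-2) * r powr (2 - 2 * s) = r powr (- 2 * s)" by (simp add: powr_add[symmetric])
      then show ?thesis by (simp add: algebra_simps)
    qed
    finally have "norm (\<integral>z. second_diff ?\<phi> x z * ?K z \<partial>lborel) \<le> A * (C\<^sub>1 + C\<^sub>2) * r powr (- 2 * s)"
      using A C12 by (subst (asm) ennreal_le_iff) auto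
    then have "\<bar>?c\<bar> * \<bar>\<integral>z. second_diff ?\<phi> x z * ?K z \<partial>lborel\<bar> \<le> \<bar>?c\<bar> * (A * (C\<^sub>1 + C\<^sub>2) * r powr (- 2 * s))"
      by (intro mult_left_mono) auto
    then show "\<bar>frac_lap s ?\<phi> x\<bar> \<le> \<bar>?c\<bar> * (A * (C\<^sub>1 + C\<^sub>2)) * r powr (- 2 * s)"
      unfolding frac_lap_tame[OF tame s dim] abs_mult by (simp add: mult.assoc)
  qed
qed

text \<open>At distance at least 2r from the centre the bump vanishes at x, so only those z count
  for which x + z or x - z hits the support. They fill two balls of volume of order r^N on which |z|
  is at least half the distance from x to \<open>x\<^sub>0\<close>.\<close>

lemma bump_frac_lap_far:
  fixes s :: real
  assumes s: "0 < s" "s < 1" and dim: "2 \<le> DIM('a::euclidean_space)"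
  shows "\<exists>C\<ge>0. \<forall>(x\<^sub>0::'a) r x. 0 < r \<and> 2 * r \<le> dist x x\<^sub>0 \<longrightarrow> \<bar>frac_lap s (\<lambda>x. bump ((x - x\<^sub>0) /\<^sub>R r)) x\<bar>
    \<le> C * (r powr DIM('a) * dist x x\<^sub>0 powr (- (DIM('a) + 2 * s)))"
proof -
  let ?N = "real DIM('a)" and ?c = "frac_lap_const DIM('a) s / 2" and ?V = "unit_ball_vol (real DIM('a))"
  let ?K = "\<lambda>z::'a. norm z powr (- (?N + 2 * s))"
  show ?thesis
  proof (intro exI[of _ "\<bar>?c\<bar> * (2 * ?V * (1/2) powr (- (?N + 2 * s)))"] conjI allI impI)
    fix x\<^sub>0 x :: 'a and r :: real assume A: "0 < r \<and> 2 * r \<le> dist x x\<^sub>0"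
    then have r: "0 < r" "2 * r \<le> dist x x\<^sub>0" by auto
    let ?\<phi> = "\<lambda>x. bump ((x - x\<^sub>0) /\<^sub>R r)"
    let ?d = "dist x x\<^sub>0"
    have tame: "tame ?\<phi>" using bump_scaled_tame[OF r(1)] .
    have zero: "?\<phi> y = 0" if "r \<le> dist y x\<^sub>0" for y
      using that r by (intro bumps_eq_0[OF bump_in_bumps]) (simp only: norm_scaled_diff[OF r(1)] le_divide_eq_1_pos)
    let ?k = "(?d / 2) powr (- (?N + 2 * s))"
    have "ennreal (norm (\<integral>z. second_diff ?\<phi> x z * ?K z \<partial>lborel)) \<le> (\<integral>\<^sup>+z. ennreal (norm (second_diff ?\<phi> x z * ?K z)) \<partial>lborel)"
      by (rule integral_norm_bound_ennreal[OF tame_second_diff_integrable[OF tame s dim]])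
    also have "\<dots> \<le> (\<integral>\<^sup>+z. ennreal ?k * indicator (ball (x\<^sub>0 - x) r) z + ennreal ?k * indicator (ball (x - x\<^sub>0) r) z \<partial>lborel)"
    proof (rule nn_integral_mono)
      fix z :: 'a
      have *: "\<bar>?\<phi> (x + z)\<bar> * ?K z \<le> ?k * indicator (ball (x\<^sub>0 - x) r) z" for z
      proof (cases "z \<in> ball (x\<^sub>0 - x) r")
        case True
        then have "norm (x\<^sub>0 - x - z) < r" by (simp add: dist_norm)
        moreover have "norm (x\<^sub>0 - x) \<le> norm (x\<^sub>0 - x - z) + norm z" by (metis diff_add_cancel norm_triangle_ineq)
        ultimately have "?d / 2 \<le> norm z" using r by (simp add: dist_norm norm_minus_commute)
        then have "?K z \<le> ?k" using r s by (intro powr_mono2') auto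
        moreover have "\<bar>?\<phi> (x + z)\<bar> \<le> 1" using bump_nonneg bump_le_1 by (simp add: abs_le_iff order_trans[OF _ bump_nonneg])
        ultimately have "\<bar>?\<phi> (x + z)\<bar> * ?K z \<le> 1 * ?k" by (intro mult_mono) auto
        then show ?thesis using True by simp
      next
        case False
        have "dist (x + z) x\<^sub>0 = dist (x\<^sub>0 - x) z" by (simp add: dist_norm norm_minus_commute algebra_simps)
        then have "r \<le> dist (x + z) x\<^sub>0" using False by simp
        then have "?\<phi> (x + z) = 0" by (rule zero)
        then show ?thesis by simp
      qed
      have ind: "indicator (ball (x\<^sub>0 - x) r) (- z) = (indicator (ball (x - x\<^sub>0) r) z :: real)"
      proof -
        have "dist (x\<^sub>0 - x) (- z) = dist (x - x\<^sub>0) z" by (metis dist_minus minus_diff_eq)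
        then show ?thesis by (simp add: indicator_def)
      qed
      have "?\<phi> x = 0" using r by (intro zero) simp
      then have "norm (second_diff ?\<phi> x z * ?K z) \<le> (\<bar>?\<phi> (x + z)\<bar> + \<bar>?\<phi> (x + - z)\<bar>) * ?K z"
        unfolding norm_mult by (intro mult_mono) (auto simp: second_diff_def)
      also have "\<dots> = \<bar>?\<phi> (x + z)\<bar> * ?K z + \<bar>?\<phi> (x + - z)\<bar> * ?K (- z)" by (simp add: distrib_right)
      also have "\<dots> \<le> ?k * indicator (ball (x\<^sub>0 - x) r) z + ?k * indicator (ball (x - x\<^sub>0) r) z"
        using *[of z] *[of "- z"] unfolding ind by (rule add_mono)
      finally have "ennreal (norm (second_diff ?\<phi> x z * ?K z))
        \<le> ennreal (?k * indicator (ball (x\<^sub>0 - x) r) z + ?k * indicator (ball (x - x\<^sub>0) r) z)" by (rule ennreal_leI)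
      then show "ennreal (norm (second_diff ?\<phi> x z * ?K z))
        \<le> ennreal ?k * indicator (ball (x\<^sub>0 - x) r) z + ennreal ?k * indicator (ball (x - x\<^sub>0) r) z"
        by (auto simp: indicator_def)
    qed
    also have "\<dots> = ennreal ?k * emeasure lborel (ball (x\<^sub>0 - x) r) + ennreal ?k * emeasure lborel (ball (x - x\<^sub>0) r)"
      by (simp add: nn_integral_add nn_integral_cmult_indicator del: emeasure_ball mem_ball)
    also have "\<dots> = ennreal (2 * (?k * (?V * r powr ?N)))"
      unfolding emeasure_ball_powr[OF r(1)]
      by (simp add: ennreal_mult[symmetric] ennreal_plus[symmetric] del: ennreal_plus)
    finally have "norm (\<integral>z. second_diff ?\<phi> x z * ?K z \<partial>lborel) \<le> 2 * (?k * (?V * r powr ?N))"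
      by (subst (asm) ennreal_le_iff) auto
    then have "\<bar>?c\<bar> * \<bar>\<integral>z. second_diff ?\<phi> x z * ?K z \<partial>lborel\<bar> \<le> \<bar>?c\<bar> * (2 * (?k * (?V * r powr ?N)))"
      by (intro mult_left_mono) auto
    moreover have "?k = (1/2) powr (- (?N + 2 * s)) * ?d powr (- (?N + 2 * s))"
      using powr_mult[of "1/2" ?d "- (?N + 2 * s)"] by simp
    ultimately show "\<bar>frac_lap s ?\<phi> x\<bar> \<le> \<bar>?c\<bar> * (2 * ?V * (1/2) powr (- (?N + 2 * s))) * (r powr ?N * ?d powr (- (?N + 2 * s)))"
      unfolding frac_lap_tame[OF tame s dim] abs_mult by (simp only: mult_ac)
  qed simp
qed

text \<open>Integrating the bump estimate over all centres \<open>x\<^sub>0 \<in> \<Omega>\<close>, with radius proportional to the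
  distance to the complement and weight \<open>\<delta>(x\<^sub>0)\<^sup>s\<^sup>-\<^sup>N\<close>, replaces a test function comparable to \<open>\<delta>\<^sup>s\<close>
  without any boundary regularity theory.\<close>
lemma weighted_bump_estimate:
  fixes \<Omega> :: "'a::euclidean_space set" and s :: real
  assumes \<Omega>: "open \<Omega>" "- \<Omega> \<noteq> {}" and s: "0 < s" "s < 1" and dim: "2 \<le> DIM('a)"
  shows "\<exists>C\<ge>0. \<forall>G u. G \<in> borel_measurable borel \<longrightarrow> u \<in> borel_measurable borel \<longrightarrow>
    (\<forall>x\<^sub>0 r. 0 < r \<and> cball x\<^sub>0 r \<subseteq> \<Omega> \<longrightarrow>
      (\<integral>\<^sup>+x. G x * ennreal (bump ((x - x\<^sub>0) /\<^sub>R r)) * indicator \<Omega> x \<partial>lborel)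
      \<le> (\<integral>\<^sup>+x. ennreal (\<bar>u x\<bar> * \<bar>frac_lap s (\<lambda>x. bump ((x - x\<^sub>0) /\<^sub>R r)) x\<bar>) * indicator \<Omega> x \<partial>lborel)) \<longrightarrow>
    (\<integral>\<^sup>+x. G x * ennreal (dist_compl \<Omega> x powr s) * indicator \<Omega> x \<partial>lborel)
      \<le> ennreal C * (\<integral>\<^sup>+x. ennreal (\<bar>u x\<bar> * dist_compl \<Omega> x powr (-s)) * indicator \<Omega> x \<partial>lborel)"
proof -
  let ?N = "real DIM('a)" and ?V = "unit_ball_vol (real DIM('a))" and ?d = "dist_compl \<Omega>"
  have [measurable]: "\<Omega> \<in> sets borel" using \<Omega> by auto
  have [measurable]: "?d \<in> borel_measurable borel"
    by (intro borel_measurable_continuous_onI continuous_intros)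
  have dpos: "0 < ?d x" if "x \<in> \<Omega>" for x using dist_compl_pos[OF \<Omega> that] .
  have dlip: "?d x \<le> ?d y + dist x y" for x y by (rule infdist_triangle)
  obtain C\<^sub>1 where C1: "0 \<le> C\<^sub>1" "\<And>(x\<^sub>0::'a) r x. 0 < r \<Longrightarrow> \<bar>frac_lap s (\<lambda>x. bump ((x - x\<^sub>0) /\<^sub>R r)) x\<bar> \<le> C\<^sub>1 * r powr (- 2 * s)"
    using bump_frac_lap_near[OF s dim] by blast
  obtain C\<^sub>2 where C2: "0 \<le> C\<^sub>2" "\<And>(x\<^sub>0::'a) r x. 0 < r \<Longrightarrow> 2 * r \<le> dist x x\<^sub>0 \<Longrightarrow> \<bar>frac_lap s (\<lambda>x. bump ((x - x\<^sub>0) /\<^sub>R r)) x\<bar>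
    \<le> C\<^sub>2 * (r powr ?N * dist x x\<^sub>0 powr (- (?N + 2 * s)))"
    using bump_frac_lap_far[OF s dim] by blast
  \<comment> \<open>Majorant of the fractional Laplacian of the bump of radius r =
    \<delta>(\<open>x\<^sub>0\<close>) / 4 at \<open>x\<^sub>0\<close>. The switch at
    \<delta>(\<open>x\<^sub>0\<close>) / 2 is the distance 2r from which the far estimate is
    valid.\<close>
  define P where "P x x\<^sub>0 = (if dist x x\<^sub>0 \<le> ?d x\<^sub>0 / 2 then C\<^sub>1 * (?d x\<^sub>0 / 4) powr (- 2 * s)
      else C\<^sub>2 * ((?d x\<^sub>0 / 4) powr ?N * dist x x\<^sub>0 powr (- (?N + 2 * s))))" for x x\<^sub>0
  have P0: "0 \<le> P x x\<^sub>0" for x x\<^sub>0 using C1(1) C2(1) by (simp add: P_def)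
  have P: "\<bar>frac_lap s (\<lambda>x. bump ((x - x\<^sub>0) /\<^sub>R (?d x\<^sub>0 / 4))) x\<bar> \<le> P x x\<^sub>0" if "x\<^sub>0 \<in> \<Omega>" for x x\<^sub>0
    using C1(2)[of "?d x\<^sub>0 / 4" x\<^sub>0 x] C2(2)[of "?d x\<^sub>0 / 4" x x\<^sub>0] dpos[OF that] by (auto simp: P_def)
  \<comment> \<open>On the ball of radius \<delta>(x) / 16 around x the 1-Lipschitz function
    \<delta> varies between 15/16 and 17/16 of \<delta>(x). The factors are the weight, where the
    exponent s - N is negative, the lower bound of the bump, and the volume of this ball.\<close>
  define c where "c = (17/16) powr (s - ?N) * exp (-2) * ?V * (1/16) powr ?N"
  have c: "0 < c" by (simp add: c_def)
  \<comment> \<open>A collects the centres \<open>x\<^sub>0\<close> near x, where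
    \<delta>(\<open>x\<^sub>0\<close>) is at least 2/3 \<delta>(x) and which lie in the ball of
    radius \<delta>(x). B collects the far ones, which lie at distance at least \<delta>(x) /
    3.\<close>
  define A where "A = C\<^sub>1 * 4 powr (2 * s) * (2/3) powr (- (?N + s)) * ?V"
  define B where "B = C\<^sub>2 * (1/4) powr ?N * 2 powr s * ((?N + s) * ?V / s * (1/3) powr (- s))"
  have A0: "0 \<le> A" and B0: "0 \<le> B" using C1(1) C2(1) s by (auto simp: A_def B_def)
  \<comment> \<open>Every centre within \<delta>(x) / 16 of x has a bump bounded below at x, since
    1/16 is less than half of (1/4)(15/16). Weight \<delta>^(s-N) times volume \<delta>^N leaves
    \<delta>^s.\<close>
  have lower: "ennreal (c * ?d x powr s) \<le> (\<integral>\<^sup>+x\<^sub>0. ennreal (?d x\<^sub>0 powr (s - ?N)) * ennreal (bump ((x - x\<^sub>0) /\<^sub>R (?d x\<^sub>0 / 4))) * indicator \<Omega> x\<^sub>0 \<partial>lborel)"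
    if x: "x \<in> \<Omega>" for x
  proof -
    let ?B = "ball x (?d x / 16)"
    have "ennreal (c * ?d x powr s) = ennreal ((17/16 * ?d x) powr (s - ?N) * exp (-2)) * emeasure lborel ?B"
    proof -
      have "(17/16 * ?d x) powr (s - ?N) = (17/16) powr (s - ?N) * ?d x powr (s - ?N)" using dpos[OF x] powr_mult[of "17/16" "?d x" "s - ?N"] by simp
      moreover have "(?d x / 16) powr ?N = (1/16) powr ?N * ?d x powr ?N" using dpos[OF x] powr_mult[of "1/16" "?d x" ?N] by simp
      moreover have "?d x powr (s - ?N) * ?d x powr ?N = ?d x powr s" by (simp add: powr_add[symmetric])
      ultimately have "(17/16 * ?d x) powr (s - ?N) * exp (-2) * (?V * (?d x / 16) powr ?N) = c * ?d x powr s"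
        by (simp add: c_def mult_ac)
      then show ?thesis using emeasure_ball_powr[of "?d x / 16" x] dpos[OF x]
        by (simp add: ennreal_mult[symmetric] mult.assoc del: emeasure_ball)
    qed
    also have "\<dots> = (\<integral>\<^sup>+x\<^sub>0. ennreal ((17/16 * ?d x) powr (s - ?N) * exp (-2)) * indicator ?B x\<^sub>0 \<partial>lborel)"
      by (subst nn_integral_cmult_indicator) auto
    also have "\<dots> \<le> (\<integral>\<^sup>+x\<^sub>0. ennreal (?d x\<^sub>0 powr (s - ?N)) * ennreal (bump ((x - x\<^sub>0) /\<^sub>R (?d x\<^sub>0 / 4))) * indicator \<Omega> x\<^sub>0 \<partial>lborel)"
    proof (rule nn_integral_mono)
      fix x\<^sub>0
      show "ennreal ((17/16 * ?d x) powr (s - ?N) * exp (-2)) * indicator ?B x\<^sub>0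
        \<le> ennreal (?d x\<^sub>0 powr (s - ?N)) * ennreal (bump ((x - x\<^sub>0) /\<^sub>R (?d x\<^sub>0 / 4))) * indicator \<Omega> x\<^sub>0"
      proof (cases "x\<^sub>0 \<in> ?B")
        case True
        then have dd: "dist x x\<^sub>0 < ?d x / 16" by simp
        have d0: "15/16 * ?d x < ?d x\<^sub>0" "?d x\<^sub>0 \<le> 17/16 * ?d x"
          using dlip[of x x\<^sub>0] dlip[of x\<^sub>0 x] dd by (auto simp: dist_commute)
        have pos: "0 < ?d x\<^sub>0" using d0 dpos[OF x] by linarith
        then have x0: "x\<^sub>0 \<in> \<Omega>" by (metis ComplI infdist_zero order_less_irrefl)
        have "(17/16 * ?d x) powr (s - ?N) \<le> ?d x\<^sub>0 powr (s - ?N)"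
          using pos d0 s dim by (intro powr_mono2') auto
        moreover have "exp (-2) \<le> bump ((x - x\<^sub>0) /\<^sub>R (?d x\<^sub>0 / 4))"
        proof (rule bump_lower_bound)
          have "norm ((x - x\<^sub>0) /\<^sub>R (?d x\<^sub>0 / 4)) = dist x x\<^sub>0 / (?d x\<^sub>0 / 4)"
            by (rule norm_scaled_diff) (use pos in simp)
          also have "\<dots> \<le> 1/2" using pos dd d0 by (simp add: field_simps)
          finally show "norm ((x - x\<^sub>0) /\<^sub>R (?d x\<^sub>0 / 4)) \<le> 1/2" .
        qed
        ultimately have "(17/16 * ?d x) powr (s - ?N) * exp (-2) \<le> ?d x\<^sub>0 powr (s - ?N) * bump ((x - x\<^sub>0) /\<^sub>R (?d x\<^sub>0 / 4))"
          by (intro mult_mono) auto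
        then have "ennreal ((17/16 * ?d x) powr (s - ?N) * exp (-2))
          \<le> ennreal (?d x\<^sub>0 powr (s - ?N)) * ennreal (bump ((x - x\<^sub>0) /\<^sub>R (?d x\<^sub>0 / 4)))"
          by (subst ennreal_mult[symmetric]) (auto simp: bump_nonneg intro: ennreal_leI)
        then show ?thesis using True x0 by (simp only: indicator_simps mult_1_right)
      qed simp
    qed
    finally show ?thesis .
  qed
  \<comment> \<open>Near centres contribute \<delta>^(-N-s) times a volume \<delta>^N. For far
    centres \<delta>(\<open>x\<^sub>0\<close>)^s is at most (2 |x - \<open>x\<^sub>0\<close>|)^s,
    which improves the decay from -N-2s to -N-s; the tail from \<delta>(x) / 3 is again of order
    \<delta>^(-s).\<close>
  have upper: "(\<integral>\<^sup>+x\<^sub>0. ennreal (?d x\<^sub>0 powr (s - ?N)) * ennreal (P x x\<^sub>0) * indicator \<Omega> x\<^sub>0 \<partial>lborel) \<le> ennreal ((A + B) * ?d x powr (- s))"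
    if x: "x \<in> \<Omega>" for x
  proof -
    let ?k = "C\<^sub>1 * 4 powr (2 * s) * (2/3 * ?d x) powr (- (?N + s))"
    let ?l = "C\<^sub>2 * (1/4) powr ?N * 2 powr s"
    define T where "T z = ennreal (norm z powr (- (?N + s))) * indicator {z. ?d x / 3 \<le> norm z} z" for z :: 'a
    have [measurable]: "ball x (?d x) \<in> sets borel" "{z::'a. ?d x / 3 \<le> norm z} \<in> sets borel" by auto
    have [measurable]: "T \<in> borel_measurable borel" unfolding T_def by measurable
    have "(\<integral>\<^sup>+x\<^sub>0. ennreal (?d x\<^sub>0 powr (s - ?N)) * ennreal (P x x\<^sub>0) * indicator \<Omega> x\<^sub>0 \<partial>lborel)
      \<le> (\<integral>\<^sup>+x\<^sub>0. ennreal ?k * indicator (cball x (?d x)) x\<^sub>0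
        + ennreal ?l * T (- x + x\<^sub>0) \<partial>lborel)"
    proof (rule nn_integral_mono)
      fix x\<^sub>0
      have nd: "norm (- x + x\<^sub>0) = dist x x\<^sub>0" by (simp add: dist_norm norm_minus_commute)
      show "ennreal (?d x\<^sub>0 powr (s - ?N)) * ennreal (P x x\<^sub>0) * indicator \<Omega> x\<^sub>0 \<le> ennreal ?k * indicator (cball x (?d x)) x\<^sub>0
        + ennreal ?l * T (- x + x\<^sub>0)"
      proof (cases "x\<^sub>0 \<in> \<Omega>")
        case True
        then have d0: "0 < ?d x\<^sub>0" by (rule dpos)
        show ?thesis
        proof (cases "dist x x\<^sub>0 \<le> ?d x\<^sub>0 / 2")
          case near: True
          have le: "2/3 * ?d x \<le> ?d x\<^sub>0" "dist x x\<^sub>0 \<le> ?d x"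
            using near dlip[of x x\<^sub>0] dlip[of x\<^sub>0 x] by (auto simp: dist_commute)
          have "?d x\<^sub>0 powr (s - ?N) * P x x\<^sub>0 = C\<^sub>1 * 4 powr (2 * s) * ?d x\<^sub>0 powr (- (?N + s))"
          proof -
            have "(?d x\<^sub>0 / 4) powr (- 2 * s) = 4 powr (2 * s) * ?d x\<^sub>0 powr (- 2 * s)"
              using d0 by (simp add: powr_divide powr_minus_divide)
            moreover have "?d x\<^sub>0 powr (s - ?N) * ?d x\<^sub>0 powr (- 2 * s) = ?d x\<^sub>0 powr (- (?N + s))"
              by (simp add: powr_add[symmetric] algebra_simps)
            ultimately show ?thesis using near by (simp add: P_def mult_ac)
          qed
          also have "\<dots> \<le> ?k"
            using le(1) dpos[OF x] s C1(1) by (intro mult_left_mono powr_mono2') auto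
          finally have fin: "ennreal (?d x\<^sub>0 powr (s - ?N) * P x x\<^sub>0) \<le> ennreal ?k" by (rule ennreal_leI)
          have L: "ennreal (?d x\<^sub>0 powr (s - ?N)) * ennreal (P x x\<^sub>0) * indicator \<Omega> x\<^sub>0 = ennreal (?d x\<^sub>0 powr (s - ?N) * P x x\<^sub>0)"
            using True P0 by (simp add: ennreal_mult)
          have R: "indicator (cball x (?d x)) x\<^sub>0 = (1 :: ennreal)" using le(2) by simp
          show ?thesis unfolding L R mult_1_right by (rule add_increasing2[OF zero_le fin])
        next
          case far: False
          then have dp: "0 < dist x x\<^sub>0" using d0 by linarith
          have le: "?d x / 3 \<le> dist x x\<^sub>0" using far dlip[of x x\<^sub>0] by simp
          have "?d x\<^sub>0 powr (s - ?N) * P x x\<^sub>0 = C\<^sub>2 * (1/4) powr ?N * ?d x\<^sub>0 powr s * dist x x\<^sub>0 powr (- (?N + 2 * s))"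
          proof -
            have "(?d x\<^sub>0 / 4) powr ?N = (1/4) powr ?N * ?d x\<^sub>0 powr ?N"
              using d0 powr_mult[of "1/4" "?d x\<^sub>0" ?N] by simp
            moreover have "?d x\<^sub>0 powr (s - ?N) * ?d x\<^sub>0 powr ?N = ?d x\<^sub>0 powr s" by (simp add: powr_add[symmetric])
            ultimately show ?thesis using far by (simp add: P_def mult_ac)
          qed
          also have "\<dots> \<le> C\<^sub>2 * (1/4) powr ?N * (2 * dist x x\<^sub>0) powr s * dist x x\<^sub>0 powr (- (?N + 2 * s))"
            using far d0 s C2(1) by (intro mult_right_mono mult_left_mono powr_mono2) auto
          also have "\<dots> = ?l * (dist x x\<^sub>0 powr s * dist x x\<^sub>0 powr (- (?N + 2 * s)))" by (simp add: powr_mult)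
          also have "dist x x\<^sub>0 powr s * dist x x\<^sub>0 powr (- (?N + 2 * s)) = dist x x\<^sub>0 powr (- (?N + s))"
            by (subst powr_add[symmetric]) (simp add: algebra_simps)
          finally have fin: "ennreal (?d x\<^sub>0 powr (s - ?N) * P x x\<^sub>0) \<le> ennreal ?l * ennreal (dist x x\<^sub>0 powr (- (?N + s)))"
            using C2(1) by (simp add: ennreal_mult[symmetric] ennreal_leI)
          have L: "ennreal (?d x\<^sub>0 powr (s - ?N)) * ennreal (P x x\<^sub>0) * indicator \<Omega> x\<^sub>0 = ennreal (?d x\<^sub>0 powr (s - ?N) * P x x\<^sub>0)"
            using True P0 by (simp add: ennreal_mult)
          have R: "indicator {z. ?d x / 3 \<le> norm z} (- x + x\<^sub>0) = (1 :: ennreal)"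
            using le by (simp only: indicator_def mem_Collect_eq nd if_True of_bool_eq)
          show ?thesis unfolding L T_def R nd mult_1_right by (rule add_increasing[OF zero_le fin])
        qed
      qed simp
    qed
    also have "\<dots> = ennreal ?k * emeasure lborel (cball x (?d x)) + ennreal ?l * (\<integral>\<^sup>+x\<^sub>0. T (- x + x\<^sub>0) \<partial>lborel)"
      by (simp add: nn_integral_add nn_integral_cmult nn_integral_cmult_indicator del: emeasure_cball mem_cball)
    also have "(\<integral>\<^sup>+x\<^sub>0. T (- x + x\<^sub>0) \<partial>lborel) = (\<integral>\<^sup>+z. T z \<partial>lborel)"
      by (rule nn_integral_lborel_shift) measurable
    also have "ennreal ?k * emeasure lborel (cball x (?d x)) + ennreal ?l * \<dots>
      \<le> ennreal ?k * ennreal (?V * ?d x powr ?N) + ennreal ?l * ennreal ((?N + s) * ?V / s * (?d x / 3) powr (-s))"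
      unfolding T_def emeasure_cball_powr[OF dpos[OF x]] using dpos[OF x] s
      by (intro add_mono mult_left_mono nn_integral_norm_tail) auto
    also have "\<dots> = ennreal (?k * (?V * ?d x powr ?N) + ?l * ((?N + s) * ?V / s * (?d x / 3) powr (-s)))"
      using C1(1) C2(1) s by (simp add: ennreal_mult[symmetric] ennreal_plus[symmetric] del: ennreal_plus)
    also have "?k * (?V * ?d x powr ?N) + ?l * ((?N + s) * ?V / s * (?d x / 3) powr (-s)) = (A + B) * ?d x powr (- s)"
    proof -
      have "(2/3 * ?d x) powr (- (?N + s)) = (2/3) powr (- (?N + s)) * ?d x powr (- (?N + s))" using dpos[OF x] powr_mult[of "2/3" "?d x" "- (?N + s)"] by simp
      moreover have "?d x powr (- (?N + s)) * ?d x powr ?N = ?d x powr (- s)" by (simp add: powr_add[symmetric])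
      ultimately have 1: "?k * (?V * ?d x powr ?N) = A * ?d x powr (- s)" by (simp add: A_def mult_ac)
      have "(?d x / 3) powr (-s) = (1/3) powr (-s) * ?d x powr (-s)"
        using dpos[OF x] powr_mult[of "1/3" "?d x" "-s"] by simp
      then have 2: "?l * ((?N + s) * ?V / s * (?d x / 3) powr (-s)) = B * ?d x powr (-s)" unfolding B_def by (simp only: mult.assoc)
      show ?thesis unfolding 1 2 by (simp add: distrib_right)
    qed
    finally show ?thesis .
  qed
  show ?thesis
  proof (intro exI[of _ "(A + B) / c"] conjI allI impI)
    show "0 \<le> (A + B) / c" using A0 B0 c by simp
    fix G :: "'a \<Rightarrow> ennreal" and u :: "'a \<Rightarrow> real"
    assume [measurable]: "G \<in> borel_measurable borel" "u \<in> borel_measurable borel"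
      and est: "\<forall>x\<^sub>0 r. 0 < r \<and> cball x\<^sub>0 r \<subseteq> \<Omega> \<longrightarrow>
      (\<integral>\<^sup>+x. G x * ennreal (bump ((x - x\<^sub>0) /\<^sub>R r)) * indicator \<Omega> x \<partial>lborel)
      \<le> (\<integral>\<^sup>+x. ennreal (\<bar>u x\<bar> * \<bar>frac_lap s (\<lambda>x. bump ((x - x\<^sub>0) /\<^sub>R r)) x\<bar>) * indicator \<Omega> x \<partial>lborel)"
    have Pm[measurable]: "(\<lambda>p. P (fst p) (snd p)) \<in> borel_measurable (lborel \<Otimes>\<^sub>M lborel)"
      unfolding P_def by measurable
    \<comment> \<open>The weight on the left is bounded by the integral over centres, the order of
      integration is exchanged, the hypothesis is applied to each single bump, and exchanging back
      leaves the integral of \<open>P\<close>. All integrands are nonnegative, so no integrability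
      has to be known.\<close>
    have "ennreal c * (\<integral>\<^sup>+x. G x * ennreal (?d x powr s) * indicator \<Omega> x \<partial>lborel)
      = (\<integral>\<^sup>+x. G x * ennreal (c * ?d x powr s) * indicator \<Omega> x \<partial>lborel)"
      using c by (subst nn_integral_cmult[symmetric]) (auto simp: ennreal_mult mult_ac intro!: nn_integral_cong)
    also have "\<dots> \<le> (\<integral>\<^sup>+x. (\<integral>\<^sup>+x\<^sub>0. (G x * indicator \<Omega> x) * (ennreal (?d x\<^sub>0 powr (s - ?N)) * ennreal (bump ((x - x\<^sub>0) /\<^sub>R (?d x\<^sub>0 / 4))) * indicator \<Omega> x\<^sub>0) \<partial>lborel) \<partial>lborel)"
    proof (rule nn_integral_mono)
      fix x
      have "G x * ennreal (c * ?d x powr s) * indicator \<Omega> x = (G x * indicator \<Omega> x) * (ennreal (c * ?d x powr s) * indicator \<Omega> x)"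
        by (auto simp: indicator_def)
      also have "\<dots> \<le> (G x * indicator \<Omega> x) * (\<integral>\<^sup>+x\<^sub>0. ennreal (?d x\<^sub>0 powr (s - ?N)) * ennreal (bump ((x - x\<^sub>0) /\<^sub>R (?d x\<^sub>0 / 4))) * indicator \<Omega> x\<^sub>0 \<partial>lborel)"
        using lower[of x] by (intro mult_left_mono) (auto simp: indicator_def)
      also have "\<dots> = (\<integral>\<^sup>+x\<^sub>0. (G x * indicator \<Omega> x) * (ennreal (?d x\<^sub>0 powr (s - ?N)) * ennreal (bump ((x - x\<^sub>0) /\<^sub>R (?d x\<^sub>0 / 4))) * indicator \<Omega> x\<^sub>0) \<partial>lborel)"
        by (rule nn_integral_cmult[symmetric]) measurable
      finally show "G x * ennreal (c * ?d x powr s) * indicator \<Omega> x \<le> \<dots>" .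
    qed
    also have "\<dots> = (\<integral>\<^sup>+x\<^sub>0. (\<integral>\<^sup>+x. (G x * indicator \<Omega> x) * (ennreal (?d x\<^sub>0 powr (s - ?N)) * ennreal (bump ((x - x\<^sub>0) /\<^sub>R (?d x\<^sub>0 / 4))) * indicator \<Omega> x\<^sub>0) \<partial>lborel) \<partial>lborel)"
      by (rule lborel_pair.Fubini'[symmetric]) measurable
    also have "\<dots> \<le> (\<integral>\<^sup>+x\<^sub>0. (\<integral>\<^sup>+x. ennreal \<bar>u x\<bar> * indicator \<Omega> x * (ennreal (?d x\<^sub>0 powr (s - ?N)) * ennreal (P x x\<^sub>0) * indicator \<Omega> x\<^sub>0) \<partial>lborel) \<partial>lborel)"
    proof (rule nn_integral_mono)
      fix x\<^sub>0
      let ?w = "ennreal (?d x\<^sub>0 powr (s - ?N)) * indicator \<Omega> x\<^sub>0"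
      have Pm2[measurable]: "(\<lambda>x. P x x\<^sub>0) \<in> borel_measurable borel" unfolding P_def by measurable
      have "(\<integral>\<^sup>+x. (G x * indicator \<Omega> x) * (ennreal (?d x\<^sub>0 powr (s - ?N)) * ennreal (bump ((x - x\<^sub>0) /\<^sub>R (?d x\<^sub>0 / 4))) * indicator \<Omega> x\<^sub>0) \<partial>lborel)
        = ?w * (\<integral>\<^sup>+x. G x * ennreal (bump ((x - x\<^sub>0) /\<^sub>R (?d x\<^sub>0 / 4))) * indicator \<Omega> x \<partial>lborel)"
        by (subst nn_integral_cmult[symmetric]) (auto simp: mult_ac intro!: nn_integral_cong)
      also have "\<dots> \<le> ?w * (\<integral>\<^sup>+x. ennreal \<bar>u x\<bar> * ennreal (P x x\<^sub>0) * indicator \<Omega> x \<partial>lborel)"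
      proof (cases "x\<^sub>0 \<in> \<Omega>")
        case True
        have sub: "cball x\<^sub>0 (?d x\<^sub>0 / 4) \<subseteq> \<Omega>"
        proof
          fix y assume "y \<in> cball x\<^sub>0 (?d x\<^sub>0 / 4)"
          then have "dist x\<^sub>0 y < ?d x\<^sub>0" using dpos[OF True] by simp
          then show "y \<in> \<Omega>" using infdist_le[of y "- \<Omega>" x\<^sub>0] by auto
        qed
        have "(\<integral>\<^sup>+x. G x * ennreal (bump ((x - x\<^sub>0) /\<^sub>R (?d x\<^sub>0 / 4))) * indicator \<Omega> x \<partial>lborel)
          \<le> (\<integral>\<^sup>+x. ennreal (\<bar>u x\<bar> * \<bar>frac_lap s (\<lambda>x. bump ((x - x\<^sub>0) /\<^sub>R (?d x\<^sub>0 / 4))) x\<bar>) * indicator \<Omega> x \<partial>lborel)"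
          using est[rule_format, of "?d x\<^sub>0 / 4" x\<^sub>0] sub dpos[OF True] by simp
        also have "\<dots> \<le> (\<integral>\<^sup>+x. ennreal \<bar>u x\<bar> * ennreal (P x x\<^sub>0) * indicator \<Omega> x \<partial>lborel)"
          using P[OF True] P0 by (intro nn_integral_mono mult_right_mono) (auto simp: ennreal_mult[symmetric] intro!: ennreal_leI mult_left_mono)
        finally show ?thesis by (intro mult_left_mono) auto
      qed simp
      also have "\<dots> = (\<integral>\<^sup>+x. ennreal \<bar>u x\<bar> * indicator \<Omega> x * (ennreal (?d x\<^sub>0 powr (s - ?N)) * ennreal (P x x\<^sub>0) * indicator \<Omega> x\<^sub>0) \<partial>lborel)"
        by (subst nn_integral_cmult[symmetric]) (auto simp: mult_ac intro!: nn_integral_cong)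
      finally show "(\<integral>\<^sup>+x. (G x * indicator \<Omega> x) * (ennreal (?d x\<^sub>0 powr (s - ?N)) * ennreal (bump ((x - x\<^sub>0) /\<^sub>R (?d x\<^sub>0 / 4))) * indicator \<Omega> x\<^sub>0) \<partial>lborel) \<le> \<dots>" .
    qed
    also have "\<dots> = (\<integral>\<^sup>+x. (\<integral>\<^sup>+x\<^sub>0. ennreal \<bar>u x\<bar> * indicator \<Omega> x * (ennreal (?d x\<^sub>0 powr (s - ?N)) * ennreal (P x x\<^sub>0) * indicator \<Omega> x\<^sub>0) \<partial>lborel) \<partial>lborel)"
      by (rule lborel_pair.Fubini') (simp add: split_beta')
    also have "\<dots> \<le> (\<integral>\<^sup>+x. ennreal (A + B) * (ennreal (\<bar>u x\<bar> * ?d x powr (-s)) * indicator \<Omega> x) \<partial>lborel)"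
    proof (rule nn_integral_mono)
      fix x
      have Pm2[measurable]: "(\<lambda>x\<^sub>0. P x x\<^sub>0) \<in> borel_measurable borel" unfolding P_def by measurable
      have "(\<integral>\<^sup>+x\<^sub>0. ennreal \<bar>u x\<bar> * indicator \<Omega> x * (ennreal (?d x\<^sub>0 powr (s - ?N)) * ennreal (P x x\<^sub>0) * indicator \<Omega> x\<^sub>0) \<partial>lborel)
        = ennreal \<bar>u x\<bar> * indicator \<Omega> x * (\<integral>\<^sup>+x\<^sub>0. ennreal (?d x\<^sub>0 powr (s - ?N)) * ennreal (P x x\<^sub>0) * indicator \<Omega> x\<^sub>0 \<partial>lborel)"
        by (rule nn_integral_cmult) measurable
      also have "\<dots> \<le> ennreal \<bar>u x\<bar> * indicator \<Omega> x * ennreal ((A + B) * ?d x powr (- s))"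
        using upper[of x] by (cases "x \<in> \<Omega>") (auto intro!: mult_left_mono)
      also have "\<dots> = ennreal (A + B) * (ennreal (\<bar>u x\<bar> * ?d x powr (-s)) * indicator \<Omega> x)"
        using A0 B0 by (cases "x \<in> \<Omega>") (simp_all add: ennreal_mult[symmetric] mult_ac del: ennreal_plus)
      finally show "(\<integral>\<^sup>+x\<^sub>0. ennreal \<bar>u x\<bar> * indicator \<Omega> x * (ennreal (?d x\<^sub>0 powr (s - ?N)) * ennreal (P x x\<^sub>0) * indicator \<Omega> x\<^sub>0) \<partial>lborel) \<le> \<dots>" .
    qed
    also have "\<dots> = ennreal (A + B) * (\<integral>\<^sup>+x. ennreal (\<bar>u x\<bar> * ?d x powr (-s)) * indicator \<Omega> x \<partial>lborel)"
      by (rule nn_integral_cmult) measurable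
    finally have "ennreal (1 / c) * (ennreal c * (\<integral>\<^sup>+x. G x * ennreal (?d x powr s) * indicator \<Omega> x \<partial>lborel))
      \<le> ennreal (1 / c) * (ennreal (A + B) * (\<integral>\<^sup>+x. ennreal (\<bar>u x\<bar> * ?d x powr (-s)) * indicator \<Omega> x \<partial>lborel))"
      by (rule mult_left_mono) simp
    then show "(\<integral>\<^sup>+x. G x * ennreal (?d x powr s) * indicator \<Omega> x \<partial>lborel)
      \<le> ennreal ((A + B) / c) * (\<integral>\<^sup>+x. ennreal (\<bar>u x\<bar> * ?d x powr (-s)) * indicator \<Omega> x \<partial>lborel)"
      using c A0 B0 by (simp add: mult.assoc[symmetric] ennreal_mult[symmetric] del: ennreal_plus)
  qed
qed

lemma integrable_lborel_shift_product:
  fixes f h :: "'a::euclidean_space \<Rightarrow> real"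
  assumes f: "integrable lborel f" and h: "integrable lborel h"
  shows "integrable (lborel \<Otimes>\<^sub>M lborel) (\<lambda>(x, z). f (x + z) * h z)"
proof (rule integrableI_bounded)
  have [measurable]: "f \<in> borel_measurable borel" "h \<in> borel_measurable borel" using f h by auto
  show "(\<lambda>(x, z). f (x + z) * h z) \<in> borel_measurable (lborel \<Otimes>\<^sub>M lborel)" by measurable
  have "(\<integral>\<^sup>+p. ennreal (norm (case p of (x, z) \<Rightarrow> f (x + z) * h z)) \<partial>(lborel \<Otimes>\<^sub>M lborel))
    = (\<integral>\<^sup>+z. (\<integral>\<^sup>+x. ennreal (norm (f (x + z) * h z)) \<partial>lborel) \<partial>lborel)"
    by (subst lborel_pair.nn_integral_snd[symmetric]) auto
  also have "\<dots> = (\<integral>\<^sup>+z. ennreal (norm (h z)) * (\<integral>\<^sup>+x. ennreal (norm (f x)) \<partial>lborel) \<partial>lborel)"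
  proof (rule nn_integral_cong)
    fix z
    have "(\<integral>\<^sup>+x. ennreal (norm (f (x + z) * h z)) \<partial>lborel) = (\<integral>\<^sup>+x. ennreal (norm (h z)) * ennreal (norm (f (z + x))) \<partial>lborel)"
      by (intro nn_integral_cong) (simp add: abs_mult ennreal_mult[symmetric] add.commute mult.commute)
    also have "\<dots> = ennreal (norm (h z)) * (\<integral>\<^sup>+x. ennreal (norm (f (z + x))) \<partial>lborel)"
      by (rule nn_integral_cmult) measurable
    also have "(\<integral>\<^sup>+x. ennreal (norm (f (z + x))) \<partial>lborel) = (\<integral>\<^sup>+x. ennreal (norm (f x)) \<partial>lborel)"
      by (rule nn_integral_lborel_shift[of "\<lambda>x. ennreal (norm (f x))"]) measurable
    finally show "(\<integral>\<^sup>+x. ennreal (norm (f (x + z) * h z)) \<partial>lborel) = ennreal (norm (h z)) * (\<integral>\<^sup>+x. ennreal (norm (f x)) \<partial>lborel)" .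
  qed
  also have "\<dots> = (\<integral>\<^sup>+z. ennreal (norm (h z)) \<partial>lborel) * (\<integral>\<^sup>+x. ennreal (norm (f x)) \<partial>lborel)"
    by (rule nn_integral_multc) measurable
  also have "\<dots> < \<infinity>" using f h by (auto simp: integrable_iff_bounded ennreal_mult_less_top)
  finally show "(\<integral>\<^sup>+p. ennreal (norm (case p of (x, z) \<Rightarrow> f (x + z) * h z)) \<partial>(lborel \<Otimes>\<^sub>M lborel)) < \<infinity>" .
qed

section \<open>Mollification\<close>

text \<open>Normalising by the integral of the rescaled bump itself makes the total mass 1 without a
  change of variables.\<close>

definition mollifier :: "real \<Rightarrow> 'a::euclidean_space \<Rightarrow> real" where
  "mollifier \<epsilon> w = bump (w /\<^sub>R \<epsilon>) / (\<integral>w. bump ((w::'a) /\<^sub>R \<epsilon>) \<partial>lborel)"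

definition mollify :: "real \<Rightarrow> ('a::euclidean_space \<Rightarrow> real) \<Rightarrow> 'a \<Rightarrow> real" where
  "mollify \<epsilon> f x = (\<integral>y. mollifier \<epsilon> (x - y) * f y \<partial>lborel)"

lemma mollifier_measurable[measurable]: "mollifier \<epsilon> \<in> borel_measurable borel"
  unfolding mollifier_def by measurable

lemma mollifier_minus: "mollifier \<epsilon> (x - y) = mollifier \<epsilon> (y - x)"
  using bump_minus[of "(x - y) /\<^sub>R \<epsilon>"] by (simp add: mollifier_def algebra_simps)

text \<open>The pointwise bound comes from a lower bound for the normalising integral: the bump is
  at least exp(-2) on the ball of half the radius, whose volume is
  \<open>unit_ball_vol DIM('a) * (\<epsilon> / 2) powr DIM('a)\<close>.\<close>

lemma mollifier_facts:
  fixes \<epsilon> :: real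
  assumes \<epsilon>: "0 < \<epsilon>"
  shows "0 \<le> mollifier \<epsilon> (w::'a::euclidean_space)"
    "\<epsilon> \<le> norm w \<Longrightarrow> mollifier \<epsilon> w = 0"
    "mollifier \<epsilon> w \<le> exp 2 * 2 powr DIM('a) / unit_ball_vol DIM('a) * \<epsilon> powr (- real DIM('a))"
    "integrable lborel (mollifier \<epsilon> :: 'a \<Rightarrow> real)" "(\<integral>w. mollifier \<epsilon> (w::'a) \<partial>lborel) = 1"
proof -
  let ?N = "real DIM('a)" and ?V = "unit_ball_vol (real DIM('a))"
  let ?b = "\<lambda>w::'a. bump (w /\<^sub>R \<epsilon>)"
  have supp: "?b w = 0" if "\<epsilon> \<le> norm w" for w
    using that \<epsilon> norm_scaled_diff[OF \<epsilon>, of w 0] by (intro bumps_eq_0[OF bump_in_bumps]) simp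
  have int: "integrable lborel ?b"
    using test_function_tame(2)[OF bump_scaled_test_function[OF \<epsilon>, of "0::'a" UNIV]] by simp
  have "exp (-2) * (?V * (\<epsilon> / 2) powr ?N) = exp (-2) * measure lborel (cball (0::'a) (\<epsilon> / 2))"
    using emeasure_cball_powr[of "\<epsilon> / 2" "0::'a"] \<epsilon> by (simp add: measure_def del: emeasure_cball)
  also have "\<dots> = (\<integral>w. exp (-2) * indicator (cball (0::'a) (\<epsilon> / 2)) w \<partial>lborel)" by simp
  also have "\<dots> \<le> (\<integral>w. ?b w \<partial>lborel)"
  proof (rule integral_mono[OF _ int])
    show "integrable lborel (\<lambda>w. exp (-2) * indicator (cball (0::'a) (\<epsilon> / 2)) w :: real)"
      by (intro integrable_mult_right integrable_real_indicator emeasure_bounded_finite bounded_cball) simp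
    fix w :: 'a
    show "exp (-2) * indicator (cball (0::'a) (\<epsilon> / 2)) w \<le> ?b w"
    proof (cases "w \<in> cball 0 (\<epsilon> / 2)")
      case True
      then have "norm (w /\<^sub>R \<epsilon>) \<le> 1/2" using \<epsilon> norm_scaled_diff[OF \<epsilon>, of w 0] by simp
      then show ?thesis using True bump_lower_bound[of "w /\<^sub>R \<epsilon>"] by simp
    qed (simp add: bump_nonneg)
  qed
  finally have m: "exp (-2) * (?V * (\<epsilon> / 2) powr ?N) \<le> (\<integral>w. ?b w \<partial>lborel)" .
  have m0: "0 < exp (-2) * (?V * (\<epsilon> / 2) powr ?N)" using \<epsilon> by simp
  then have mpos: "0 < (\<integral>w. ?b w \<partial>lborel)" using m by linarith
  show "0 \<le> mollifier \<epsilon> w" using mpos by (simp add: mollifier_def bump_nonneg)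
  show "\<epsilon> \<le> norm w \<Longrightarrow> mollifier \<epsilon> w = 0" using supp by (simp add: mollifier_def)
  have "mollifier \<epsilon> w \<le> 1 / (\<integral>w. ?b w \<partial>lborel)"
    unfolding mollifier_def using mpos by (intro divide_right_mono bump_le_1) simp
  also have "\<dots> \<le> 1 / (exp (-2) * (?V * (\<epsilon> / 2) powr ?N))"
    using m m0 by (intro divide_left_mono) auto
  also have "\<dots> = exp 2 * 2 powr ?N / ?V * \<epsilon> powr (- ?N)"
    using \<epsilon> by (simp add: powr_divide powr_minus_divide exp_minus field_simps)
  finally show "mollifier \<epsilon> w \<le> exp 2 * 2 powr ?N / ?V * \<epsilon> powr (- ?N)" .
  show "integrable lborel (mollifier \<epsilon> :: 'a \<Rightarrow> real)"
    unfolding mollifier_def[abs_def] using int by simp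
  show "(\<integral>w. mollifier \<epsilon> (w::'a) \<partial>lborel) = 1"
    unfolding mollifier_def using mpos by simp
qed

lemma mollify_kernel_integrable:
  fixes f g :: "'a::euclidean_space \<Rightarrow> real"
  assumes \<epsilon>: "0 < \<epsilon>" and f: "integrable lborel f" and g: "integrable lborel g"
  shows "integrable (lborel \<Otimes>\<^sub>M lborel) (\<lambda>(x, y). g x * (mollifier \<epsilon> (x - y) * f y))"
proof (rule Bochner_Integration.integrable_bound)
  let ?M = "exp 2 * 2 powr DIM('a) / unit_ball_vol DIM('a) * \<epsilon> powr (- real DIM('a))"
  have M: "\<bar>mollifier \<epsilon> (w::'a)\<bar> \<le> ?M" for w using mollifier_facts(1,3)[OF \<epsilon>, of w] by simp
  have [measurable]: "f \<in> borel_measurable borel" "g \<in> borel_measurable borel" using f g by auto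
  show "integrable (lborel \<Otimes>\<^sub>M lborel) (\<lambda>(x, y). g x * (?M * f y))"
    by (rule integrable_lborel_product[OF g]) (use f in simp)
  show "(\<lambda>(x, y). g x * (mollifier \<epsilon> (x - y) * f y)) \<in> borel_measurable (lborel \<Otimes>\<^sub>M lborel)" by measurable
  have "norm (g x * (mollifier \<epsilon> (x - y) * f y)) \<le> norm (g x * (?M * f y))" for x y
  proof -
    have "\<bar>mollifier \<epsilon> (x - y)\<bar> * \<bar>f y\<bar> \<le> ?M * \<bar>f y\<bar>" by (intro mult_right_mono M) simp
    then have "\<bar>g x\<bar> * (\<bar>mollifier \<epsilon> (x - y)\<bar> * \<bar>f y\<bar>) \<le> \<bar>g x\<bar> * (?M * \<bar>f y\<bar>)" by (intro mult_left_mono) auto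
    also have "?M * \<bar>f y\<bar> = \<bar>?M * f y\<bar>" by (simp add: abs_mult)
    finally show ?thesis by (simp only: abs_mult real_norm_def)
  qed
  then show "AE p in lborel \<Otimes>\<^sub>M lborel. norm (case p of (x, y) \<Rightarrow> g x * (mollifier \<epsilon> (x - y) * f y)) \<le> norm (case p of (x, y) \<Rightarrow> g x * (?M * f y))"
    by (intro AE_I2) (auto split: prod.split simp del: real_norm_def)
qed

lemma mollify_measurable[measurable]:
  assumes [measurable]: "f \<in> borel_measurable borel"
  shows "mollify \<epsilon> f \<in> borel_measurable borel"
  unfolding mollify_def by measurable

lemma mollify_integrable:
  fixes f :: "'a::euclidean_space \<Rightarrow> real"
  assumes \<epsilon>: "0 < \<epsilon>" and f: "integrable lborel f"
  shows "integrable lborel (mollify \<epsilon> f)"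
proof -
  have [measurable]: "f \<in> borel_measurable borel" using f by auto
  have "integrable (lborel \<Otimes>\<^sub>M lborel) (\<lambda>(y, z). mollifier \<epsilon> (y + z) * f (- z))"
    using integrable_lborel_shift_product[of "mollifier \<epsilon> :: 'a \<Rightarrow> real" "\<lambda>z. f (0 - z)"]
      mollifier_facts(4)[OF \<epsilon>] integrable_lborel_reflect[OF f, of 0] by simp
  then have "integrable lborel (\<lambda>x. \<integral>z. mollifier \<epsilon> (x + z) * f (- z) \<partial>lborel)"
    by (rule lborel_pair.integrable_fst)
  moreover have "(\<integral>z. mollifier \<epsilon> (x + z) * f (- z) \<partial>lborel) = mollify \<epsilon> f x" for x
    using integral_lborel_reflect[of "\<lambda>y. mollifier \<epsilon> (x - y) * f y" 0] by (simp add: mollify_def)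
  ultimately show ?thesis by simp
qed

text \<open>Convolution with an even kernel is symmetric. This is what later moves one mollification
  from the test function onto u.\<close>

lemma mollify_adjoint:
  fixes f g :: "'a::euclidean_space \<Rightarrow> real"
  assumes \<epsilon>: "0 < \<epsilon>" and f: "integrable lborel f" and g: "integrable lborel g"
  shows "(\<integral>x. g x * mollify \<epsilon> f x \<partial>lborel) = (\<integral>x. mollify \<epsilon> g x * f x \<partial>lborel)"
proof -
  have "(\<integral>x. g x * mollify \<epsilon> f x \<partial>lborel) = (\<integral>x. (\<integral>y. g x * (mollifier \<epsilon> (x - y) * f y) \<partial>lborel) \<partial>lborel)"
    by (simp add: mollify_def)
  also have "\<dots> = (\<integral>y. (\<integral>x. g x * (mollifier \<epsilon> (x - y) * f y) \<partial>lborel) \<partial>lborel)"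
    by (rule lborel_pair.Fubini_integral[OF mollify_kernel_integrable[OF assms], symmetric])
  also have "\<dots> = (\<integral>y. (\<integral>x. mollifier \<epsilon> (y - x) * g x \<partial>lborel) * f y \<partial>lborel)"
    by (simp add: mollifier_minus[of _ _ y for y] mult_ac flip: integral_mult_left_zero)
  finally show ?thesis by (simp add: mollify_def)
qed

lemma mollify_shift:
  fixes f :: "'a::euclidean_space \<Rightarrow> real"
  assumes [measurable]: "f \<in> borel_measurable borel"
  shows "mollify \<epsilon> f (x + z) = mollify \<epsilon> (\<lambda>y. f (y + z)) x"
  using integral_lborel_shift[of "\<lambda>y. mollifier \<epsilon> (x + z - y) * f y" z]
  by (simp add: mollify_def algebra_simps)

lemma mollify_bound:
  fixes f :: "'a::euclidean_space \<Rightarrow> real"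
  assumes \<epsilon>: "0 < \<epsilon>" and f: "integrable lborel f" "\<And>x. \<bar>f x\<bar> \<le> 1"
  shows "\<bar>mollify \<epsilon> f x\<bar> \<le> 1"
proof -
  have [measurable]: "f \<in> borel_measurable borel" using f by auto
  have i: "integrable lborel (\<lambda>y. mollifier \<epsilon> (x - y))" by (rule integrable_lborel_reflect[OF mollifier_facts(4)[OF \<epsilon>]])
  have le: "\<bar>mollifier \<epsilon> (x - y) * f y\<bar> \<le> mollifier \<epsilon> (x - y)" for y
    using mollifier_facts(1)[OF \<epsilon>, of "x - y"] f(2)[of y] by (simp add: abs_mult mult_left_le)
  have "\<bar>mollify \<epsilon> f x\<bar> \<le> (\<integral>y. mollifier \<epsilon> (x - y) \<partial>lborel)"
    unfolding mollify_def
  proof (rule integral_abs_bound_integral[OF _ i le])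
    show "integrable lborel (\<lambda>y. mollifier \<epsilon> (x - y) * f y)"
    proof (rule Bochner_Integration.integrable_bound[OF i])
      show "AE y in lborel. norm (mollifier \<epsilon> (x - y) * f y) \<le> norm (mollifier \<epsilon> (x - y))"
      proof (rule AE_I2)
        fix y show "norm (mollifier \<epsilon> (x - y) * f y) \<le> norm (mollifier \<epsilon> (x - y))"
          using le[of y] by simp
      qed
    qed measurable
  qed
  also have "\<dots> = 1" using integral_lborel_reflect[of "mollifier \<epsilon>" x] mollifier_facts(5)[where 'a='a, OF \<epsilon>] by simp
  finally show ?thesis .
qed

text \<open>Smoothness comes from the kernel alone, so f may be discontinuous. Mollification
  enlarges the support by at most the closed ball of radius \<epsilon>, and the resulting set is
  compact.\<close>

lemma mollify_test_function:
  fixes f :: "'a::euclidean_space \<Rightarrow> real"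
  assumes \<epsilon>: "0 < \<epsilon>" and f: "integrable lborel f" "\<And>x. x \<notin> K \<Longrightarrow> f x = 0"
    and K: "compact K" "\<And>x. x \<in> K \<Longrightarrow> cball x \<epsilon> \<subseteq> \<Omega>"
  shows "mollify \<epsilon> f \<in> test_functions \<Omega>"
proof (rule test_functionsI)
  show "Ck_on k UNIV (mollify \<epsilon> f)" for k
  proof -
    let ?m = "\<integral>w. bump ((w::'a) /\<^sub>R \<epsilon>) \<partial>lborel"
    have "(\<lambda>w. inverse ?m * bump w) \<in> bumps" by (intro bumps.scale bump_in_bumps)
    from bumps_convolution_Ck[OF this \<epsilon> f(1)] show ?thesis
      by (simp add: mollify_def[abs_def] mollifier_def divide_inverse mult_ac)
  qed
  let ?K = "\<Union>x\<in>K. \<Union>y\<in>cball 0 \<epsilon>. {x + y}"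
  show "compact ?K" by (rule compact_sums'[OF K(1) compact_cball])
  show "?K \<subseteq> \<Omega>"
  proof
    fix p assume "p \<in> ?K"
    then obtain x y where xy: "x \<in> K" "norm y \<le> \<epsilon>" "p = x + y" by auto
    then have "p \<in> cball x \<epsilon>" by (simp add: dist_norm)
    then show "p \<in> \<Omega>" using K(2)[OF xy(1)] by blast
  qed
  fix x assume x: "x \<notin> ?K"
  have z: "mollifier \<epsilon> (x - y) * f y = 0" for y
  proof (cases "y \<in> K")
    case True
    have "\<not> norm (x - y) \<le> \<epsilon>"
    proof
      assume "norm (x - y) \<le> \<epsilon>"
      then have "x \<in> ?K" using True by (intro UN_I[of y] UN_I[of "x - y"]) auto
      then show False using x by simp
    qed
    then show ?thesis using mollifier_facts(2)[OF \<epsilon>, of "x - y"] by simp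
  qed (simp add: f)
  show "mollify \<epsilon> f x = 0" unfolding mollify_def by (simp only: z Bochner_Integration.integral_zero)
qed

lemma ennreal_lincomb:
  assumes "0 \<le> a" "0 \<le> b" "0 \<le> c" "0 \<le> d"
  shows "ennreal (a * (indicator A x * b) + c * d) = ennreal a * indicator A x * ennreal b + ennreal c * ennreal d"
  using assms by (cases "x \<in> A") (simp_all add: ennreal_mult)

lemma ennreal_lincomb':
  assumes "0 \<le> a" "0 \<le> b" "0 \<le> c" "0 \<le> d"
  shows "ennreal (a * b + c * d) = ennreal a * ennreal b + ennreal c * ennreal d"
  using assms by (simp add: ennreal_mult)

text \<open>The error is an average of |u y - u x| over |x - y| < \<epsilon>. Splitting this
  increment into a constant and its square turns the square into the Gagliardo integrand, because
  there \<epsilon>^(-N-s) is at most \<epsilon>^s |x - y|^(-N-2s).\<close>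

lemma mollify_L1_error:
  fixes u :: "'a::euclidean_space \<Rightarrow> real" and s S R :: real
  assumes u: "integrable lborel u" "\<And>x. R \<le> norm x \<Longrightarrow> u x = 0" and s: "0 < s" and R: "0 < R" and S: "0 \<le> S"
    and semi: "(\<integral>\<^sup>+x. (\<integral>\<^sup>+y. ennreal (\<bar>u x - u y\<bar>\<^sup>2 / dist x y powr (DIM('a) + 2 * s)) \<partial>lborel) \<partial>lborel) \<le> ennreal S"
  shows "\<exists>C. \<forall>\<epsilon>. 0 < \<epsilon> \<and> \<epsilon> \<le> 1 \<longrightarrow> (\<integral>x. \<bar>mollify \<epsilon> u x - u x\<bar> \<partial>lborel) \<le> C * \<epsilon> powr s"
proof -
  let ?N = "real DIM('a)"
  have [measurable]: "u \<in> borel_measurable borel" using u by auto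
  let ?M = "exp 2 * 2 powr ?N / unit_ball_vol ?N"
  have M0: "0 \<le> ?M" by simp
  let ?W = "unit_ball_vol ?N * (R + 1) powr ?N"
  show ?thesis
  proof (intro exI[of _ "(?W + ?M * S) / 2"] allI impI)
    fix \<epsilon> :: real assume A: "0 < \<epsilon> \<and> \<epsilon> \<le> 1"
    then have \<epsilon>: "0 < \<epsilon>" "\<epsilon> \<le> 1" by auto
    let ?\<eta> = "mollifier \<epsilon> :: 'a \<Rightarrow> real"
    let ?Q = "\<lambda>x y. \<bar>u x - u y\<bar>\<^sup>2 / dist x y powr (?N + 2 * s)"
    have int_eta: "integrable lborel (\<lambda>y. ?\<eta> (x - y))" for x by (rule integrable_lborel_reflect[OF mollifier_facts(4)[OF \<epsilon>(1)]])
    have intu: "integrable lborel (\<lambda>y. ?\<eta> (x - y) * u y)" for x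
    proof (rule Bochner_Integration.integrable_bound)
      show "integrable lborel (\<lambda>y. ?M * \<epsilon> powr (- ?N) * u y)" using u by simp
      show "AE y in lborel. norm (?\<eta> (x - y) * u y) \<le> norm (?M * \<epsilon> powr (- ?N) * u y)"
      proof (rule AE_I2)
        fix y
        have "\<bar>?\<eta> (x - y)\<bar> \<le> \<bar>?M * \<epsilon> powr (- ?N)\<bar>"
          using mollifier_facts(1,3)[OF \<epsilon>(1), of "x - y"] by simp
        then show "norm (?\<eta> (x - y) * u y) \<le> norm (?M * \<epsilon> powr (- ?N) * u y)"
          unfolding real_norm_def abs_mult[of _ "u y"] by (rule mult_right_mono) (rule abs_ge_zero)
      qed
    qed measurable
    have pw: "ennreal \<bar>mollify \<epsilon> u x - u x\<bar> \<le> (\<integral>\<^sup>+y. ennreal (?\<eta> (x - y) * \<bar>u y - u x\<bar>) \<partial>lborel)" for x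
    proof -
      have "u x = (\<integral>y. ?\<eta> (x - y) * u x \<partial>lborel)"
        using integral_lborel_reflect[of ?\<eta> x] mollifier_facts(5)[where 'a='a, OF \<epsilon>(1)] by simp
      then have "mollify \<epsilon> u x - u x = (\<integral>y. ?\<eta> (x - y) * u y \<partial>lborel) - (\<integral>y. ?\<eta> (x - y) * u x \<partial>lborel)"
        by (simp add: mollify_def)
      also have "\<dots> = (\<integral>y. ?\<eta> (x - y) * u y - ?\<eta> (x - y) * u x \<partial>lborel)"
        using int_eta by (intro Bochner_Integration.integral_diff[symmetric] intu) simp
      finally have eq: "mollify \<epsilon> u x - u x = (\<integral>y. ?\<eta> (x - y) * u y - ?\<eta> (x - y) * u x \<partial>lborel)" .
      have "ennreal (norm (\<integral>y. ?\<eta> (x - y) * u y - ?\<eta> (x - y) * u x \<partial>lborel)) \<le> (\<integral>\<^sup>+y. ennreal (norm (?\<eta> (x - y) * u y - ?\<eta> (x - y) * u x)) \<partial>lborel)"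
        using int_eta by (intro integral_norm_bound_ennreal Bochner_Integration.integrable_diff intu) simp
      moreover have "norm (?\<eta> (x - y) * u y - ?\<eta> (x - y) * u x) = ?\<eta> (x - y) * \<bar>u y - u x\<bar>" for y
        using mollifier_facts(1)[OF \<epsilon>(1), of "x - y"] by (simp add: abs_mult right_diff_distrib[symmetric])
      ultimately show ?thesis unfolding eq by simp
    qed
    \<comment> \<open>The first summand has mass 1 in y and bounded support in x; the second is
      controlled by the seminorm. Both carry the factor \<epsilon>^s.\<close>
    have key: "?\<eta> (x - y) * \<bar>u y - u x\<bar> \<le> \<epsilon> powr s / 2 * (indicator (ball 0 (R + 1)) x * ?\<eta> (x - y)) + ?M * \<epsilon> powr s / 2 * ?Q x y" for x y
    proof (cases "dist x y < \<epsilon> \<and> u x \<noteq> u y")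
      case False
      then have "?\<eta> (x - y) * \<bar>u y - u x\<bar> = 0"
        using mollifier_facts(2)[OF \<epsilon>(1), of "x - y"] by (auto simp: dist_norm)
      moreover have "0 \<le> \<epsilon> powr s / 2 * (indicator (ball 0 (R + 1)) x * ?\<eta> (x - y))"
        using mollifier_facts(1)[OF \<epsilon>(1), of "x - y"] by (intro mult_nonneg_nonneg) auto
      moreover have "0 \<le> ?M * \<epsilon> powr s / 2 * ?Q x y" by (intro mult_nonneg_nonneg divide_nonneg_nonneg M0) auto
      ultimately show ?thesis by (simp only: add_nonneg_nonneg)
    next
      case True
      then have d: "0 < dist x y" "dist x y < \<epsilon>" by auto
      \<comment> \<open>If x were farther out, y would have norm at least R as well, and both values
        of u would vanish. This localises the constant term of the splitting.\<close>
      have "x \<in> ball 0 (R + 1)"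
      proof (rule ccontr)
        assume "x \<notin> ball 0 (R + 1)"
        then have "R + 1 \<le> norm x" by simp
        moreover have "norm x \<le> norm y + dist x y" by (simp add: dist_norm norm_triangle_sub)
        ultimately have "R \<le> norm x" "R \<le> norm y" using d \<epsilon> by auto
        then show False using u(2) True by simp
      qed
      let ?a = "\<bar>u y - u x\<bar>"
      \<comment> \<open>Completed square of \<epsilon>^(s/2) - \<epsilon>^(-s/2) a, with weights
        chosen so that both terms come out with \<epsilon>^s in the end.\<close>
      have am: "?a \<le> \<epsilon> powr s / 2 + \<epsilon> powr (-s) * ?a\<^sup>2 / 2"
      proof -
        have "0 \<le> (\<epsilon> powr (s/2) - \<epsilon> powr (-s/2) * ?a)\<^sup>2" by simp
        also have "\<dots> = \<epsilon> powr s - 2 * ?a + \<epsilon> powr (-s) * ?a\<^sup>2"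
          using \<epsilon> by (simp add: power2_diff power_mult_distrib powr_power powr_add[symmetric] mult.assoc[symmetric]
              power2_eq_square[of "_ powr _"])
        finally show ?thesis by simp
      qed
      have "?\<eta> (x - y) * (\<epsilon> powr (-s) * ?a\<^sup>2) \<le> (?M * \<epsilon> powr (- ?N)) * (\<epsilon> powr (-s) * ?a\<^sup>2)"
        using mollifier_facts(3)[OF \<epsilon>(1), of "x - y"] by (intro mult_right_mono) auto
      also have "\<dots> = ?M * ?a\<^sup>2 * (\<epsilon> powr s * \<epsilon> powr (- (?N + 2 * s)))"
      proof -
        have "\<epsilon> powr (- ?N) * \<epsilon> powr (-s) = \<epsilon> powr s * \<epsilon> powr (- (?N + 2 * s))"
          by (simp add: powr_add[symmetric] algebra_simps)
        then show ?thesis by (simp add: mult_ac)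
      qed
      also have "\<dots> \<le> ?M * ?a\<^sup>2 * (\<epsilon> powr s * dist x y powr (- (?N + 2 * s)))"
        using d s M0 by (intro mult_left_mono powr_mono2') auto
      also have "\<dots> = ?M * \<epsilon> powr s * ?Q x y"
        by (simp only: powr_minus_divide) (simp add: abs_minus_commute)
      finally have "?\<eta> (x - y) * (\<epsilon> powr (-s) * ?a\<^sup>2) \<le> ?M * \<epsilon> powr s * ?Q x y" .
      moreover have "?\<eta> (x - y) * ?a \<le> ?\<eta> (x - y) * (\<epsilon> powr s / 2 + \<epsilon> powr (-s) * ?a\<^sup>2 / 2)"
        using am mollifier_facts(1)[OF \<epsilon>(1), of "x - y"] by (rule mult_left_mono)
      moreover have "?\<eta> (x - y) * (\<epsilon> powr s / 2 + \<epsilon> powr (-s) * ?a\<^sup>2 / 2)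
        = \<epsilon> powr s / 2 * ?\<eta> (x - y) + ?\<eta> (x - y) * (\<epsilon> powr (-s) * ?a\<^sup>2) / 2" by algebra
      moreover have "?M * \<epsilon> powr s / 2 * ?Q x y = ?M * \<epsilon> powr s * ?Q x y / 2" by (simp only: times_divide_eq_left)
      moreover have "indicator (ball 0 (R + 1)) x = (1::real)" using \<open>x \<in> ball 0 (R + 1)\<close> by simp
      moreover have "X \<le> E * (i * m) + R" if "P \<le> Q" "X \<le> Y" "Y = E * m + P / 2" "R = Q / 2" "i = 1" for P Q X Y R i m E :: real
        using that by simp
      ultimately show ?thesis by blast
    qed
    have [measurable]: "(\<lambda>p. ?Q (fst p) (snd p)) \<in> borel_measurable (lborel \<Otimes>\<^sub>M lborel)" by measurable
    have Qm[measurable]: "?Q x \<in> borel_measurable lborel" for x by measurable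
    have [measurable]: "ball (0::'a) (R + 1) \<in> sets borel" by simp
    have "(\<integral>\<^sup>+x. ennreal \<bar>mollify \<epsilon> u x - u x\<bar> \<partial>lborel)
      \<le> (\<integral>\<^sup>+x. ennreal (\<epsilon> powr s / 2) * indicator (ball 0 (R + 1)) x + ennreal (?M * \<epsilon> powr s / 2) * (\<integral>\<^sup>+y. ennreal (?Q x y) \<partial>lborel) \<partial>lborel)"
    proof (rule nn_integral_mono)
      fix x
      have "ennreal \<bar>mollify \<epsilon> u x - u x\<bar> \<le> (\<integral>\<^sup>+y. ennreal (?\<eta> (x - y) * \<bar>u y - u x\<bar>) \<partial>lborel)" by (rule pw)
      also have "\<dots> \<le> (\<integral>\<^sup>+y. (ennreal (\<epsilon> powr s / 2) * indicator (ball 0 (R + 1)) x) * ennreal (?\<eta> (x - y)) + ennreal (?M * \<epsilon> powr s / 2) * ennreal (?Q x y) \<partial>lborel)"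
      proof (rule nn_integral_mono)
        fix y
        have "ennreal (?\<eta> (x - y) * \<bar>u y - u x\<bar>) \<le> ennreal (\<epsilon> powr s / 2 * (indicator (ball 0 (R + 1)) x * ?\<eta> (x - y)) + ?M * \<epsilon> powr s / 2 * ?Q x y)"
          by (rule ennreal_leI[OF key])
        also have "\<dots> = (ennreal (\<epsilon> powr s / 2) * indicator (ball 0 (R + 1)) x) * ennreal (?\<eta> (x - y)) + ennreal (?M * \<epsilon> powr s / 2) * ennreal (?Q x y)"
          by (rule ennreal_lincomb) (use mollifier_facts(1)[OF \<epsilon>(1), of "x - y"] M0 in auto)
        finally show "ennreal (?\<eta> (x - y) * \<bar>u y - u x\<bar>) \<le> \<dots>" .
      qed
      also have "\<dots> = (ennreal (\<epsilon> powr s / 2) * indicator (ball 0 (R + 1)) x) * (\<integral>\<^sup>+y. ennreal (?\<eta> (x - y)) \<partial>lborel) + ennreal (?M * \<epsilon> powr s / 2) * (\<integral>\<^sup>+y. ennreal (?Q x y) \<partial>lborel)"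
        by (rule nn_integral_lincomb) measurable
      also have "(\<integral>\<^sup>+y. ennreal (?\<eta> (x - y)) \<partial>lborel) = 1"
      proof -
        have "(\<integral>\<^sup>+y. ennreal (?\<eta> (x - y)) \<partial>lborel) = ennreal (\<integral>y. ?\<eta> (x - y) \<partial>lborel)"
          using mollifier_facts(1)[OF \<epsilon>(1)] by (intro nn_integral_eq_integral int_eta) auto
        then show ?thesis using integral_lborel_reflect[of ?\<eta> x] mollifier_facts(5)[where 'a='a, OF \<epsilon>(1)] by simp
      qed
      finally show "ennreal \<bar>mollify \<epsilon> u x - u x\<bar> \<le> ennreal (\<epsilon> powr s / 2) * indicator (ball 0 (R + 1)) x + ennreal (?M * \<epsilon> powr s / 2) * (\<integral>\<^sup>+y. ennreal (?Q x y) \<partial>lborel)"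
        by simp
    qed
    also have "\<dots> = ennreal (\<epsilon> powr s / 2) * (\<integral>\<^sup>+x. indicator (ball (0::'a) (R + 1)) x \<partial>lborel) + ennreal (?M * \<epsilon> powr s / 2) * (\<integral>\<^sup>+x. (\<integral>\<^sup>+y. ennreal (?Q x y) \<partial>lborel) \<partial>lborel)"
      by (rule nn_integral_lincomb) measurable
    also have "(\<integral>\<^sup>+x. indicator (ball (0::'a) (R + 1)) x \<partial>lborel) = ennreal ?W"
      using emeasure_ball_powr[of "R + 1" "0::'a"] R by (simp del: emeasure_ball)
    also have "ennreal (\<epsilon> powr s / 2) * ennreal ?W + ennreal (?M * \<epsilon> powr s / 2) * (\<integral>\<^sup>+x. (\<integral>\<^sup>+y. ennreal (?Q x y) \<partial>lborel) \<partial>lborel)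
      \<le> ennreal (\<epsilon> powr s / 2) * ennreal ?W + ennreal (?M * \<epsilon> powr s / 2) * ennreal S"
      by (intro add_left_mono mult_left_mono semi) auto
    also have "\<dots> = ennreal (\<epsilon> powr s / 2 * ?W + ?M * \<epsilon> powr s / 2 * S)"
      by (rule ennreal_lincomb'[symmetric]) (use S M0 R in auto)
    also have "\<epsilon> powr s / 2 * ?W + ?M * \<epsilon> powr s / 2 * S = (?W + ?M * S) / 2 * \<epsilon> powr s" by (simp add: algebra_simps)
    finally have "(\<integral>\<^sup>+x. ennreal \<bar>mollify \<epsilon> u x - u x\<bar> \<partial>lborel) \<le> ennreal ((?W + ?M * S) / 2 * \<epsilon> powr s)" .
    moreover have "(\<integral>\<^sup>+x. ennreal \<bar>mollify \<epsilon> u x - u x\<bar> \<partial>lborel) = ennreal (\<integral>x. \<bar>mollify \<epsilon> u x - u x\<bar> \<partial>lborel)"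
      using u mollify_integrable[OF \<epsilon>(1) u(1)] by (intro nn_integral_eq_integral) auto
    ultimately have "ennreal (\<integral>x. \<bar>mollify \<epsilon> u x - u x\<bar> \<partial>lborel) \<le> ennreal ((?W + ?M * S) / 2 * \<epsilon> powr s)" by (simp only:)
    moreover have "0 \<le> (?W + ?M * S) / 2 * \<epsilon> powr s"
      using S by (intro mult_nonneg_nonneg divide_nonneg_nonneg add_nonneg_nonneg) auto
    ultimately show "(\<integral>x. \<bar>mollify \<epsilon> u x - u x\<bar> \<partial>lborel) \<le> (?W + ?M * S) / 2 * \<epsilon> powr s"
      by (simp only: ennreal_le_iff)
  qed
qed

section \<open>A nonlocal Kato inequality\<close>

lemma integrable_dominated:
  fixes f g :: "'b \<Rightarrow> real"
  assumes "integrable M g" "f \<in> borel_measurable M" "\<And>x. \<bar>f x\<bar> \<le> g x"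
  shows "integrable M f"
proof (rule Bochner_Integration.integrable_bound[OF assms(1,2)])
  have "norm (f x) \<le> norm (g x)" for x using assms(3)[of x] by simp
  then show "AE x in M. norm (f x) \<le> norm (g x)" by simp
qed

lemma lipschitz_kernel_integrable:
  fixes s :: real
  assumes s: "0 < s" "s < 1" and dim: "2 \<le> DIM('a::euclidean_space)"
  shows "integrable lborel (\<lambda>z::'a. min 1 (norm z) * norm z powr (- (DIM('a) + s)))"
proof -
  have "(\<lambda>z::'a. min 1 (norm z) * norm z powr (- (DIM('a) + s))) = (\<lambda>z::'a. min 1 (norm z powr 1) * norm z powr (- (DIM('a) + s)))"
    by (rule ext) simp
  then show ?thesis using kernel_min_integrable[where 'a='a, of s 1] s dim by simp
qed

text \<open>The Lipschitz increment of \<zeta> alone tames the kernel, since s < 1, so v needs no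
  more than integrability. The bound is linear in the L1 norm of v; this continuity is what allows v
  to be replaced by an L1 limit.\<close>

lemma difference_product_integrable:
  fixes s L :: real and v w \<zeta> :: "'a::euclidean_space \<Rightarrow> real"
  assumes s: "0 < s" "s < 1" and dim: "2 \<le> DIM('a)"
    and v: "integrable lborel v" and \<zeta>: "\<zeta> \<in> borel_measurable borel" "\<And>x y. \<bar>\<zeta> x - \<zeta> y\<bar> \<le> L * min 1 (dist x y)"
    and w: "w \<in> borel_measurable borel" "\<And>x. \<bar>w x\<bar> \<le> M"
  shows "integrable (lborel \<Otimes>\<^sub>M lborel) (\<lambda>(x, z). norm z powr (- (DIM('a) + s)) * ((v x - v (x + z)) * w x * (\<zeta> x - \<zeta> (x + z))))"
    and "\<bar>\<integral>(x, z). norm z powr (- (DIM('a) + s)) * ((v x - v (x + z)) * w x * (\<zeta> x - \<zeta> (x + z))) \<partial>(lborel \<Otimes>\<^sub>M lborel)\<bar>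
      \<le> 2 * M * L * (\<integral>z. min 1 (norm z) * norm z powr (- (DIM('a) + s)) \<partial>(lborel :: 'a measure)) * (\<integral>x. \<bar>v x\<bar> \<partial>lborel)"
proof -
  let ?K = "\<lambda>z::'a. norm z powr (- (DIM('a) + s))"
  let ?h = "\<lambda>z::'a. min 1 (norm z) * ?K z"
  let ?F = "\<lambda>(x, z). ?K z * ((v x - v (x + z)) * w x * (\<zeta> x - \<zeta> (x + z)))"
  note [measurable] = \<zeta>(1) w(1)
  have [measurable]: "v \<in> borel_measurable borel" using v by auto
  have h: "integrable lborel ?h" by (rule lipschitz_kernel_integrable[OF s dim])
  have M0: "0 \<le> M" using w(2)[of 0] by linarith
  have av: "integrable lborel (\<lambda>x. \<bar>v x\<bar>)" using v by simp
  have i1: "integrable (lborel \<Otimes>\<^sub>M lborel) (\<lambda>(x, z). \<bar>v x\<bar> * ?h z)" by (rule integrable_lborel_product[OF av h])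
  have i2: "integrable (lborel \<Otimes>\<^sub>M lborel) (\<lambda>(x, z). \<bar>v (x + z)\<bar> * ?h z)" by (rule integrable_lborel_shift_product[OF av h])
  let ?G = "\<lambda>p. (M * L) * ((case p of (x, z) \<Rightarrow> \<bar>v x\<bar> * ?h z) + (case p of (x, z) \<Rightarrow> \<bar>v (x + z)\<bar> * ?h z))"
  have G: "integrable (lborel \<Otimes>\<^sub>M lborel) ?G" using i1 i2 by simp
  have le: "\<bar>?F p\<bar> \<le> ?G p" for p
  proof (cases p)
    case (Pair x z)
    have "\<bar>v x - v (x + z)\<bar> * \<bar>w x\<bar> * \<bar>\<zeta> x - \<zeta> (x + z)\<bar> \<le> (\<bar>v x\<bar> + \<bar>v (x + z)\<bar>) * M * (L * min 1 (norm z))"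
      using \<zeta>(2)[of x "x + z"] w(2)[of x] M0 by (intro mult_mono) (auto simp: dist_norm)
    then have "?K z * (\<bar>v x - v (x + z)\<bar> * \<bar>w x\<bar> * \<bar>\<zeta> x - \<zeta> (x + z)\<bar>) \<le> ?K z * ((\<bar>v x\<bar> + \<bar>v (x + z)\<bar>) * M * (L * min 1 (norm z)))"
      by (intro mult_left_mono) auto
    also have "\<dots> = ?G p" using Pair by (simp add: algebra_simps)
    finally show ?thesis using Pair by (simp add: abs_mult)
  qed
  show F: "integrable (lborel \<Otimes>\<^sub>M lborel) ?F"
    by (rule integrable_dominated[OF G _ le]) measurable
  have "\<bar>\<integral>p. ?F p \<partial>(lborel \<Otimes>\<^sub>M lborel)\<bar> \<le> (\<integral>p. ?G p \<partial>(lborel \<Otimes>\<^sub>M lborel))"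
    by (rule integral_abs_bound_integral[OF F G le])
  also have "\<dots> = (M * L) * ((\<integral>p. (case p of (x, z) \<Rightarrow> \<bar>v x\<bar> * ?h z) \<partial>(lborel \<Otimes>\<^sub>M lborel)) + (\<integral>p. (case p of (x, z) \<Rightarrow> \<bar>v (x + z)\<bar> * ?h z) \<partial>(lborel \<Otimes>\<^sub>M lborel)))"
    using i1 i2 by simp
  also have "(\<integral>p. (case p of (x, z) \<Rightarrow> \<bar>v x\<bar> * ?h z) \<partial>(lborel \<Otimes>\<^sub>M lborel)) = (\<integral>z. ?h z \<partial>lborel) * (\<integral>x. \<bar>v x\<bar> \<partial>lborel)"
    by (subst lborel_pair.integral_snd[symmetric, OF i1]) simp
  also have "(\<integral>p. (case p of (x, z) \<Rightarrow> \<bar>v (x + z)\<bar> * ?h z) \<partial>(lborel \<Otimes>\<^sub>M lborel)) = (\<integral>z. ?h z \<partial>lborel) * (\<integral>x. \<bar>v x\<bar> \<partial>lborel)"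
  proof -
    have "(\<integral>x. \<bar>v (x + z)\<bar> \<partial>lborel) = (\<integral>x. \<bar>v x\<bar> \<partial>lborel)" for z
      using integral_lborel_shift[of "\<lambda>x. \<bar>v x\<bar>" z] by (simp add: add.commute)
    then show ?thesis by (subst lborel_pair.integral_snd[symmetric, OF i2]) simp
  qed
  finally show "\<bar>\<integral>p. ?F p \<partial>(lborel \<Otimes>\<^sub>M lborel)\<bar> \<le> 2 * M * L * (\<integral>z. ?h z \<partial>lborel) * (\<integral>x. \<bar>v x\<bar> \<partial>lborel)"
    by (simp add: algebra_simps)
qed

text \<open>For the order s < 1 the first increment of a Lipschitz function is already integrable
  against the kernel, and both halves of the second difference have the same integral. Keeping z as
  the outer variable allows the inner integral to be manipulated for each fixed increment.\<close>

lemma fractional_pairing: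
  fixes s L :: real and u \<phi> :: "'a::euclidean_space \<Rightarrow> real"
  assumes s: "0 < s" "s < 1" and dim: "2 \<le> DIM('a)"
    and u: "integrable lborel u" and \<phi>: "tame \<phi>" "\<And>x y. \<bar>\<phi> x - \<phi> y\<bar> \<le> L * min 1 (dist x y)"
  shows "integrable lborel (\<lambda>z. norm z powr (- (DIM('a) + s)) * (\<integral>x. u x * (\<phi> x - \<phi> (x + z)) \<partial>lborel))" (is ?A)
    and "(\<integral>x. u x * frac_lap (s / 2) \<phi> x \<partial>lborel)
      = frac_lap_const DIM('a) (s / 2) * (\<integral>z. norm z powr (- (DIM('a) + s)) * (\<integral>x. u x * (\<phi> x - \<phi> (x + z)) \<partial>lborel) \<partial>lborel)" (is ?B)
proof -
  let ?K = "\<lambda>z::'a. norm z powr (- (DIM('a) + s))" and ?c = "frac_lap_const DIM('a) (s / 2)"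
  let ?h = "\<lambda>z::'a. min 1 (norm z) * ?K z"
  have [measurable]: "u \<in> borel_measurable borel" "\<phi> \<in> borel_measurable borel" using u tame_measurable[OF \<phi>(1)] by auto
  have h: "integrable lborel (\<lambda>z. L * ?h z)" using lipschitz_kernel_integrable[OF s dim] by simp
  have le: "\<bar>(\<phi> x - \<phi> (x + z)) * ?K z\<bar> \<le> L * ?h z" for x z
  proof -
    have "\<bar>\<phi> x - \<phi> (x + z)\<bar> * ?K z \<le> L * min 1 (norm z) * ?K z"
      using \<phi>(2)[of x "x + z"] by (intro mult_right_mono) (auto simp: dist_norm)
    then show ?thesis by (simp add: abs_mult mult.assoc)
  qed
  have int: "integrable lborel (\<lambda>z. (\<phi> x - \<phi> (x + z)) * ?K z)" for x
    by (rule integrable_dominated[OF h _ le]) measurable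
  have fl: "frac_lap (s / 2) \<phi> x = ?c * (\<integral>z. (\<phi> x - \<phi> (x + z)) * ?K z \<partial>lborel)" for x
  proof -
    let ?D = "\<lambda>z. (\<phi> x - \<phi> (x + z)) * ?K z"
    have "(\<integral>z. second_diff \<phi> x z * ?K z \<partial>lborel) = (\<integral>z. ?D z + ?D (0 - z) \<partial>lborel)"
      by (intro Bochner_Integration.integral_cong refl) (simp add: second_diff_def algebra_simps)
    also have "\<dots> = (\<integral>z. ?D z \<partial>lborel) + (\<integral>z. ?D (0 - z) \<partial>lborel)"
      by (rule Bochner_Integration.integral_add[OF int integrable_lborel_reflect[OF int]])
    also have "(\<integral>z. ?D (0 - z) \<partial>lborel) = (\<integral>z. ?D z \<partial>lborel)"
      by (rule integral_lborel_reflect) measurable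
    finally show ?thesis using frac_lap_tame[OF \<phi>(1), of "s / 2" x] s dim by simp
  qed
  have i: "integrable (lborel \<Otimes>\<^sub>M lborel) (\<lambda>(x, z). u x * ((\<phi> x - \<phi> (x + z)) * ?K z))"
  proof (rule Bochner_Integration.integrable_bound[OF integrable_lborel_product[OF u h]])
    show "(\<lambda>(x, z). u x * ((\<phi> x - \<phi> (x + z)) * ?K z)) \<in> borel_measurable (lborel \<Otimes>\<^sub>M lborel)" by measurable
    have "norm (u x * ((\<phi> x - \<phi> (x + z)) * ?K z)) \<le> norm (u x * (L * ?h z))" for x z
    proof -
      have "\<bar>u x\<bar> * \<bar>(\<phi> x - \<phi> (x + z)) * ?K z\<bar> \<le> \<bar>u x\<bar> * \<bar>L * ?h z\<bar>"
        by (rule mult_left_mono[OF order_trans[OF le abs_ge_self]]) simp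
      then show ?thesis by (simp only: abs_mult real_norm_def)
    qed
    then show "AE p in lborel \<Otimes>\<^sub>M lborel. norm (case p of (x, z) \<Rightarrow> u x * ((\<phi> x - \<phi> (x + z)) * ?K z)) \<le> norm (case p of (x, z) \<Rightarrow> u x * (L * ?h z))"
      by (intro AE_I2) (auto split: prod.split simp del: real_norm_def)
  qed
  have eq: "(\<integral>x. u x * ((\<phi> x - \<phi> (x + z)) * ?K z) \<partial>lborel) = ?K z * (\<integral>x. u x * (\<phi> x - \<phi> (x + z)) \<partial>lborel)" for z
  proof -
    have "(\<integral>x. u x * ((\<phi> x - \<phi> (x + z)) * ?K z) \<partial>lborel) = (\<integral>x. ?K z * (u x * (\<phi> x - \<phi> (x + z))) \<partial>lborel)"
      by (intro Bochner_Integration.integral_cong refl) simp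
    then show ?thesis by (simp only: integral_mult_right_zero)
  qed
  show ?A using lborel_pair.integrable_snd[OF i] unfolding eq .
  have "(\<integral>x. u x * frac_lap (s / 2) \<phi> x \<partial>lborel) = (\<integral>x. ?c * (\<integral>z. u x * ((\<phi> x - \<phi> (x + z)) * ?K z) \<partial>lborel) \<partial>lborel)"
    by (intro Bochner_Integration.integral_cong refl) (simp add: fl)
  also have "\<dots> = ?c * (\<integral>x. (\<integral>z. u x * ((\<phi> x - \<phi> (x + z)) * ?K z) \<partial>lborel) \<partial>lborel)"
    by (rule integral_mult_right_zero)
  also have "(\<integral>x. (\<integral>z. u x * ((\<phi> x - \<phi> (x + z)) * ?K z) \<partial>lborel) \<partial>lborel) = (\<integral>z. (\<integral>x. u x * ((\<phi> x - \<phi> (x + z)) * ?K z) \<partial>lborel) \<partial>lborel)"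
    by (rule lborel_pair.Fubini_integral[OF i, symmetric])
  finally show ?B unfolding eq .
qed

lemma integrable_mult_bounded:
  fixes f g :: "'a::euclidean_space \<Rightarrow> real"
  assumes f: "integrable lborel f" and g: "g \<in> borel_measurable borel" "\<And>x. \<bar>g x\<bar> \<le> M"
  shows "integrable lborel (\<lambda>x. f x * g x)"
proof (rule Bochner_Integration.integrable_bound[of _ "\<lambda>x. M * f x"])
  note [measurable] = g(1)
  have [measurable]: "f \<in> borel_measurable borel" using f by auto
  show "integrable lborel (\<lambda>x. M * f x)" using f by simp
  show "(\<lambda>x. f x * g x) \<in> borel_measurable lborel" by measurable
  show "AE x in lborel. norm (f x * g x) \<le> norm (M * f x)"
  proof (rule AE_I2)
    fix x
    have "\<bar>f x\<bar> * \<bar>g x\<bar> \<le> \<bar>f x\<bar> * \<bar>M\<bar>" using g(2)[of x] by (intro mult_left_mono) auto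
    then show "norm (f x * g x) \<le> norm (M * f x)" by (simp add: abs_mult mult.commute)
  qed
qed

text \<open>Testing with \<open>\<eta>\<^sub>\<epsilon> * (\<zeta> T(\<eta>\<^sub>\<epsilon> * u))\<close>, which is smooth although \<open>T\<close> is not, makes both arguments of
  the energy form mollified. The part of the form containing the increment of \<open>T(\<eta>\<^sub>\<epsilon> * u)\<close> is
  nonnegative and dropped.\<close>
lemma kato_mollified:
  fixes s A L :: real and u \<zeta> :: "'a::euclidean_space \<Rightarrow> real" and T :: "real \<Rightarrow> real"
  assumes s: "0 < s" "s < 1" and dim: "2 \<le> DIM('a)" and \<epsilon>: "0 < \<epsilon>"
    and u: "integrable lborel u"
    and A: "\<And>\<phi>. \<phi> \<in> test_functions \<Omega> \<Longrightarrow> (\<And>x. \<bar>\<phi> x\<bar> \<le> 1) \<Longrightarrow> \<bar>\<integral>x. u x * frac_lap (s / 2) \<phi> x \<partial>lborel\<bar> \<le> A"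
    and \<zeta>: "\<zeta> \<in> borel_measurable borel" "\<And>x y. \<bar>\<zeta> x - \<zeta> y\<bar> \<le> L * min 1 (dist x y)" "\<And>x. 0 \<le> \<zeta> x" "\<And>x. \<zeta> x \<le> 1"
    and K: "compact K" "\<And>x. x \<in> K \<Longrightarrow> cball x \<epsilon> \<subseteq> \<Omega>" "\<And>x. x \<notin> K \<Longrightarrow> \<zeta> x = 0"
    and T: "T \<in> borel_measurable borel" "mono T" "\<And>t. \<bar>T t\<bar> \<le> 1"
  shows "(\<integral>(x, z). norm z powr (- (DIM('a) + s)) * ((mollify \<epsilon> u x - mollify \<epsilon> u (x + z)) * T (mollify \<epsilon> u x) * (\<zeta> x - \<zeta> (x + z))) \<partial>(lborel \<Otimes>\<^sub>M lborel))
    \<le> 2 * A / \<bar>frac_lap_const DIM('a) (s / 2)\<bar>"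
proof -
  let ?K = "\<lambda>z::'a. norm z powr (- (DIM('a) + s))" and ?c = "frac_lap_const DIM('a) (s / 2)"
  note [measurable] = \<zeta>(1) T(1)
  have [measurable]: "u \<in> borel_measurable borel" using u by auto
  define v where "v = mollify \<epsilon> u"
  have vint: "integrable lborel v" unfolding v_def by (rule mollify_integrable[OF \<epsilon> u])
  have [measurable]: "v \<in> borel_measurable borel" unfolding v_def by measurable
  define \<psi> where "\<psi> x = \<zeta> x * T (v x)" for x
  have [measurable]: "\<psi> \<in> borel_measurable borel" unfolding \<psi>_def by measurable
  have \<psi>1: "\<bar>\<psi> x\<bar> \<le> 1" for x
    using \<zeta>(3,4)[of x] T(3)[of "v x"] unfolding \<psi>_def abs_mult by (intro mult_le_one) auto
  have \<psi>0: "\<psi> x = 0" if "x \<notin> K" for x using K(3)[OF that] by (simp add: \<psi>_def)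
  have [measurable]: "K \<in> sets borel" using K(1) by (simp add: borel_compact)
  have \<psi>int: "integrable lborel \<psi>"
  proof (rule Bochner_Integration.integrable_bound[of _ "indicator K :: 'a \<Rightarrow> real"])
    show "integrable lborel (indicator K :: 'a \<Rightarrow> real)"
      using K(1) by (intro integrable_real_indicator emeasure_compact_finite) auto
    show "AE x in lborel. norm (\<psi> x) \<le> norm (indicator K x :: real)"
      using \<psi>1 \<psi>0 by (intro AE_I2) (auto simp: indicator_def)
  qed measurable
  define \<phi> where "\<phi> = mollify \<epsilon> \<psi>"
  have \<phi>t: "\<phi> \<in> test_functions \<Omega>" unfolding \<phi>_def by (rule mollify_test_function[OF \<epsilon> \<psi>int \<psi>0 K(1,2)])
  have \<phi>1: "\<bar>\<phi> x\<bar> \<le> 1" for x unfolding \<phi>_def by (rule mollify_bound[OF \<epsilon> \<psi>int \<psi>1])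
  obtain L' where L': "\<And>x y. \<bar>\<phi> x - \<phi> y\<bar> \<le> L' * min 1 (dist x y)" using test_function_tame(3)[OF \<phi>t] by blast
  note tame = test_function_tame(1)[OF \<phi>t]
  have [measurable]: "\<phi> \<in> borel_measurable borel" by (rule tame_measurable[OF tame])
  \<comment> \<open>For fixed z, mollification commutes with translation and is symmetric, so it
    passes from \<phi> to u: the pairing of u with \<phi> becomes that of v = \<eta>*u with the
    unmollified \<psi>.\<close>
  define a where "a z = (\<integral>x. v x * (\<psi> x - \<psi> (x + z)) \<partial>lborel)" for z
  have a_eq: "(\<integral>x. u x * (\<phi> x - \<phi> (x + z)) \<partial>lborel) = a z" for z
  proof -
    have \<psi>z: "integrable lborel (\<lambda>y. \<psi> (y + z))" using integrable_lborel_shift[OF \<psi>int, of z] by (simp add: add.commute)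
    have sh: "\<phi> (x + z) = mollify \<epsilon> (\<lambda>y. \<psi> (y + z)) x" for x unfolding \<phi>_def by (rule mollify_shift) measurable
    have "(\<integral>x. u x * (\<phi> x - \<phi> (x + z)) \<partial>lborel) = (\<integral>x. u x * \<phi> x - u x * \<phi> (x + z) \<partial>lborel)"
      by (simp add: right_diff_distrib)
    also have "\<dots> = (\<integral>x. u x * \<phi> x \<partial>lborel) - (\<integral>x. u x * \<phi> (x + z) \<partial>lborel)"
      by (intro Bochner_Integration.integral_diff integrable_mult_bounded[OF u, where M=1] \<phi>1) measurable
    also have "(\<integral>x. u x * \<phi> x \<partial>lborel) = (\<integral>x. v x * \<psi> x \<partial>lborel)"
      unfolding \<phi>_def v_def by (rule mollify_adjoint[OF \<epsilon> \<psi>int u])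
    also have "(\<integral>x. u x * \<phi> (x + z) \<partial>lborel) = (\<integral>x. v x * \<psi> (x + z) \<partial>lborel)"
      unfolding sh v_def by (rule mollify_adjoint[OF \<epsilon> \<psi>z u])
    also have "(\<integral>x. v x * \<psi> x \<partial>lborel) - (\<integral>x. v x * \<psi> (x + z) \<partial>lborel) = (\<integral>x. v x * \<psi> x - v x * \<psi> (x + z) \<partial>lborel)"
      by (intro Bochner_Integration.integral_diff[symmetric] integrable_mult_bounded[OF vint, where M=1] \<psi>1) measurable
    finally show ?thesis by (simp add: a_def right_diff_distrib)
  qed
  have Ka: "integrable lborel (\<lambda>z. ?K z * a z)" 
    and pair: "(\<integral>x. u x * frac_lap (s / 2) \<phi> x \<partial>lborel) = ?c * (\<integral>z. ?K z * a z \<partial>lborel)"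
    using fractional_pairing[OF s dim u tame L'] unfolding a_eq by auto
  \<comment> \<open>Shifting x by z shows b(z) = a(z) + a(-z). As the kernel is even, the integral
    doubles; hence the factor 2 in the conclusion.\<close>
  define b where "b z = (\<integral>x. (v x - v (x + z)) * (\<psi> x - \<psi> (x + z)) \<partial>lborel)" for z
  have b_eq: "b z = a z + a (0 - z)" for z
  proof -
    have "a (0 - z) = (\<integral>x. v (z + x) * (\<psi> (z + x) - \<psi> (z + x + (0 - z))) \<partial>lborel)"
      unfolding a_def by (rule integral_lborel_shift[symmetric]) measurable
    also have "\<dots> = (\<integral>x. v (x + z) * (\<psi> (x + z) - \<psi> x) \<partial>lborel)"
      by (intro Bochner_Integration.integral_cong refl) (simp add: add.commute)
    finally have a': "a (0 - z) = (\<integral>x. v (x + z) * (\<psi> (x + z) - \<psi> x) \<partial>lborel)" .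
    have \<psi>2: "\<bar>\<psi> x - \<psi> y\<bar> \<le> 2" for x y using \<psi>1[of x] \<psi>1[of y] by linarith
    have vz: "integrable lborel (\<lambda>x. v (x + z))" using integrable_lborel_shift[OF vint, of z] by (simp add: add.commute)
    have "a z + a (0 - z) = (\<integral>x. v x * (\<psi> x - \<psi> (x + z)) + v (x + z) * (\<psi> (x + z) - \<psi> x) \<partial>lborel)"
      unfolding a' a_def[of z]
      by (intro Bochner_Integration.integral_add[symmetric] integrable_mult_bounded[OF vint, where M=2] integrable_mult_bounded[OF vz, where M=2] \<psi>2) measurable
    then show ?thesis unfolding b_def by (simp add: algebra_simps)
  qed
  have Kneg: "?K (0 - z) = ?K z" for z by simp
  have Ka': "integrable lborel (\<lambda>z. ?K z * a (0 - z))"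
    using integrable_lborel_reflect[OF Ka, of 0] unfolding Kneg .
  have Kb: "integrable lborel (\<lambda>z. ?K z * b z)" unfolding b_eq distrib_left using Ka Ka' by simp
  have Kam: "(\<lambda>z. ?K z * a z) \<in> borel_measurable borel" using Ka by auto
  have "(\<integral>z. ?K z * b z \<partial>lborel) = (\<integral>z. ?K z * a z \<partial>lborel) + (\<integral>z. ?K z * a (0 - z) \<partial>lborel)"
    unfolding b_eq distrib_left by (rule Bochner_Integration.integral_add[OF Ka Ka'])
  also have "(\<integral>z. ?K z * a (0 - z) \<partial>lborel) = (\<integral>z. ?K z * a z \<partial>lborel)"
    using integral_lborel_reflect[OF Kam, of 0] unfolding Kneg .
  finally have Kb_eq: "(\<integral>z. ?K z * b z \<partial>lborel) = 2 * (\<integral>z. ?K z * a z \<partial>lborel)" by simp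
  define F where "F x z = ?K z * ((v x - v (x + z)) * T (v x) * (\<zeta> x - \<zeta> (x + z)))" for x z
  have Fint: "integrable (lborel \<Otimes>\<^sub>M lborel) (\<lambda>(x, z). F x z)"
    unfolding F_def by (rule difference_product_integrable(1)[OF s dim vint \<zeta>(1,2), of "\<lambda>x. T (v x)" 1]) (use T in measurable)
  have "(\<integral>(x, z). F x z \<partial>(lborel \<Otimes>\<^sub>M lborel)) = (\<integral>z. (\<integral>x. F x z \<partial>lborel) \<partial>lborel)"
    by (rule lborel_pair.integral_snd[OF Fint, symmetric])
  also have "\<dots> \<le> (\<integral>z. ?K z * b z \<partial>lborel)"
  proof (rule integral_mono[OF lborel_pair.integrable_snd[OF Fint] Kb])
    fix z
    have vz: "integrable lborel (\<lambda>x. v x - v (x + z))"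
      using integrable_lborel_shift[OF vint, of z] vint by (simp add: add.commute)
    have eq: "(\<integral>x. F x z \<partial>lborel) = ?K z * (\<integral>x. (v x - v (x + z)) * (T (v x) * (\<zeta> x - \<zeta> (x + z))) \<partial>lborel)"
      unfolding F_def by (simp only: mult.assoc integral_mult_right_zero)
    have b2: "\<bar>\<zeta> x - \<zeta> (x + z)\<bar> \<le> 1" for x
      using \<zeta>(3,4)[of x] \<zeta>(3,4)[of "x + z"] by (auto simp: abs_le_iff)
    have b3: "\<bar>T (v x) * (\<zeta> x - \<zeta> (x + z))\<bar> \<le> 1" for x
      using T(3)[of "v x"] b2[of x] unfolding abs_mult by (intro mult_le_one) auto
    have \<psi>2: "\<bar>\<psi> x - \<psi> y\<bar> \<le> 2" for x y using \<psi>1[of x] \<psi>1[of y] by linarith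
    have "(\<integral>x. (v x - v (x + z)) * (T (v x) * (\<zeta> x - \<zeta> (x + z))) \<partial>lborel) \<le> b z"
      unfolding b_def
    proof (rule integral_mono)
      show "integrable lborel (\<lambda>x. (v x - v (x + z)) * (T (v x) * (\<zeta> x - \<zeta> (x + z))))"
        by (rule integrable_mult_bounded[OF vz _ b3]) measurable
      show "integrable lborel (\<lambda>x. (v x - v (x + z)) * (\<psi> x - \<psi> (x + z)))"
        by (rule integrable_mult_bounded[OF vz _ \<psi>2]) measurable
      fix x
      have "0 \<le> (v x - v (x + z)) * (T (v x) - T (v (x + z)))"
      proof (cases "v (x + z) \<le> v x")
        case True
        then show ?thesis using monoD[OF T(2) True] by simp
      next
        case False
        then have "v x \<le> v (x + z)" by simp
        then show ?thesis using monoD[OF T(2), of "v x" "v (x + z)"] by (simp add: mult_nonpos_nonpos)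
      qed
      \<comment> \<open>Discrete Leibniz rule: the increment of \<psi> = \<zeta> T(v) is T(v x)
        times the increment of \<zeta> plus \<zeta>(x + z) times the increment of T(v). Monotonicity
        of T gives the second part, multiplied by the increment of v, the right sign.\<close>
      then have "0 \<le> \<zeta> (x + z) * ((v x - v (x + z)) * (T (v x) - T (v (x + z))))" using \<zeta>(3) by simp
      also have "\<dots> = (v x - v (x + z)) * (\<psi> x - \<psi> (x + z)) - (v x - v (x + z)) * (T (v x) * (\<zeta> x - \<zeta> (x + z)))"
        by (simp add: \<psi>_def algebra_simps)
      finally show "(v x - v (x + z)) * (T (v x) * (\<zeta> x - \<zeta> (x + z))) \<le> (v x - v (x + z)) * (\<psi> x - \<psi> (x + z))" by simp
    qed
    then show "(\<integral>x. F x z \<partial>lborel) \<le> ?K z * b z" unfolding eq by (intro mult_left_mono) auto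
  qed
  also have "\<dots> \<le> 2 * A / \<bar>?c\<bar>"
  proof -
    have c: "?c \<noteq> 0" using frac_lap_const_nonzero[of "s / 2"] s by simp
    have "\<bar>?c * (\<integral>z. ?K z * a z \<partial>lborel)\<bar> \<le> A" using A[OF \<phi>t \<phi>1] pair by simp
    then have "\<bar>\<integral>z. ?K z * a z \<partial>lborel\<bar> \<le> A / \<bar>?c\<bar>" using c by (simp add: abs_mult field_simps)
    then show ?thesis unfolding Kb_eq by simp
  qed
  finally show ?thesis by (simp add: F_def v_def)
qed

text \<open>In the form of \<open>kato_mollified\<close> v occurs linearly and inside T. The linear
  occurrence is replaced by u through the L1 bound, uniformly in the bounded factor T(v). Inside T
  only almost everywhere convergence along a subsequence is at hand, and there dominated convergence
  applies.\<close>

lemma kato_limit: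
  fixes s A L S R \<epsilon>\<^sub>0 :: real and u \<zeta> :: "'a::euclidean_space \<Rightarrow> real" and T :: "real \<Rightarrow> real"
  assumes s: "0 < s" "s < 1" and dim: "2 \<le> DIM('a)" and \<epsilon>\<^sub>0: "0 < \<epsilon>\<^sub>0"
    and u: "integrable lborel u" "\<And>x. R \<le> norm x \<Longrightarrow> u x = 0" and R: "0 < R" and S: "0 \<le> S"
    and semi: "(\<integral>\<^sup>+x. (\<integral>\<^sup>+y. ennreal (\<bar>u x - u y\<bar>\<^sup>2 / dist x y powr (DIM('a) + 2 * s)) \<partial>lborel) \<partial>lborel) \<le> ennreal S"
    and A: "\<And>\<phi>. \<phi> \<in> test_functions \<Omega> \<Longrightarrow> (\<And>x. \<bar>\<phi> x\<bar> \<le> 1) \<Longrightarrow> \<bar>\<integral>x. u x * frac_lap (s / 2) \<phi> x \<partial>lborel\<bar> \<le> A"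
    and \<zeta>: "\<zeta> \<in> borel_measurable borel" "\<And>x y. \<bar>\<zeta> x - \<zeta> y\<bar> \<le> L * min 1 (dist x y)" "\<And>x. 0 \<le> \<zeta> x" "\<And>x. \<zeta> x \<le> 1"
    and K: "compact K" "\<And>x. x \<in> K \<Longrightarrow> cball x \<epsilon>\<^sub>0 \<subseteq> \<Omega>" "\<And>x. x \<notin> K \<Longrightarrow> \<zeta> x = 0"
    and T: "continuous_on UNIV T" "mono T" "\<And>t. \<bar>T t\<bar> \<le> 1"
  shows "(\<integral>(x, z). norm z powr (- (DIM('a) + s)) * ((u x - u (x + z)) * T (u x) * (\<zeta> x - \<zeta> (x + z))) \<partial>(lborel \<Otimes>\<^sub>M lborel))
    \<le> 2 * A / \<bar>frac_lap_const DIM('a) (s / 2)\<bar>"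
proof -
  let ?K = "\<lambda>z::'a. norm z powr (- (DIM('a) + s))"
  define F where "F v w = (\<lambda>(x, z). ?K z * ((v x - v (x + z)) * w x * (\<zeta> x - \<zeta> (x + z))))" for v w :: "'a \<Rightarrow> real"
  have [measurable]: "T \<in> borel_measurable borel" using T(1) by (rule borel_measurable_continuous_onI)
  have [measurable]: "u \<in> borel_measurable borel" using u by auto
  \<comment> \<open>The scales stay below \<open>\<epsilon>\<^sub>0\<close>, so that the mollified
    test functions are supported in \<Omega>, and below 1, as the L1 error estimate
    requires.\<close>
  define e where "e n = min \<epsilon>\<^sub>0 1 / real (Suc n)" for n
  have e: "0 < e n" "e n \<le> \<epsilon>\<^sub>0" "e n \<le> 1" for n
  proof -
    show "0 < e n" using \<epsilon>\<^sub>0 by (simp add: e_def)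
    have "e n \<le> min \<epsilon>\<^sub>0 1 / 1" unfolding e_def using \<epsilon>\<^sub>0 by (intro divide_left_mono) auto
    then show "e n \<le> \<epsilon>\<^sub>0" "e n \<le> 1" by auto
  qed
  have e0: "e \<longlonglongrightarrow> 0"
    using tendsto_mult_left[OF LIMSEQ_inverse_real_of_nat, of "min \<epsilon>\<^sub>0 1"] unfolding e_def[abs_def] by (simp add: divide_inverse)
  define v where "v n = mollify (e n) u" for n
  have vint: "integrable lborel (v n)" for n unfolding v_def by (rule mollify_integrable[OF e(1) u(1)])
  have [measurable]: "v n \<in> borel_measurable borel" for n unfolding v_def by measurable
  define d where "d n x = v n x - u x" for n x
  have dint: "integrable lborel (d n)" for n unfolding d_def using vint u by simp
  obtain C where C: "\<And>\<epsilon>. 0 < \<epsilon> \<Longrightarrow> \<epsilon> \<le> 1 \<Longrightarrow> (\<integral>x. \<bar>mollify \<epsilon> u x - u x\<bar> \<partial>lborel) \<le> C * \<epsilon> powr s"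
    using mollify_L1_error[OF u s(1) R S semi] by blast
  have dlim: "(\<lambda>n. \<integral>x. norm (d n x) \<partial>lborel) \<longlonglongrightarrow> 0"
  proof (rule tendsto_sandwich[of "\<lambda>_. 0"])
    show "(\<lambda>n. C * e n powr s) \<longlonglongrightarrow> 0"
    proof -
      have "\<forall>\<^sub>F n in sequentially. 0 \<le> e n" using e(1) less_imp_le by (intro always_eventually) blast
      from tendsto_mult_left[OF tendsto_zero_powrI[OF e0 tendsto_const this s(1)], of C] show ?thesis by simp
    qed
    show "\<forall>\<^sub>F n in sequentially. (\<integral>x. norm (d n x) \<partial>lborel) \<le> C * e n powr s"
      using C e(1,3) by (auto simp: d_def v_def)
    show "\<forall>\<^sub>F n in sequentially. 0 \<le> (\<integral>x. norm (d n x) \<partial>lborel)" by auto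
  qed simp
  obtain r where r: "strict_mono r" "AE x in lborel. (\<lambda>n. d (r n) x) \<longlonglongrightarrow> 0"
    using tendsto_L1_AE_subseq[OF dint dlim] by blast
  have dlim': "(\<lambda>n. \<integral>x. \<bar>d (r n) x\<bar> \<partial>lborel) \<longlonglongrightarrow> 0"
    using LIMSEQ_subseq_LIMSEQ[OF dlim r(1)] by (simp add: comp_def)
  define H where "H = (\<integral>z. min 1 (norm z) * ?K z \<partial>(lborel :: 'a measure))"
  have int: "integrable (lborel \<Otimes>\<^sub>M lborel) (F w (\<lambda>x. T (v n x)))" if "integrable lborel w" for w n
    unfolding F_def by (rule difference_product_integrable(1)[OF s dim that \<zeta>(1,2), of _ 1]) (use T(3) in measurable)
  have bound: "\<bar>\<integral>p. F w (\<lambda>x. T (v n x)) p \<partial>(lborel \<Otimes>\<^sub>M lborel)\<bar> \<le> 2 * 1 * L * H * (\<integral>x. \<bar>w x\<bar> \<partial>lborel)" if "integrable lborel w" for w n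
    unfolding F_def H_def by (rule difference_product_integrable(2)[OF s dim that \<zeta>(1,2)]) (use T(3) in measurable)
  have lim1: "(\<lambda>n. \<integral>p. F (d (r n)) (\<lambda>x. T (v (r n) x)) p \<partial>(lborel \<Otimes>\<^sub>M lborel)) \<longlonglongrightarrow> 0"
  proof (rule Lim_null_comparison)
    show "\<forall>\<^sub>F n in sequentially. norm (\<integral>p. F (d (r n)) (\<lambda>x. T (v (r n) x)) p \<partial>(lborel \<Otimes>\<^sub>M lborel)) \<le> 2 * 1 * L * H * (\<integral>x. \<bar>d (r n) x\<bar> \<partial>lborel)"
      using bound[OF dint] by simp
    show "(\<lambda>n. 2 * 1 * L * H * (\<integral>x. \<bar>d (r n) x\<bar> \<partial>lborel)) \<longlonglongrightarrow> 0"
      using tendsto_mult_left[OF dlim', of "2 * 1 * L * H"] by simp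
  qed
  have lim2: "(\<lambda>n. \<integral>p. F u (\<lambda>x. T (v (r n) x)) p \<partial>(lborel \<Otimes>\<^sub>M lborel)) \<longlonglongrightarrow> (\<integral>p. F u (\<lambda>x. T (u x)) p \<partial>(lborel \<Otimes>\<^sub>M lborel))"
  proof (rule integral_dominated_convergence[where w="\<lambda>p. \<bar>F u (\<lambda>_. 1) p\<bar>"])
    note [measurable] = \<zeta>(1)
    show "F u (\<lambda>x. T (u x)) \<in> borel_measurable (lborel \<Otimes>\<^sub>M lborel)" unfolding F_def by measurable
    show "F u (\<lambda>x. T (v (r n) x)) \<in> borel_measurable (lborel \<Otimes>\<^sub>M lborel)" for n unfolding F_def by measurable
    have "integrable (lborel \<Otimes>\<^sub>M lborel) (F u (\<lambda>_. 1))"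
      unfolding F_def by (rule difference_product_integrable(1)[OF s dim u(1) \<zeta>(1,2), of _ 1]) auto
    then show "integrable (lborel \<Otimes>\<^sub>M lborel) (\<lambda>p. \<bar>F u (\<lambda>_. 1) p\<bar>)" by simp
    show "AE p in lborel \<Otimes>\<^sub>M lborel. norm (F u (\<lambda>x. T (v (r n) x)) p) \<le> \<bar>F u (\<lambda>_. 1) p\<bar>" for n
    proof (rule AE_I2)
      fix p :: "'a \<times> 'a"
      obtain x z where p: "p = (x, z)" by (cases p)
      have "\<bar>?K z * ((u x - u (x + z)) * (\<zeta> x - \<zeta> (x + z)))\<bar> * \<bar>T (v (r n) x)\<bar> \<le> \<bar>?K z * ((u x - u (x + z)) * (\<zeta> x - \<zeta> (x + z)))\<bar> * 1"
        by (intro mult_left_mono T(3)) simp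
      then show "norm (F u (\<lambda>x. T (v (r n) x)) p) \<le> \<bar>F u (\<lambda>_. 1) p\<bar>"
        by (simp add: F_def p abs_mult mult_ac)
    qed
    \<comment> \<open>Convergence fails at most on a null set of x. In the product space the
      exceptional set is this null set times the whole space, which is again null.\<close>
    obtain N where N: "{x \<in> space lborel. \<not> (\<lambda>n. d (r n) x) \<longlonglongrightarrow> 0} \<subseteq> N" "N \<in> sets lborel" "emeasure lborel N = 0"
      using AE_E[OF r(2)] by (metis (no_types, lifting))
    have "AE p in lborel \<Otimes>\<^sub>M (lborel :: 'a measure). fst p \<notin> N"
    proof (rule lborel_pair.AE_pair_measure)
      have "N \<in> null_sets lborel" using N by (auto intro: null_setsI)
      from AE_not_in[OF this] show "AE x in lborel. AE y in (lborel :: 'a measure). fst (x, y) \<notin> N" by eventually_elim simp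
      have [measurable]: "N \<in> sets borel" using N(2) by simp
      show "{p \<in> space (lborel \<Otimes>\<^sub>M lborel). fst p \<notin> N} \<in> sets (lborel \<Otimes>\<^sub>M (lborel :: 'a measure))" by measurable
    qed
    then show "AE p in lborel \<Otimes>\<^sub>M lborel. (\<lambda>n. F u (\<lambda>x. T (v (r n) x)) p) \<longlonglongrightarrow> F u (\<lambda>x. T (u x)) p"
    proof (rule AE_mp, intro AE_I2 impI)
      fix p :: "'a \<times> 'a" assume "fst p \<notin> N"
      then obtain x z where p: "p = (x, z)" "x \<notin> N" by (cases p) auto
      then have "(\<lambda>n. d (r n) x) \<longlonglongrightarrow> 0" using N(1) by auto
      then have "(\<lambda>n. d (r n) x + u x) \<longlonglongrightarrow> 0 + u x" by (intro tendsto_add tendsto_const)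
      then have "(\<lambda>n. v (r n) x) \<longlonglongrightarrow> u x" by (simp add: d_def)
      then have "(\<lambda>n. T (v (r n) x)) \<longlonglongrightarrow> T (u x)"
        using T(1) by (auto intro: continuous_on_tendsto_compose)
      then show "(\<lambda>n. F u (\<lambda>x. T (v (r n) x)) p) \<longlonglongrightarrow> F u (\<lambda>x. T (u x)) p"
        unfolding F_def p(1) by (auto intro!: tendsto_intros)
    qed
  qed
  have split: "(\<integral>p. F (v (r n)) (\<lambda>x. T (v (r n) x)) p \<partial>(lborel \<Otimes>\<^sub>M lborel))
     = (\<integral>p. F (d (r n)) (\<lambda>x. T (v (r n) x)) p \<partial>(lborel \<Otimes>\<^sub>M lborel)) + (\<integral>p. F u (\<lambda>x. T (v (r n) x)) p \<partial>(lborel \<Otimes>\<^sub>M lborel))" for n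
  proof -
    have "F (v (r n)) (\<lambda>x. T (v (r n) x)) p = F (d (r n)) (\<lambda>x. T (v (r n) x)) p + F u (\<lambda>x. T (v (r n) x)) p" for p
      by (cases p) (simp add: F_def d_def algebra_simps)
    then show ?thesis using int[OF dint] int[OF u(1)] by simp
  qed
  have lim: "(\<lambda>n. \<integral>p. F (v (r n)) (\<lambda>x. T (v (r n) x)) p \<partial>(lborel \<Otimes>\<^sub>M lborel)) \<longlonglongrightarrow> (\<integral>p. F u (\<lambda>x. T (u x)) p \<partial>(lborel \<Otimes>\<^sub>M lborel))"
    unfolding split using tendsto_add[OF lim1 lim2] by simp
  have "(\<integral>p. F (v n) (\<lambda>x. T (v n x)) p \<partial>(lborel \<Otimes>\<^sub>M lborel)) \<le> 2 * A / \<bar>frac_lap_const DIM('a) (s / 2)\<bar>" for n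
    unfolding F_def v_def
  proof (rule kato_mollified[OF s dim e(1) u(1) A \<zeta> K(1) _ K(3) _ T(2,3)])
    show "cball x (e n) \<subseteq> \<Omega>" if "x \<in> K" for x using K(2)[OF that] e(2)[of n] by (meson order_trans subset_cball)
  qed auto
  then have "(\<integral>p. F u (\<lambda>x. T (u x)) p \<partial>(lborel \<Otimes>\<^sub>M lborel)) \<le> 2 * A / \<bar>frac_lap_const DIM('a) (s / 2)\<bar>"
    using LIMSEQ_le_const2[OF lim] by blast
  then show ?thesis unfolding F_def .
qed

text \<open>The bound does not depend on the scale \<open>1/k\<close> of the cutoff, which provides the dominating function
  for \<open>k \<rightarrow> \<infinity>\<close>.\<close>
lemma cutoff_increment:
  fixes a b d s k :: real
  assumes a: "0 < a" and b: "0 < b" and d: "\<bar>a - b\<bar> \<le> d" and s: "0 < s" "s < 1" and k: "0 < k"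
  shows "(max 0 (min 1 (k * a - 1)) - max 0 (min 1 (k * b - 1)))\<^sup>2 \<le> (2 * d) powr s * (a powr (-s) + b powr (-s))"
proof -
  let ?z = "\<lambda>t. max 0 (min 1 (k * t - 1))"
  have main: "(?z a - ?z b)\<^sup>2 \<le> (2 * d) powr s * a powr (-s)" if ab: "a \<le> b" and a: "0 < a" and d: "\<bar>a - b\<bar> \<le> d" for a b
  proof (cases "?z a = ?z b")
    case False
    \<comment> \<open>A nonzero increment means that the smaller argument is not yet in the region
      where the cutoff equals 1. This bounds k by 2 / a and so removes it from the Lipschitz
      constant.\<close>
    have "k * a < 2"
    proof (rule ccontr)
      assume "\<not> k * a < 2"
      moreover have "k * a \<le> k * b" using ab k by simp
      ultimately show False using False by simp
    qed
    then have ka: "k \<le> 2 / a" using a by (simp add: field_simps)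
    have le1: "\<bar>?z a - ?z b\<bar> \<le> 1" by (auto simp: max_def min_def)
    have "\<bar>?z a - ?z b\<bar> \<le> \<bar>k * a - k * b\<bar>" by (auto simp: max_def min_def)
    also have "\<dots> = k * \<bar>a - b\<bar>" using k by (simp add: abs_mult right_diff_distrib[symmetric])
    also have "\<dots> \<le> 2 / a * d" using ka d a k by (intro mult_mono) auto
    finally have le2: "\<bar>?z a - ?z b\<bar> \<le> 2 * d / a" by simp
    have pos: "0 < \<bar>?z a - ?z b\<bar>" using False by simp
    then have dpos: "0 < 2 * d / a" using le2 by linarith
    then have d0: "0 < d" using a by (simp add: zero_less_divide_iff)
    have "(?z a - ?z b)\<^sup>2 = \<bar>?z a - ?z b\<bar> powr 2" using pos by (simp add: powr_realpow)
    \<comment> \<open>The increment is at most 1, so lowering the exponent from 2 to s only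
      increases the value. The exponent s leaves the factor a^(-s), integrable over \<Omega> for a =
      \<delta>(x).\<close>
    also have "\<dots> \<le> \<bar>?z a - ?z b\<bar> powr s" using pos le1 s by (intro powr_mono') auto
    also have "\<dots> \<le> (2 * d / a) powr s" using le2 s by (intro powr_mono2) auto
    also have "\<dots> = (2 * d) powr s * a powr (-s)" using a d0 by (simp add: powr_divide powr_minus_divide)
    finally show ?thesis .
  qed simp
  show ?thesis
  proof (cases "a \<le> b")
    case True
    from main[OF this a d] show ?thesis by (simp add: distrib_left add_increasing2)
  next
    case False
    then have "(?z b - ?z a)\<^sup>2 \<le> (2 * d) powr s * b powr (-s)" using d by (intro main b) auto
    then show ?thesis by (simp add: distrib_left add_increasing power2_commute)
  qed
qed

text \<open>In the limit of the sign test, pairs with x in \<Omega> and x + z outside contribute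
  |u(x)| |z|^(-N-s), whose integral over z is at least \<open>c\<^sub>0\<close> \<delta>(x)^(-s)
  |u(x)|. Pairs with both points in \<Omega> disappear because the increment of the cutoff does; the
  seminorm of u justifies this limit.\<close>

lemma kato_hardy:
  fixes \<Omega> :: "'a::euclidean_space set" and s :: real
  assumes \<Omega>: "open \<Omega>" "bounded \<Omega>" "C2_boundary \<Omega>" and s: "0 < s" "s < 1" and dim: "2 \<le> DIM('a)"
  shows "\<exists>C\<ge>0. \<forall>u A. integrable lborel u \<longrightarrow> (\<forall>x. x \<notin> \<Omega> \<longrightarrow> u x = 0) \<longrightarrow>
    (\<integral>\<^sup>+x. (\<integral>\<^sup>+y. ennreal (\<bar>u x - u y\<bar>\<^sup>2 / dist x y powr (DIM('a) + 2 * s)) \<partial>lborel) \<partial>lborel) < \<infinity> \<longrightarrow>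
    (\<forall>\<phi>\<in>test_functions \<Omega>. (\<forall>x. \<bar>\<phi> x\<bar> \<le> 1) \<longrightarrow> \<bar>\<integral>x. u x * frac_lap (s / 2) \<phi> x \<partial>lborel\<bar> \<le> A) \<longrightarrow>
    (\<integral>\<^sup>+x. ennreal (\<bar>u x\<bar> * dist_compl \<Omega> x powr (-s)) * indicator \<Omega> x \<partial>lborel) \<le> ennreal (C * A)"
proof -
  let ?N = "real DIM('a)" and ?d = "dist_compl \<Omega>" and ?c = "frac_lap_const DIM('a) (s / 2)"
  let ?K = "\<lambda>z::'a. norm z powr (- (?N + s))"
  have ne: "- \<Omega> \<noteq> {}" using bounded_compl_nonempty[OF \<Omega>(2)] .
  have [measurable]: "\<Omega> \<in> sets borel" using \<Omega> by auto
  have [measurable]: "?d \<in> borel_measurable borel"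
    by (intro borel_measurable_continuous_onI continuous_intros)
  have dpos: "0 < ?d x" if "x \<in> \<Omega>" for x using dist_compl_pos[OF \<Omega>(1) ne that] .
  have dlip: "\<bar>?d x - ?d y\<bar> \<le> dist x y" for x y
    using infdist_triangle[of x "- \<Omega>" y] infdist_triangle[of y "- \<Omega>" x] by (simp add: abs_le_iff dist_commute)
  obtain c\<^sub>0 where c0: "0 < c\<^sub>0" "\<And>y. y \<in> \<Omega> \<Longrightarrow> ennreal (c\<^sub>0 * ?d y powr (-s))
    \<le> (\<integral>\<^sup>+x. ennreal (norm (x - y) powr (- (?N + s))) * indicator (- \<Omega>) x \<partial>lborel)"
    using exterior_potential_lower_bound[OF \<Omega> s(1)] by blast
  obtain R where R: "0 < R" "\<And>x. x \<in> \<Omega> \<Longrightarrow> norm x < R" using \<Omega>(2) by (auto simp: bounded_pos_less)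
  have c: "?c \<noteq> 0" using frac_lap_const_nonzero[of "s / 2"] s by simp
  \<comment> \<open>The functions f and h provide the integrable majorant f(x) h(z) + f(x + z) h(z)
    for cutoff increments. The ball of radius 2R carrying h contains every increment between two
    points of \<Omega>.\<close>
  define f where "f x = ?d x powr (-s) * indicator \<Omega> x" for x
  have [measurable]: "f \<in> borel_measurable borel" unfolding f_def by measurable
  have fint: "integrable lborel f"
  proof (rule integrableI_bounded)
    have "(\<integral>\<^sup>+x. ennreal (norm (f x)) \<partial>lborel) = (\<integral>\<^sup>+x. ennreal (?d x powr (-s)) * indicator \<Omega> x \<partial>lborel)"
      by (intro nn_integral_cong) (auto simp: f_def indicator_def)
    then show "(\<integral>\<^sup>+x. ennreal (norm (f x)) \<partial>lborel) < \<infinity>"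
      using nn_integral_dist_compl_powr_finite[OF \<Omega> s] by simp
  qed measurable
  define h where "h z = norm z powr (s - ?N) * indicator (cball 0 (2 * R)) z" for z :: 'a
  have [measurable]: "cball (0::'a) (2 * R) \<in> sets borel" by simp
  have [measurable]: "h \<in> borel_measurable borel" unfolding h_def by measurable
  have hint: "integrable lborel h"
  proof (rule integrableI_bounded)
    have "(\<integral>\<^sup>+z. ennreal (norm (h z)) \<partial>lborel) = (\<integral>\<^sup>+z. ennreal (norm (z::'a) powr (s - ?N)) * indicator (cball 0 (2 * R)) z \<partial>lborel)"
      by (intro nn_integral_cong) (auto simp: h_def indicator_def)
    also have "\<dots> < \<infinity>"
      by (rule le_less_trans[OF nn_integral_norm_head[where 'a='a, of s "2 * R"]]) (use s dim R in auto)
    finally show "(\<integral>\<^sup>+z. ennreal (norm (h z)) \<partial>lborel) < \<infinity>" .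
  qed measurable
  \<comment> \<open>The constant is the bound 2 A / |\<open>?c\<close>| of the sign test divided by
    \<open>c\<^sub>0\<close>, the lower bound for the exterior kernel mass.\<close>
  show ?thesis
  proof (intro exI[of _ "2 / (\<bar>?c\<bar> * c\<^sub>0)"] conjI allI impI)
    show "0 \<le> 2 / (\<bar>?c\<bar> * c\<^sub>0)" using c0(1) by simp
    fix u :: "'a \<Rightarrow> real" and A :: real
    assume u: "integrable lborel u" and u0: "\<forall>x. x \<notin> \<Omega> \<longrightarrow> u x = 0"
      and semi: "(\<integral>\<^sup>+x. (\<integral>\<^sup>+y. ennreal (\<bar>u x - u y\<bar>\<^sup>2 / dist x y powr (?N + 2 * s)) \<partial>lborel) \<partial>lborel) < \<infinity>"
      and A: "\<forall>\<phi>\<in>test_functions \<Omega>. (\<forall>x. \<bar>\<phi> x\<bar> \<le> 1) \<longrightarrow> \<bar>\<integral>x. u x * frac_lap (s / 2) \<phi> x \<partial>lborel\<bar> \<le> A"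
    have [measurable]: "u \<in> borel_measurable borel" using u by auto
    define S where "S = enn2real (\<integral>\<^sup>+x. (\<integral>\<^sup>+y. ennreal (\<bar>u x - u y\<bar>\<^sup>2 / dist x y powr (?N + 2 * s)) \<partial>lborel) \<partial>lborel)"
    have S: "0 \<le> S" "(\<integral>\<^sup>+x. (\<integral>\<^sup>+y. ennreal (\<bar>u x - u y\<bar>\<^sup>2 / dist x y powr (?N + 2 * s)) \<partial>lborel) \<partial>lborel) \<le> ennreal S"
      using semi unfolding S_def by auto
    define q where "q = (\<lambda>(x, z). \<bar>u x - u (x + z)\<bar>\<^sup>2 * norm z powr (- (?N + 2 * s)))"
    have qint: "integrable (lborel \<Otimes>\<^sub>M lborel) q"
    proof (rule integrableI_bounded)
      show "q \<in> borel_measurable (lborel \<Otimes>\<^sub>M lborel)" unfolding q_def by measurable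
      have qm: "(\<lambda>p. ennreal (norm (q p))) \<in> borel_measurable (lborel \<Otimes>\<^sub>M lborel)" unfolding q_def by measurable
      have "(\<integral>\<^sup>+p. ennreal (norm (q p)) \<partial>(lborel \<Otimes>\<^sub>M lborel)) = (\<integral>\<^sup>+x. (\<integral>\<^sup>+z. ennreal (norm (q (x, z))) \<partial>lborel) \<partial>lborel)"
        by (rule lborel.nn_integral_fst[symmetric, OF qm])
      also have "\<dots> = (\<integral>\<^sup>+x. (\<integral>\<^sup>+y. ennreal (\<bar>u x - u y\<bar>\<^sup>2 / dist x y powr (?N + 2 * s)) \<partial>lborel) \<partial>lborel)"
      proof (rule nn_integral_cong)
        fix x
        have m: "(\<lambda>y. ennreal (\<bar>u x - u y\<bar>\<^sup>2 / dist x y powr (?N + 2 * s))) \<in> borel_measurable borel" by measurable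
        have "(\<integral>\<^sup>+z. ennreal (norm (q (x, z))) \<partial>lborel) = (\<integral>\<^sup>+z. ennreal (\<bar>u x - u (x + z)\<bar>\<^sup>2 / dist x (x + z) powr (?N + 2 * s)) \<partial>lborel)"
          unfolding q_def by (intro nn_integral_cong) (simp add: dist_norm powr_minus_divide abs_mult del: minus_add_distrib)
        then show "(\<integral>\<^sup>+z. ennreal (norm (q (x, z))) \<partial>lborel) = (\<integral>\<^sup>+y. ennreal (\<bar>u x - u y\<bar>\<^sup>2 / dist x y powr (?N + 2 * s)) \<partial>lborel)"
          using nn_integral_lborel_shift[OF m, of x] by simp
      qed
      finally show "(\<integral>\<^sup>+p. ennreal (norm (q p)) \<partial>(lborel \<Otimes>\<^sub>M lborel)) < \<infinity>" using semi by simp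
    qed
    \<comment> \<open>T k is a piecewise linear approximation of the sign. The cutoff \<zeta> k
      vanishes where \<delta> is at most 1/(k+1), leaving room for mollification at scale
      1/(2(k+1)), and equals 1 once \<delta> is at least 2/(k+1). The index shift avoids k =
      0.\<close>
    define T where "T k t = max (-1) (min 1 (real (Suc k) * t))" for k t
    define \<zeta> where "\<zeta> k x = max 0 (min 1 (real (Suc k) * ?d x - 1))" for k x
    have [measurable]: "T k \<in> borel_measurable borel" "\<zeta> k \<in> borel_measurable borel" for k
      unfolding T_def[abs_def] \<zeta>_def[abs_def] by measurable
    have T1: "\<bar>T k t\<bar> \<le> 1" for k t by (auto simp: T_def)
    have T_nonneg: "0 \<le> t * T k t" for k t
    proof (cases "0 \<le> t")
      case True
      then have "0 \<le> real (Suc k) * t" by (intro mult_nonneg_nonneg) auto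
      then have "0 \<le> T k t" unfolding T_def by (simp add: le_max_iff_disj)
      then show ?thesis using True by simp
    next
      case False
      then have "real (Suc k) * t \<le> 0" by (intro mult_nonneg_nonpos) auto
      then have "T k t \<le> 0" unfolding T_def by simp
      then show ?thesis using False by (simp add: mult_nonpos_nonpos)
    qed
    have \<zeta>01: "0 \<le> \<zeta> k x" "\<zeta> k x \<le> 1" for k x by (auto simp: \<zeta>_def)
    have \<zeta>lip: "\<bar>\<zeta> k x - \<zeta> k y\<bar> \<le> real (Suc k) * min 1 (dist x y)" for k x y
    proof -
      have "\<bar>\<zeta> k x - \<zeta> k y\<bar> \<le> 1" using \<zeta>01[of k x] \<zeta>01[of k y] by (auto simp: abs_le_iff)
      then have 1: "\<bar>\<zeta> k x - \<zeta> k y\<bar> \<le> real (Suc k) * 1" by simp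
      have "\<bar>\<zeta> k x - \<zeta> k y\<bar> \<le> \<bar>real (Suc k) * ?d x - real (Suc k) * ?d y\<bar>" by (auto simp: \<zeta>_def max_def min_def)
      also have "\<dots> = real (Suc k) * \<bar>?d x - ?d y\<bar>" by (simp add: abs_mult right_diff_distrib[symmetric] del: of_nat_Suc)
      also have "\<dots> \<le> real (Suc k) * dist x y" by (intro mult_left_mono dlip) simp
      finally show ?thesis using 1 by (simp add: min_def)
    qed
    define D where "D k = (\<lambda>(x, z). ?K z * ((u x - u (x + z)) * T k (u x) * (\<zeta> k x - \<zeta> k (x + z))))" for k
    have Dint: "integrable (lborel \<Otimes>\<^sub>M lborel) (D k)" for k
      unfolding D_def by (rule difference_product_integrable(1)[OF s dim u _ \<zeta>lip _ T1]) measurable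
    have Dle: "(\<integral>p. D k p \<partial>(lborel \<Otimes>\<^sub>M lborel)) \<le> 2 * A / \<bar>?c\<bar>" for k
      unfolding D_def
    proof (rule kato_limit[OF s dim _ u _ R(1) S, where \<Omega>=\<Omega> and \<epsilon>\<^sub>0="1 / (2 * real (Suc k))" and K="{x. 1 / real (Suc k) \<le> ?d x}"])
      let ?K = "{x. 1 / real (Suc k) \<le> ?d x}"
      have sub: "?K \<subseteq> \<Omega>"
      proof
        fix x assume "x \<in> ?K"
        then have "1 / real (Suc k) \<le> ?d x" by simp
        moreover have "0 < 1 / real (Suc k)" by simp
        ultimately have "0 < ?d x" by linarith
        then show "x \<in> \<Omega>" by (metis ComplI infdist_zero order_less_irrefl)
      qed
      have "closed ?K" by (intro closed_Collect_le continuous_intros)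
      then show "compact ?K" using sub \<Omega>(2) by (auto simp: compact_eq_bounded_closed intro: bounded_subset)
      show "u x = 0" if "R \<le> norm x" for x using R(2)[of x] u0 that by force
      show "cball x (1 / (2 * real (Suc k))) \<subseteq> \<Omega>" if "x \<in> ?K" for x
      proof
        fix y assume "y \<in> cball x (1 / (2 * real (Suc k)))"
        then have "dist x y \<le> 1 / (2 * real (Suc k))" by simp
        moreover have "1 / (2 * real (Suc k)) < 1 / real (Suc k)" by (simp add: field_simps)
        ultimately have "0 < ?d y" using that dlip[of x y] by auto
        then show "y \<in> \<Omega>" by (metis ComplI infdist_zero order_less_irrefl)
      qed
      show "\<zeta> k x = 0" if "x \<notin> ?K" for x using that by (simp add: \<zeta>_def field_simps)
      show "continuous_on UNIV (T k)" unfolding T_def[abs_def] by (intro continuous_intros)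
      show "mono (T k)" unfolding T_def[abs_def] by (intro monoI max.mono min.mono mult_left_mono) auto
    qed (use A T1 \<zeta>01 \<zeta>lip in auto)
    \<comment> \<open>Majorant for interior pairs, independent of k: half the Gagliardo integrand
      plus half the squared cutoff increment as bounded by \<open>cutoff_increment\<close>.\<close>
    define W where "W p = 1/2 * q p + 1/2 * 2 powr s * ((case p of (x, z) \<Rightarrow> f x * h z) + (case p of (x, z) \<Rightarrow> f (x + z) * h z))" for p
    have Wint: "integrable (lborel \<Otimes>\<^sub>M lborel) W"
      unfolding W_def[abs_def] using qint integrable_lborel_product[OF fint hint] integrable_lborel_shift_product[OF fint hint] by simp
    define E\<^sub>1 where "E\<^sub>1 = {p :: 'a \<times> 'a. fst p \<in> \<Omega> \<and> fst p + snd p \<notin> \<Omega>}"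
    define E\<^sub>2 where "E\<^sub>2 = {p :: 'a \<times> 'a. fst p \<in> \<Omega> \<and> fst p + snd p \<in> \<Omega>}"
    have "{p \<in> space (lborel \<Otimes>\<^sub>M lborel). fst p \<in> \<Omega> \<and> fst p + snd p \<notin> \<Omega>} \<in> sets (lborel \<Otimes>\<^sub>M (lborel :: 'a measure))" by measurable
    then have E1[measurable]: "E\<^sub>1 \<in> sets (lborel \<Otimes>\<^sub>M lborel)" by (simp add: E\<^sub>1_def space_pair_measure)
    have "{p \<in> space (lborel \<Otimes>\<^sub>M lborel). fst p \<in> \<Omega> \<and> fst p + snd p \<in> \<Omega>} \<in> sets (lborel \<Otimes>\<^sub>M (lborel :: 'a measure))" by measurable
    then have E2[measurable]: "E\<^sub>2 \<in> sets (lborel \<Otimes>\<^sub>M lborel)" by (simp add: E\<^sub>2_def space_pair_measure)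
    define P where "P k p = indicator E\<^sub>1 p * D k p" for k p
    define Q where "Q k p = indicator E\<^sub>2 p * D k p" for k p
    have Pint: "integrable (lborel \<Otimes>\<^sub>M lborel) (P k)" for k
      unfolding P_def using integrable_mult_indicator[OF E1 Dint[of k]] unfolding real_scaleR_def .
    have Qint: "integrable (lborel \<Otimes>\<^sub>M lborel) (Q k)" for k
      unfolding Q_def using integrable_mult_indicator[OF E2 Dint[of k]] unfolding real_scaleR_def .
    \<comment> \<open>The two regions do not cover x outside \<Omega>, but there u x = 0 and T k
      vanishes at 0.\<close>
    have DPQ: "D k p = P k p + Q k p" for k p
    proof (cases p)
      case (Pair x z)
      show ?thesis
      proof (cases "x \<in> \<Omega>")
        case False
        then have "D k p = 0" using u0 by (simp add: D_def Pair T_def)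
        then show ?thesis by (simp add: P_def Q_def)
      qed (auto simp: P_def Q_def E\<^sub>1_def E\<^sub>2_def Pair indicator_def)
    qed
    have Qle: "\<bar>Q k p\<bar> \<le> W p" for k p
    proof (cases p)
      case (Pair x z)
      have W0: "0 \<le> W p" by (auto simp: W_def q_def f_def h_def Pair)
      show ?thesis
      proof (cases "p \<in> E\<^sub>2 \<and> z \<noteq> 0")
        case False
        then have "Q k p = 0" by (auto simp: Q_def D_def Pair)
        then show ?thesis using W0 by simp
      next
        case True
        then have x: "x \<in> \<Omega>" "x + z \<in> \<Omega>" and z: "0 < norm z" by (auto simp: E\<^sub>2_def Pair)
        let ?n = "norm z" and ?U = "\<bar>u x - u (x + z)\<bar>" and ?Z = "\<bar>\<zeta> k x - \<zeta> k (x + z)\<bar>"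
        have "norm z \<le> norm (x + z) + norm x" by (metis add_diff_cancel_left' norm_triangle_ineq4)
        then have zR: "z \<in> cball 0 (2 * R)" using R(2)[OF x(1)] R(2)[OF x(2)] by simp
        have "\<bar>Q k p\<bar> = ?K z * (?U * \<bar>T k (u x)\<bar> * ?Z)" using True by (simp add: Q_def D_def Pair abs_mult)
        also have "\<dots> \<le> ?K z * (?U * 1 * ?Z)" by (intro mult_left_mono mult_right_mono T1) auto
        \<comment> \<open>The kernel |z|^(-N-s) is divided as |z|^(-N/2-s) times |z|^(-N/2), so that
          squaring the first factor reproduces exactly the Gagliardo integrand.\<close>
        also have "\<dots> = (?U * ?n powr (- (?N / 2 + s))) * (?Z * ?n powr (- (?N / 2)))"
        proof -
          have "?K z = ?n powr (- (?N / 2 + s)) * ?n powr (- (?N / 2))" by (simp add: powr_add[symmetric])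
          then show ?thesis by simp
        qed
        also have "\<dots> \<le> 1/2 * (?U * ?n powr (- (?N / 2 + s)))\<^sup>2 + 1/2 * (?Z * ?n powr (- (?N / 2)))\<^sup>2"
          using sum_squares_bound[of "?U * ?n powr (- (?N / 2 + s))" "?Z * ?n powr (- (?N / 2))"] by linarith
        also have "(?U * ?n powr (- (?N / 2 + s)))\<^sup>2 = q p"
          by (simp add: q_def Pair power_mult_distrib power2_eq_square[of "_ powr _"] powr_add[symmetric])
        also have "(?Z * ?n powr (- (?N / 2)))\<^sup>2 = ?Z\<^sup>2 * ?n powr (- ?N)"
          by (simp add: power_mult_distrib power2_eq_square[of "_ powr _"] powr_add[symmetric])
        also have "?Z\<^sup>2 * ?n powr (- ?N) \<le> ((2 * ?n) powr s * (?d x powr (-s) + ?d (x + z) powr (-s))) * ?n powr (- ?N)"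
        proof (rule mult_right_mono)
          have "\<bar>?d x - ?d (x + z)\<bar> \<le> norm z" using dlip[of x "x + z"] by (simp add: dist_norm)
          from cutoff_increment[OF dpos[OF x(1)] dpos[OF x(2)] this s, of "real (Suc k)"]
          show "?Z\<^sup>2 \<le> (2 * ?n) powr s * (?d x powr (-s) + ?d (x + z) powr (-s))" by (simp add: \<zeta>_def)
        qed simp
        also have "\<dots> = 2 powr s * (f x * h z + f (x + z) * h z)"
        proof -
          have "(2 * ?n) powr s * ?n powr (- ?N) = 2 powr s * ?n powr (s - ?N)"
            using z by (simp add: powr_mult powr_diff powr_minus_divide)
          moreover have "f x = ?d x powr (-s)" "f (x + z) = ?d (x + z) powr (-s)" "h z = ?n powr (s - ?N)"
            using x zR by (simp_all add: f_def h_def)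
          moreover have "(X * (a + b)) * Y = t * (a * w + b * w)" if "X * Y = t * w" for X Y a b t w :: real
            using that by algebra
          ultimately show ?thesis by presburger
        qed
        finally show ?thesis by (simp add: W_def Pair)
      qed
    qed
    \<comment> \<open>For fixed x and x + z in \<Omega> both cutoffs are eventually 1, so the
      integrand is eventually 0.\<close>
    have Qlim: "(\<lambda>k. \<integral>p. \<bar>Q k p\<bar> \<partial>(lborel \<Otimes>\<^sub>M lborel)) \<longlonglongrightarrow> (\<integral>p. 0 \<partial>((lborel :: 'a measure) \<Otimes>\<^sub>M (lborel :: 'a measure)))"
    proof (rule integral_dominated_convergence[where w=W])
      show "(\<lambda>p. \<bar>Q k p\<bar>) \<in> borel_measurable (lborel \<Otimes>\<^sub>M lborel)" for k using Qint[of k] by simp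
      show "AE p in lborel \<Otimes>\<^sub>M lborel. norm \<bar>Q k p\<bar> \<le> W p" for k using Qle by simp
      show "AE p in lborel \<Otimes>\<^sub>M lborel. (\<lambda>k. \<bar>Q k p\<bar>) \<longlonglongrightarrow> 0"
      proof (rule AE_I2)
        fix p :: "'a \<times> 'a"
        show "(\<lambda>k. \<bar>Q k p\<bar>) \<longlonglongrightarrow> 0"
        proof (cases "p \<in> E\<^sub>2")
          case True
          obtain x z where p: "p = (x, z)" by (cases p)
          have x: "x \<in> \<Omega>" "x + z \<in> \<Omega>" using True by (auto simp: E\<^sub>2_def p)
          have ev: "\<forall>\<^sub>F k in sequentially. \<zeta> k y = 1" if "y \<in> \<Omega>" for y
          proof -
            obtain n where n: "2 / ?d y < real n" using reals_Archimedean2 by blast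
            have "\<zeta> k y = 1" if "n \<le> k" for k
            proof -
              have "2 / ?d y < real (Suc k)" using n that by linarith
              then have "2 < real (Suc k) * ?d y" using dpos[OF \<open>y \<in> \<Omega>\<close>] by (simp add: field_simps)
              then show ?thesis by (simp add: \<zeta>_def)
            qed
            then show ?thesis by (auto simp: eventually_sequentially)
          qed
          have "\<forall>\<^sub>F k in sequentially. 0 = \<bar>Q k p\<bar>"
            using ev[OF x(1)] ev[OF x(2)] by eventually_elim (simp add: Q_def D_def p)
          then show ?thesis by (rule Lim_transform_eventually[OF tendsto_const])
        qed (simp add: Q_def)
      qed
    qed (use Wint in auto)
    define a where "a k = 2 * A / \<bar>?c\<bar> + (\<integral>p. \<bar>Q k p\<bar> \<partial>(lborel \<Otimes>\<^sub>M lborel))" for k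
    have alim: "a \<longlonglongrightarrow> 2 * A / \<bar>?c\<bar>"
      unfolding a_def[abs_def] using tendsto_add[OF tendsto_const Qlim, of "2 * A / \<bar>?c\<bar>"] by simp
    \<comment> \<open>With x + z outside \<Omega> both u and the cutoff vanish there, and the
      integrand reduces to the kernel times u(x) T(u(x)) \<zeta>(x), a product of nonnegative
      quantities.\<close>
    have Pnn: "0 \<le> P k p" for k p
    proof (cases p)
      case (Pair x z)
      have "0 \<le> ?K z * ((u x * T k (u x)) * \<zeta> k x)" using T_nonneg[of "u x" k] \<zeta>01[of k x] by simp
      moreover have "\<zeta> k (x + z) = 0" "u (x + z) = 0" if "x + z \<notin> \<Omega>"
        using that u0 by (simp_all add: \<zeta>_def)
      ultimately show ?thesis by (auto simp: P_def D_def Pair E\<^sub>1_def indicator_def)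
    qed
    have Ple: "(\<integral>\<^sup>+p. ennreal (P k p) \<partial>(lborel \<Otimes>\<^sub>M lborel)) \<le> ennreal (a k)" for k
    proof -
      have "(\<integral>\<^sup>+p. ennreal (P k p) \<partial>(lborel \<Otimes>\<^sub>M lborel)) = ennreal (\<integral>p. P k p \<partial>(lborel \<Otimes>\<^sub>M lborel))"
        using Pnn by (intro nn_integral_eq_integral Pint) simp
      also have "(\<integral>p. P k p \<partial>(lborel \<Otimes>\<^sub>M lborel)) = (\<integral>p. D k p \<partial>(lborel \<Otimes>\<^sub>M lborel)) - (\<integral>p. Q k p \<partial>(lborel \<Otimes>\<^sub>M lborel))"
        using Pint Qint by (simp add: DPQ)
      also have "\<dots> \<le> a k"
        using Dle[of k] integral_abs_bound[of "lborel \<Otimes>\<^sub>M lborel" "Q k"] by (simp add: a_def abs_le_iff)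
      finally show ?thesis by (simp add: ennreal_leI)
    qed
    define P\<^sub>0 where "P\<^sub>0 p = indicator E\<^sub>1 p * (?K (snd p) * \<bar>u (fst p)\<bar>)" for p
    have Plim: "(\<lambda>k. ennreal (P k p)) \<longlonglongrightarrow> ennreal (P\<^sub>0 p)" for p
    proof (cases "p \<in> E\<^sub>1")
      case True
      obtain x z where p: "p = (x, z)" by (cases p)
      have x: "x \<in> \<Omega>" "x + z \<notin> \<Omega>" using True by (auto simp: E\<^sub>1_def p)
      have z0: "\<zeta> k (x + z) = 0" "u (x + z) = 0" for k using x u0 by (simp_all add: \<zeta>_def)
      obtain n where n: "2 / ?d x < real n" using reals_Archimedean2 by blast
      obtain m where m: "1 / \<bar>u x\<bar> < real m" using reals_Archimedean2 by blast
      have "P\<^sub>0 p = P k p" if "n + m \<le> k" for k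
      proof -
        have "2 / ?d x < real (Suc k)" using n that by linarith
        then have "2 < real (Suc k) * ?d x" using dpos[OF x(1)] by (simp add: field_simps)
        then have z1: "\<zeta> k x = 1" by (simp add: \<zeta>_def)
        have "u x * T k (u x) = \<bar>u x\<bar>"
        proof (cases "u x = 0")
          case False
          have "1 / \<bar>u x\<bar> < real (Suc k)" using m that by linarith
          then have 1: "1 < real (Suc k) * \<bar>u x\<bar>" using False by (simp add: field_simps)
          then show ?thesis
            by (cases "0 \<le> u x") (auto simp: T_def min_def max_def abs_if not_le)
        qed simp
        then show ?thesis using True z0 z1 by (simp add: P\<^sub>0_def P_def D_def p)
      qed
      then have "\<forall>\<^sub>F k in sequentially. ennreal (P\<^sub>0 p) = ennreal (P k p)"
        unfolding eventually_sequentially by (intro exI[of _ "n + m"]) auto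
      then show ?thesis by (rule Lim_transform_eventually[OF tendsto_const])
    qed (simp add: P_def P\<^sub>0_def)
    \<comment> \<open>Fatou: the integrals of P k are bounded by the real sequence \<open>a\<close>,
      and at each point P k is eventually equal to its limit. No finiteness of the limit integral is
      assumed; it results.\<close>
    have "(\<integral>\<^sup>+p. ennreal (P\<^sub>0 p) \<partial>(lborel \<Otimes>\<^sub>M lborel)) = (\<integral>\<^sup>+p. liminf (\<lambda>k. ennreal (P k p)) \<partial>(lborel \<Otimes>\<^sub>M lborel))"
      using lim_imp_Liminf[OF sequentially_bot Plim] by simp
    also have "\<dots> \<le> liminf (\<lambda>k. \<integral>\<^sup>+p. ennreal (P k p) \<partial>(lborel \<Otimes>\<^sub>M lborel))"
      by (rule nn_integral_liminf) (use Pint in simp)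
    also have "\<dots> \<le> liminf (\<lambda>k. ennreal (a k))" using Ple by (intro Liminf_mono) simp
    also have "\<dots> = ennreal (2 * A / \<bar>?c\<bar>)" by (intro lim_imp_Liminf tendsto_ennrealI alim) simp
    finally have fin: "(\<integral>\<^sup>+p. ennreal (P\<^sub>0 p) \<partial>(lborel \<Otimes>\<^sub>M lborel)) \<le> ennreal (2 * A / \<bar>?c\<bar>)" .
    have P0m: "(\<lambda>p. ennreal (P\<^sub>0 p)) \<in> borel_measurable (lborel \<Otimes>\<^sub>M lborel)" unfolding P\<^sub>0_def by measurable
    have "ennreal c\<^sub>0 * (\<integral>\<^sup>+x. ennreal (\<bar>u x\<bar> * ?d x powr (-s)) * indicator \<Omega> x \<partial>lborel)
      = (\<integral>\<^sup>+x. ennreal c\<^sub>0 * (ennreal (\<bar>u x\<bar> * ?d x powr (-s)) * indicator \<Omega> x) \<partial>lborel)"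
      by (rule nn_integral_cmult[symmetric]) measurable
    also have "\<dots> \<le> (\<integral>\<^sup>+x. (\<integral>\<^sup>+z. ennreal (P\<^sub>0 (x, z)) \<partial>lborel) \<partial>lborel)"
    proof (rule nn_integral_mono)
      fix x
      show "ennreal c\<^sub>0 * (ennreal (\<bar>u x\<bar> * ?d x powr (-s)) * indicator \<Omega> x) \<le> (\<integral>\<^sup>+z. ennreal (P\<^sub>0 (x, z)) \<partial>lborel)"
      proof (cases "x \<in> \<Omega>")
        case True
        have m: "(\<lambda>y. ennreal (norm (y - x) powr (- (?N + s))) * indicator (- \<Omega>) y) \<in> borel_measurable borel" by measurable
        have "ennreal c\<^sub>0 * (ennreal (\<bar>u x\<bar> * ?d x powr (-s)) * indicator \<Omega> x) = ennreal \<bar>u x\<bar> * ennreal (c\<^sub>0 * ?d x powr (-s))"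
          using True c0(1) by (simp add: ennreal_mult[symmetric] mult_ac)
        also have "\<dots> \<le> ennreal \<bar>u x\<bar> * (\<integral>\<^sup>+y. ennreal (norm (y - x) powr (- (?N + s))) * indicator (- \<Omega>) y \<partial>lborel)"
          by (intro mult_left_mono c0(2)[OF True]) simp
        also have "(\<integral>\<^sup>+y. ennreal (norm (y - x) powr (- (?N + s))) * indicator (- \<Omega>) y \<partial>lborel)
          = (\<integral>\<^sup>+z. ennreal (norm (x + z - x) powr (- (?N + s))) * indicator (- \<Omega>) (x + z) \<partial>lborel)"
          by (rule nn_integral_lborel_shift[OF m, symmetric])
        also have "ennreal \<bar>u x\<bar> * \<dots> = (\<integral>\<^sup>+z. ennreal \<bar>u x\<bar> * (ennreal (norm (x + z - x) powr (- (?N + s))) * indicator (- \<Omega>) (x + z)) \<partial>lborel)"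
          by (rule nn_integral_cmult[symmetric]) measurable
        also have "\<dots> = (\<integral>\<^sup>+z. ennreal (P\<^sub>0 (x, z)) \<partial>lborel)"
          using True by (intro nn_integral_cong) (auto simp: P\<^sub>0_def E\<^sub>1_def indicator_def ennreal_mult[symmetric] mult.commute)
        finally show ?thesis .
      qed simp
    qed
    also have "\<dots> = (\<integral>\<^sup>+p. ennreal (P\<^sub>0 p) \<partial>(lborel \<Otimes>\<^sub>M lborel))" by (rule lborel.nn_integral_fst[OF P0m])
    also note fin
    finally have le: "ennreal c\<^sub>0 * (\<integral>\<^sup>+x. ennreal (\<bar>u x\<bar> * ?d x powr (-s)) * indicator \<Omega> x \<partial>lborel) \<le> ennreal (2 * A / \<bar>?c\<bar>)" .
    have "(\<integral>\<^sup>+x. ennreal (\<bar>u x\<bar> * ?d x powr (-s)) * indicator \<Omega> x \<partial>lborel)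
      = ennreal (1 / c\<^sub>0) * (ennreal c\<^sub>0 * (\<integral>\<^sup>+x. ennreal (\<bar>u x\<bar> * ?d x powr (-s)) * indicator \<Omega> x \<partial>lborel))"
      using c0(1) by (simp add: mult.assoc[symmetric] ennreal_mult[symmetric])
    also have "\<dots> \<le> ennreal (1 / c\<^sub>0) * ennreal (2 * A / \<bar>?c\<bar>)" by (intro mult_left_mono le) simp
    also have "\<dots> = ennreal (1 / c\<^sub>0 * (2 * A / \<bar>?c\<bar>))" using c0(1) by (intro ennreal_mult'[symmetric]) simp
    also have "1 / c\<^sub>0 * (2 * A / \<bar>?c\<bar>) = 2 / (\<bar>?c\<bar> * c\<^sub>0) * A" by (simp add: field_simps)
    finally show "(\<integral>\<^sup>+x. ennreal (\<bar>u x\<bar> * ?d x powr (-s)) * indicator \<Omega> x \<partial>lborel) \<le> ennreal (2 / (\<bar>?c\<bar> * c\<^sub>0) * A)" .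
  qed
qed

section \<open>Weak solutions\<close>

lemma Lp_space_finite_measure_integrable:
  assumes "finite_measure M" "1 \<le> p" "f \<in> Lp_space p M"
  shows "integrable M f"
proof (rule Bochner_Integration.integrable_bound[of _ "\<lambda>x. 1 + \<bar>f x\<bar> powr p"])
  interpret finite_measure M by fact
  show "integrable M (\<lambda>x. 1 + \<bar>f x\<bar> powr p)" "f \<in> borel_measurable M"
    using assms(3) by (auto simp: Lp_space_def)
  have "\<bar>f x\<bar> \<le> 1 + \<bar>f x\<bar> powr p" for x
  proof (cases "\<bar>f x\<bar> \<le> 1")
    case False
    then show ?thesis using powr_mono[of 1 p "\<bar>f x\<bar>"] assms(2) by simp
  qed (simp add: add_increasing2)
  then show "AE x in M. norm (f x) \<le> norm (1 + \<bar>f x\<bar> powr p)" by (simp add: abs_of_nonneg add_nonneg_nonneg)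
qed

text \<open>Data on \<Omega> are Lebesgue measurable and defined up to null sets, whereas the
  estimates use Fubini and translations for Borel functions on the whole space. Values outside
  \<Omega> are set to 0.\<close>

lemma lebesgue_on_borel_representative:
  fixes f :: "'a::euclidean_space \<Rightarrow> real"
  assumes \<Omega>: "open \<Omega>" and f: "f \<in> borel_measurable (lebesgue_on \<Omega>)"
  obtains f\<^sub>0 where "f\<^sub>0 \<in> borel_measurable borel" "\<And>x. x \<notin> \<Omega> \<Longrightarrow> f\<^sub>0 x = 0" "AE x in lborel. x \<in> \<Omega> \<longrightarrow> f\<^sub>0 x = f x"
proof -
  have [measurable]: "\<Omega> \<in> sets borel" using \<Omega> by auto
  have "(\<lambda>x. indicator \<Omega> x *\<^sub>R f x) \<in> borel_measurable lebesgue"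
    using f \<Omega> by (subst (asm) borel_measurable_restrict_space_iff) auto
  then obtain f' where f': "f' \<in> borel_measurable lborel" "AE x in lborel. indicator \<Omega> x *\<^sub>R f x = f' x"
    using completion_ex_borel_measurable_real by blast
  have [measurable]: "f' \<in> borel_measurable borel" using f' by simp
  show thesis
  proof (rule that[of "\<lambda>x. indicator \<Omega> x * f' x"])
    show "(\<lambda>x. indicator \<Omega> x * f' x) \<in> borel_measurable borel" by measurable
    show "AE x in lborel. x \<in> \<Omega> \<longrightarrow> indicator \<Omega> x * f' x = f x"
      using f'(2) by eventually_elim auto
  qed simp
qed

lemma AE_lebesgue_on_iff:
  assumes "open \<Omega>"
  shows "(AE x in lebesgue_on \<Omega>. P x) \<longleftrightarrow> (AE x in lborel. x \<in> \<Omega> \<longrightarrow> P x)"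
  using assms by (subst AE_restrict_space_iff) (auto simp: AE_completion_iff)

lemma nn_integral_lebesgue_on:
  assumes "open \<Omega>"
  shows "(\<integral>\<^sup>+x. f x \<partial>lebesgue_on \<Omega>) = (\<integral>\<^sup>+x. f x * indicator \<Omega> x \<partial>lborel)"
  using assms by (subst nn_integral_restrict_space) (auto simp: nn_integral_completion)

text \<open>True without integrability, because the Bochner integral of a non-integrable function is
  0. So weak identities can be estimated before their integrands are known to be integrable.\<close>

lemma norm_integral_le_nn_integral:
  fixes f :: "'b \<Rightarrow> real"
  shows "ennreal \<bar>\<integral>x. f x \<partial>M\<bar> \<le> (\<integral>\<^sup>+x. ennreal \<bar>f x\<bar> \<partial>M)"
proof (cases "integrable M f")
  case True
  then show ?thesis using integral_norm_bound_ennreal[of M f] by simp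
next
  case False
  then show ?thesis by (simp add: not_integrable_integral_eq)
qed

text \<open>Everything about a weak solution that is used, in terms of Borel functions: \<open>\<gamma>\<close> stands for
  \<open>\<bar>(-\<Delta>)\<^sup>s\<^sup>/\<^sup>2 u\<bar>\<close>.\<close>
lemma weak_solution_borel:
  fixes \<Omega> :: "'a::euclidean_space set" and s \<mu>\<^sub>1 lam :: real and f f\<^sub>0 \<mu> u :: "'a \<Rightarrow> real"
  assumes \<Omega>: "open \<Omega>" "bounded \<Omega>" and s: "0 < s" "s < 1" and dim: "2 \<le> DIM('a)"
    and f: "integrable (lebesgue_on \<Omega>) f" "AE x in lebesgue_on \<Omega>. f x \<ge> 0"
    and f0: "f\<^sub>0 \<in> borel_measurable borel" "AE x in lborel. x \<in> \<Omega> \<longrightarrow> f\<^sub>0 x = f x" "\<And>x. 0 \<le> f\<^sub>0 x"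
    and \<mu>: "\<mu> \<in> Linf_space (lebesgue_on \<Omega>)" "\<mu>\<^sub>1 > 0" "AE x in lebesgue_on \<Omega>. \<mu> x \<ge> \<mu>\<^sub>1"
    and lam: "0 < lam" and u: "u \<in> frac_sobolev_2 s" "weak_solution s \<Omega> \<mu> lam f u"
  obtains u\<^sub>0 \<gamma> where "integrable lborel u\<^sub>0" "\<And>x. x \<notin> \<Omega> \<Longrightarrow> u\<^sub>0 x = 0"
    "(\<integral>\<^sup>+x. (\<integral>\<^sup>+y. ennreal (\<bar>u\<^sub>0 x - u\<^sub>0 y\<bar>\<^sup>2 / dist x y powr (DIM('a) + 2 * s)) \<partial>lborel) \<partial>lborel) < \<infinity>"
    "\<gamma> \<in> borel_measurable borel" "\<And>x. 0 \<le> \<gamma> x" "(\<integral>\<^sup>+x. ennreal ((\<gamma> x)\<^sup>2) * indicator \<Omega> x \<partial>lborel) < \<infinity>"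
    "\<And>\<phi>. \<phi> \<in> test_functions \<Omega> \<Longrightarrow> (\<And>x. \<bar>\<phi> x\<bar> \<le> 1) \<Longrightarrow>
      ennreal \<bar>\<integral>x. u\<^sub>0 x * frac_lap (s / 2) \<phi> x \<partial>lborel\<bar> \<le> (\<integral>\<^sup>+x. ennreal (\<gamma> x) * indicator \<Omega> x \<partial>lborel)"
    "\<And>\<phi>. \<phi> \<in> test_functions \<Omega> \<Longrightarrow> (\<And>x. 0 \<le> \<phi> x) \<Longrightarrow>
      (\<integral>\<^sup>+x. ennreal (\<mu>\<^sub>1 * (\<gamma> x)\<^sup>2 + lam * f\<^sub>0 x) * ennreal (\<phi> x) * indicator \<Omega> x \<partial>lborel)
      \<le> (\<integral>\<^sup>+x. ennreal (\<bar>u\<^sub>0 x\<bar> * \<bar>frac_lap s \<phi> x\<bar>) * indicator \<Omega> x \<partial>lborel)"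
proof -
  have [measurable]: "\<Omega> \<in> sets borel" using \<Omega> by auto
  have \<Omega>leb: "\<Omega> \<inter> space lebesgue \<in> sets lebesgue" by simp
  obtain g where u1: "integrable (lebesgue_on \<Omega>) u" "AE x in lebesgue. x \<notin> \<Omega> \<longrightarrow> u x = 0"
    and hg: "has_frac_lap_on (s / 2) \<Omega> u g" and g2: "integrable (lebesgue_on \<Omega>) (\<lambda>x. \<bar>g x\<bar>\<^sup>2)"
    and weak: "\<And>\<phi> h. \<phi> \<in> test_space_X s \<Omega> \<Longrightarrow> has_frac_lap_on s \<Omega> \<phi> h \<Longrightarrow>
          (LINT x|lebesgue_on \<Omega>. u x * h x) = (LINT x|lebesgue_on \<Omega>. (\<mu> x * \<bar>g x\<bar>\<^sup>2 + lam * f x) * \<phi> x)"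
    using u(2) unfolding weak_solution_def by blast
  have um: "u \<in> borel_measurable lebesgue" using u(1) by (simp add: frac_sobolev_2_def Lp_space_def)
  have "u \<in> borel_measurable (lebesgue_on \<Omega>)" using u1(1) by auto
  then obtain u\<^sub>0 where u0: "u\<^sub>0 \<in> borel_measurable borel" "\<And>x. x \<notin> \<Omega> \<Longrightarrow> u\<^sub>0 x = 0" "AE x in lborel. x \<in> \<Omega> \<longrightarrow> u\<^sub>0 x = u x"
    using lebesgue_on_borel_representative[OF \<Omega>(1)] by blast
  note [measurable] = u0(1) f0(1)
  have ae_u: "AE x in lborel. u\<^sub>0 x = u x"
    using u0(3) u1(2)[unfolded AE_completion_iff] by eventually_elim (use u0(2) in auto)
  \<comment> \<open>Local integrability speaks about g on compact subsets only. Measurability of |g|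
    on all of \<Omega> is read off from its integrable square, and only |g| enters the
    estimates.\<close>
  have "(\<lambda>x. \<bar>g x\<bar>) = (\<lambda>x. sqrt (\<bar>g x\<bar>\<^sup>2))" by (rule ext) simp
  also have "\<dots> \<in> borel_measurable (lebesgue_on \<Omega>)" by (rule measurable_compose[OF borel_measurable_integrable[OF g2]]) simp
  finally obtain \<gamma>' where \<gamma>': "\<gamma>' \<in> borel_measurable borel" "\<And>x. x \<notin> \<Omega> \<Longrightarrow> \<gamma>' x = 0" "AE x in lborel. x \<in> \<Omega> \<longrightarrow> \<gamma>' x = \<bar>g x\<bar>"
    using lebesgue_on_borel_representative[OF \<Omega>(1)] by blast
  note [measurable] = \<gamma>'(1)
  define \<gamma> where "\<gamma> x = \<bar>\<gamma>' x\<bar>" for x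
  have [measurable]: "\<gamma> \<in> borel_measurable borel" unfolding \<gamma>_def by measurable
  have ae_\<gamma>: "AE x in lborel. x \<in> \<Omega> \<longrightarrow> \<gamma> x = \<bar>g x\<bar>" using \<gamma>'(3) by eventually_elim (simp add: \<gamma>_def)
  show thesis
  proof (rule that[of u\<^sub>0 \<gamma>])
    show "integrable lborel u\<^sub>0"
    proof -
      have "integrable lebesgue (\<lambda>x. indicator \<Omega> x *\<^sub>R u x)" using u1(1) integrable_restrict_space[OF \<Omega>leb] by blast
      moreover have "AE x in lebesgue. indicator \<Omega> x *\<^sub>R u x = u\<^sub>0 x"
        unfolding AE_completion_iff using u0(3) by eventually_elim (auto simp: indicator_def u0(2))
      moreover have "u\<^sub>0 \<in> borel_measurable lebesgue" by (intro measurable_completion) simp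
      ultimately have "integrable lebesgue u\<^sub>0" using integrable_cong_AE_imp by blast
      then show ?thesis by (subst (asm) integrable_completion) auto
    qed
    show "u\<^sub>0 x = 0" if "x \<notin> \<Omega>" for x using u0(2)[OF that] .
    show "(\<integral>\<^sup>+x. (\<integral>\<^sup>+y. ennreal (\<bar>u\<^sub>0 x - u\<^sub>0 y\<bar>\<^sup>2 / dist x y powr (DIM('a) + 2 * s)) \<partial>lborel) \<partial>lborel) < \<infinity>"
    proof -
      have "(\<integral>\<^sup>+x. (\<integral>\<^sup>+y. ennreal (\<bar>u x - u y\<bar>\<^sup>2 / dist x y powr (DIM('a) + 2 * s)) \<partial>lborel) \<partial>lborel) < \<infinity>"
        using u(1) unfolding frac_sobolev_2_def by (simp add: nn_integral_completion)
      also have "(\<integral>\<^sup>+x. (\<integral>\<^sup>+y. ennreal (\<bar>u x - u y\<bar>\<^sup>2 / dist x y powr (DIM('a) + 2 * s)) \<partial>lborel) \<partial>lborel)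
        = (\<integral>\<^sup>+x. (\<integral>\<^sup>+y. ennreal (\<bar>u\<^sub>0 x - u\<^sub>0 y\<bar>\<^sup>2 / dist x y powr (DIM('a) + 2 * s)) \<partial>lborel) \<partial>lborel)"
      proof (rule nn_integral_cong_AE)
        show "AE x in lborel. (\<integral>\<^sup>+y. ennreal (\<bar>u x - u y\<bar>\<^sup>2 / dist x y powr (DIM('a) + 2 * s)) \<partial>lborel)
          = (\<integral>\<^sup>+y. ennreal (\<bar>u\<^sub>0 x - u\<^sub>0 y\<bar>\<^sup>2 / dist x y powr (DIM('a) + 2 * s)) \<partial>lborel)"
          using ae_u
        proof eventually_elim
          case (elim x)
          show ?case
          proof (rule nn_integral_cong_AE)
            show "AE y in lborel. ennreal (\<bar>u x - u y\<bar>\<^sup>2 / dist x y powr (DIM('a) + 2 * s))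
              = ennreal (\<bar>u\<^sub>0 x - u\<^sub>0 y\<bar>\<^sup>2 / dist x y powr (DIM('a) + 2 * s))"
              using ae_u
            proof eventually_elim
              fix y assume "u\<^sub>0 y = u y"
              then show "ennreal (\<bar>u x - u y\<bar>\<^sup>2 / dist x y powr (DIM('a) + 2 * s))
                = ennreal (\<bar>u\<^sub>0 x - u\<^sub>0 y\<bar>\<^sup>2 / dist x y powr (DIM('a) + 2 * s))"
                using elim by (simp only:)
            qed
          qed
        qed
      qed
      finally show ?thesis .
    qed
    show "\<gamma> \<in> borel_measurable borel" by measurable
    show "0 \<le> \<gamma> x" for x by (simp add: \<gamma>_def)
    show "(\<integral>\<^sup>+x. ennreal ((\<gamma> x)\<^sup>2) * indicator \<Omega> x \<partial>lborel) < \<infinity>"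
    proof -
      have "(\<integral>\<^sup>+x. ennreal ((\<gamma> x)\<^sup>2) * indicator \<Omega> x \<partial>lborel) = (\<integral>\<^sup>+x. ennreal (norm (\<bar>g x\<bar>\<^sup>2)) * indicator \<Omega> x \<partial>lborel)"
        by (rule nn_integral_cong_AE) (use ae_\<gamma> in \<open>eventually_elim, auto simp: indicator_def\<close>)
      also have "\<dots> = (\<integral>\<^sup>+x. ennreal (norm (\<bar>g x\<bar>\<^sup>2)) \<partial>lebesgue_on \<Omega>)"
        by (rule nn_integral_lebesgue_on[OF \<Omega>(1), symmetric])
      also have "\<dots> < \<infinity>" using g2 by (simp add: integrable_iff_bounded)
      finally show ?thesis .
    qed
    show "ennreal \<bar>\<integral>x. u\<^sub>0 x * frac_lap (s / 2) \<phi> x \<partial>lborel\<bar> \<le> (\<integral>\<^sup>+x. ennreal (\<gamma> x) * indicator \<Omega> x \<partial>lborel)"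
      if \<phi>: "\<phi> \<in> test_functions \<Omega>" "\<And>x. \<bar>\<phi> x\<bar> \<le> 1" for \<phi>
    proof -
      have flm[measurable]: "frac_lap (s / 2) \<phi> \<in> borel_measurable borel"
        by (rule frac_lap_measurable[OF test_function_tame(1)[OF \<phi>(1)]]) (use s dim in auto)
      have "(\<integral>x. u\<^sub>0 x * frac_lap (s / 2) \<phi> x \<partial>lborel) = (LINT x|lebesgue. u\<^sub>0 x * frac_lap (s / 2) \<phi> x)"
        by (rule integral_completion[symmetric]) measurable
      also have "\<dots> = (LINT x|lebesgue. u x * frac_lap (s / 2) \<phi> x)"
      proof (rule integral_cong_AE)
        have fl': "frac_lap (s / 2) \<phi> \<in> borel_measurable lebesgue" "u\<^sub>0 \<in> borel_measurable lebesgue"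
          by (intro measurable_completion, simp)+
        show "(\<lambda>x. u\<^sub>0 x * frac_lap (s / 2) \<phi> x) \<in> borel_measurable lebesgue" "(\<lambda>x. u x * frac_lap (s / 2) \<phi> x) \<in> borel_measurable lebesgue"
          using fl' um by (auto intro: borel_measurable_times)
        show "AE x in lebesgue. u\<^sub>0 x * frac_lap (s / 2) \<phi> x = u x * frac_lap (s / 2) \<phi> x"
          unfolding AE_completion_iff using ae_u by eventually_elim simp
      qed
      also have "\<dots> = (LINT x:\<Omega>|lebesgue. g x * \<phi> x)"
        using hg \<phi>(1) unfolding has_frac_lap_on_def by blast
      finally have "ennreal \<bar>\<integral>x. u\<^sub>0 x * frac_lap (s / 2) \<phi> x \<partial>lborel\<bar> = ennreal \<bar>LINT x|lebesgue. indicator \<Omega> x *\<^sub>R (g x * \<phi> x)\<bar>"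
        by (simp add: set_lebesgue_integral_def)
      also have "\<dots> \<le> (\<integral>\<^sup>+x. ennreal \<bar>indicator \<Omega> x *\<^sub>R (g x * \<phi> x)\<bar> \<partial>lebesgue)"
        by (rule norm_integral_le_nn_integral)
      also have "\<dots> = (\<integral>\<^sup>+x. ennreal \<bar>indicator \<Omega> x *\<^sub>R (g x * \<phi> x)\<bar> \<partial>lborel)" by (simp add: nn_integral_completion)
      also have "\<dots> \<le> (\<integral>\<^sup>+x. ennreal (\<gamma> x) * indicator \<Omega> x \<partial>lborel)"
      proof (rule nn_integral_mono_AE)
        show "AE x in lborel. ennreal \<bar>indicator \<Omega> x *\<^sub>R (g x * \<phi> x)\<bar> \<le> ennreal (\<gamma> x) * indicator \<Omega> x"
          using ae_\<gamma>
        proof eventually_elim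
          case (elim x)
          have "\<bar>g x\<bar> * \<bar>\<phi> x\<bar> \<le> \<bar>g x\<bar> * 1" by (intro mult_left_mono \<phi>) simp
          then show ?case using elim by (auto simp: indicator_def abs_mult intro!: ennreal_leI)
        qed
      qed
      finally show ?thesis .
    qed
    show "(\<integral>\<^sup>+x. ennreal (\<mu>\<^sub>1 * (\<gamma> x)\<^sup>2 + lam * f\<^sub>0 x) * ennreal (\<phi> x) * indicator \<Omega> x \<partial>lborel)
      \<le> (\<integral>\<^sup>+x. ennreal (\<bar>u\<^sub>0 x\<bar> * \<bar>frac_lap s \<phi> x\<bar>) * indicator \<Omega> x \<partial>lborel)"
      if \<phi>: "\<phi> \<in> test_functions \<Omega>" "\<And>x. 0 \<le> \<phi> x" for \<phi>
    proof -
      let ?G = "\<lambda>x. (\<mu> x * \<bar>g x\<bar>\<^sup>2 + lam * f x) * \<phi> x"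
      have tame: "tame \<phi>" by (rule test_function_tame(1)[OF \<phi>(1)])
      obtain M where M: "\<And>x. \<bar>\<phi> x\<bar> \<le> M" using tame by (auto simp: tame_def)
      have \<phi>m: "\<phi> \<in> borel_measurable (lebesgue_on \<Omega>)"
        by (intro measurable_restrict_space1 measurable_completion) (simp add: tame_measurable[OF tame])
      obtain B where B: "\<mu> \<in> borel_measurable (lebesgue_on \<Omega>)" "AE x in lebesgue_on \<Omega>. \<bar>\<mu> x\<bar> \<le> B"
        using \<mu>(1) by (auto simp: Linf_space_def)
      have int1: "integrable (lebesgue_on \<Omega>) (\<lambda>x. \<mu> x * \<bar>g x\<bar>\<^sup>2)"
      proof (rule Bochner_Integration.integrable_bound[of _ "\<lambda>x. B * \<bar>g x\<bar>\<^sup>2"])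
        show "integrable (lebesgue_on \<Omega>) (\<lambda>x. B * \<bar>g x\<bar>\<^sup>2)" using g2 by simp
        show "(\<lambda>x. \<mu> x * \<bar>g x\<bar>\<^sup>2) \<in> borel_measurable (lebesgue_on \<Omega>)"
          using B(1) g2 by (intro borel_measurable_times) auto
        show "AE x in lebesgue_on \<Omega>. norm (\<mu> x * \<bar>g x\<bar>\<^sup>2) \<le> norm (B * \<bar>g x\<bar>\<^sup>2)"
          using B(2) by eventually_elim (simp add: abs_mult mult_right_mono)
      qed
      have int: "integrable (lebesgue_on \<Omega>) ?G"
      proof (rule Bochner_Integration.integrable_bound[of _ "\<lambda>x. M * (\<mu> x * \<bar>g x\<bar>\<^sup>2 + lam * f x)"])
        show "integrable (lebesgue_on \<Omega>) (\<lambda>x. M * (\<mu> x * \<bar>g x\<bar>\<^sup>2 + lam * f x))" using int1 f(1) by simp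
        show "?G \<in> borel_measurable (lebesgue_on \<Omega>)"
          by (intro borel_measurable_times borel_measurable_add borel_measurable_const \<phi>m borel_measurable_integrable f g2 B(1))
        have "norm (?G x) \<le> norm (M * (\<mu> x * \<bar>g x\<bar>\<^sup>2 + lam * f x))" for x
        proof -
          have "\<bar>\<mu> x * \<bar>g x\<bar>\<^sup>2 + lam * f x\<bar> * \<bar>\<phi> x\<bar> \<le> \<bar>\<mu> x * \<bar>g x\<bar>\<^sup>2 + lam * f x\<bar> * \<bar>M\<bar>"
            using M[of x] by (intro mult_left_mono) auto
          then show ?thesis unfolding real_norm_def abs_mult[of _ "\<phi> x"] abs_mult[of M] by (simp only: mult.commute)
        qed
        then show "AE x in lebesgue_on \<Omega>. norm (?G x) \<le> norm (M * (\<mu> x * \<bar>g x\<bar>\<^sup>2 + lam * f x))" by simp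
      qed
      \<comment> \<open>For a nonnegative test the whole right-hand side of the equation is
        nonnegative, so its Bochner integral equals the nonnegative integral that the bump estimate
        works with.\<close>
      have nonneg: "AE x in lebesgue_on \<Omega>. 0 \<le> ?G x"
        using \<mu>(3) f(2)
      proof eventually_elim
        case (elim x)
        then show ?case using \<mu>(2) lam \<phi>(2)[of x] by (intro mult_nonneg_nonneg add_nonneg_nonneg) auto
      qed
      have "(\<integral>\<^sup>+x. ennreal (\<mu>\<^sub>1 * (\<gamma> x)\<^sup>2 + lam * f\<^sub>0 x) * ennreal (\<phi> x) * indicator \<Omega> x \<partial>lborel)
        \<le> (\<integral>\<^sup>+x. ennreal (?G x) * indicator \<Omega> x \<partial>lborel)"
      proof (rule nn_integral_mono_AE)
        show "AE x in lborel. ennreal (\<mu>\<^sub>1 * (\<gamma> x)\<^sup>2 + lam * f\<^sub>0 x) * ennreal (\<phi> x) * indicator \<Omega> x \<le> ennreal (?G x) * indicator \<Omega> x"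
          using ae_\<gamma> f0(2) \<mu>(3)[unfolded AE_lebesgue_on_iff[OF \<Omega>(1)]]
        proof eventually_elim
          case (elim x)
          show ?case
          proof (cases "x \<in> \<Omega>")
            case True
            have "\<mu>\<^sub>1 * (\<gamma> x)\<^sup>2 \<le> \<mu> x * \<bar>g x\<bar>\<^sup>2" using True elim by (auto intro!: mult_right_mono)
            then have le: "(\<mu>\<^sub>1 * (\<gamma> x)\<^sup>2 + lam * f\<^sub>0 x) * \<phi> x \<le> ?G x" using True elim \<phi>(2)[of x] by (intro mult_right_mono) auto
            have "0 \<le> \<mu>\<^sub>1 * (\<gamma> x)\<^sup>2 + lam * f\<^sub>0 x" using \<mu>(2) lam f0(3)[of x] by simp
            then have "ennreal (\<mu>\<^sub>1 * (\<gamma> x)\<^sup>2 + lam * f\<^sub>0 x) * ennreal (\<phi> x) = ennreal ((\<mu>\<^sub>1 * (\<gamma> x)\<^sup>2 + lam * f\<^sub>0 x) * \<phi> x)"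
              by (rule ennreal_mult[symmetric]) (rule \<phi>(2))
            then show ?thesis using True ennreal_leI[OF le] by (simp only: indicator_simps mult_1_right)
          qed simp
        qed
      qed
      also have "\<dots> = (\<integral>\<^sup>+x. ennreal (?G x) \<partial>lebesgue_on \<Omega>)" by (rule nn_integral_lebesgue_on[OF \<Omega>(1), symmetric])
      also have "\<dots> = ennreal (LINT x|lebesgue_on \<Omega>. ?G x)" by (rule nn_integral_eq_integral[OF int nonneg])
      also have "(LINT x|lebesgue_on \<Omega>. ?G x) = (LINT x|lebesgue_on \<Omega>. u x * frac_lap s \<phi> x)"
        by (rule weak[OF test_function_in_X[OF \<phi>(1) \<Omega>(1) s dim], symmetric])
      also have "ennreal \<dots> \<le> ennreal \<bar>LINT x|lebesgue_on \<Omega>. u x * frac_lap s \<phi> x\<bar>" by (intro ennreal_leI) simp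
      also have "\<dots> \<le> (\<integral>\<^sup>+x. ennreal \<bar>u x * frac_lap s \<phi> x\<bar> \<partial>lebesgue_on \<Omega>)" by (rule norm_integral_le_nn_integral)
      also have "\<dots> = (\<integral>\<^sup>+x. ennreal \<bar>u x * frac_lap s \<phi> x\<bar> * indicator \<Omega> x \<partial>lborel)" by (rule nn_integral_lebesgue_on[OF \<Omega>(1)])
      also have "\<dots> = (\<integral>\<^sup>+x. ennreal (\<bar>u\<^sub>0 x\<bar> * \<bar>frac_lap s \<phi> x\<bar>) * indicator \<Omega> x \<partial>lborel)"
        by (rule nn_integral_cong_AE) (use ae_u in \<open>eventually_elim, simp add: abs_mult\<close>)
      finally show ?thesis .
    qed
  qed
qed

text \<open>The two estimates \<open>\<integral>(\<mu>\<^sub>1 \<gamma>\<^sup>2 + \<lambda> f) \<delta>\<^sup>s \<le> C\<^sub>2 \<integral>\<bar>u\<bar> \<delta>\<^sup>-\<^sup>s\<close> and \<open>\<integral>\<bar>u\<bar> \<delta>\<^sup>-\<^sup>s \<le> C\<^sub>1 \<integral>\<gamma>\<close> close up by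
  \<open>\<gamma> \<le> t \<gamma>\<^sup>2 \<delta>\<^sup>s + \<delta>\<^sup>-\<^sup>s / t\<close>.\<close>
lemma lambda_bound:
  fixes \<Omega> :: "'a::euclidean_space set" and s \<mu>\<^sub>1 :: real and f f\<^sub>0 \<mu> :: "'a \<Rightarrow> real"
  assumes \<Omega>: "open \<Omega>" "bounded \<Omega>" "C2_boundary \<Omega>" and s: "0 < s" "s < 1" and dim: "2 \<le> DIM('a)"
    and f: "integrable (lebesgue_on \<Omega>) f" "AE x in lebesgue_on \<Omega>. f x \<ge> 0"
    and f0: "f\<^sub>0 \<in> borel_measurable borel" "AE x in lborel. x \<in> \<Omega> \<longrightarrow> f\<^sub>0 x = f x" "\<And>x. 0 \<le> f\<^sub>0 x"
    and \<mu>: "\<mu> \<in> Linf_space (lebesgue_on \<Omega>)" "\<mu>\<^sub>1 > 0" "AE x in lebesgue_on \<Omega>. \<mu> x \<ge> \<mu>\<^sub>1"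
  shows "\<exists>B\<ge>0. \<forall>lam u. 0 < lam \<longrightarrow> u \<in> frac_sobolev_2 s \<longrightarrow> weak_solution s \<Omega> \<mu> lam f u \<longrightarrow>
    ennreal lam * (\<integral>\<^sup>+x. ennreal (f\<^sub>0 x) * ennreal (dist_compl \<Omega> x powr s) * indicator \<Omega> x \<partial>lborel) \<le> ennreal B"
proof -
  let ?d = "dist_compl \<Omega>"
  have ne: "- \<Omega> \<noteq> {}" using bounded_compl_nonempty[OF \<Omega>(2)] .
  have [measurable]: "\<Omega> \<in> sets borel" using \<Omega> by auto
  have [measurable]: "?d \<in> borel_measurable borel"
    by (intro borel_measurable_continuous_onI continuous_intros)
  have dpos: "0 < ?d x" if "x \<in> \<Omega>" for x using dist_compl_pos[OF \<Omega>(1) ne that] .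
  note [measurable] = f0(1)
  obtain C\<^sub>1 where C1: "0 \<le> C\<^sub>1" and C1': "\<forall>u A. integrable lborel u \<longrightarrow> (\<forall>x. x \<notin> \<Omega> \<longrightarrow> u x = 0) \<longrightarrow>
    (\<integral>\<^sup>+x. (\<integral>\<^sup>+y. ennreal (\<bar>u x - u y\<bar>\<^sup>2 / dist x y powr (DIM('a) + 2 * s)) \<partial>lborel) \<partial>lborel) < \<infinity> \<longrightarrow>
    (\<forall>\<phi>\<in>test_functions \<Omega>. (\<forall>x. \<bar>\<phi> x\<bar> \<le> 1) \<longrightarrow> \<bar>\<integral>x. u x * frac_lap (s / 2) \<phi> x \<partial>lborel\<bar> \<le> A) \<longrightarrow>
    (\<integral>\<^sup>+x. ennreal (\<bar>u x\<bar> * ?d x powr (-s)) * indicator \<Omega> x \<partial>lborel) \<le> ennreal (C\<^sub>1 * A)"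
    using kato_hardy[OF \<Omega> s dim] by (elim exE conjE)
  obtain C\<^sub>2 where C2: "0 \<le> C\<^sub>2" and C2': "\<forall>G u. G \<in> borel_measurable borel \<longrightarrow> u \<in> borel_measurable borel \<longrightarrow>
    (\<forall>x\<^sub>0 r. 0 < r \<and> cball x\<^sub>0 r \<subseteq> \<Omega> \<longrightarrow>
      (\<integral>\<^sup>+x. G x * ennreal (bump ((x - x\<^sub>0) /\<^sub>R r)) * indicator \<Omega> x \<partial>lborel)
      \<le> (\<integral>\<^sup>+x. ennreal (\<bar>u x\<bar> * \<bar>frac_lap s (\<lambda>x. bump ((x - x\<^sub>0) /\<^sub>R r)) x\<bar>) * indicator \<Omega> x \<partial>lborel)) \<longrightarrow>
    (\<integral>\<^sup>+x. G x * ennreal (?d x powr s) * indicator \<Omega> x \<partial>lborel)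
      \<le> ennreal C\<^sub>2 * (\<integral>\<^sup>+x. ennreal (\<bar>u x\<bar> * ?d x powr (-s)) * indicator \<Omega> x \<partial>lborel)"
    using weighted_bump_estimate[OF \<Omega>(1) ne s dim] by (elim exE conjE)
  define C where "C = C\<^sub>2 * C\<^sub>1"
  have C: "0 \<le> C" using C1 C2 by (simp add: C_def)
  \<comment> \<open>Chosen so that C t \<le> \<open>\<mu>\<^sub>1\<close>: the quadratic term
    produced by splitting \<gamma> is then absorbed on the left. The summand 1 covers C = 0.\<close>
  define t where "t = \<mu>\<^sub>1 / (C + 1)"
  have t: "0 < t" "C * t \<le> \<mu>\<^sub>1"
  proof -
    show "0 < t" using C \<mu>(2) by (simp add: t_def)
    have "C * t = \<mu>\<^sub>1 * (C / (C + 1))" by (simp add: t_def)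
    also have "\<dots> \<le> \<mu>\<^sub>1 * 1" using C \<mu>(2) by (intro mult_left_mono) (auto simp: divide_le_eq_1)
    finally show "C * t \<le> \<mu>\<^sub>1" by simp
  qed
  define I where "I = enn2real (\<integral>\<^sup>+x. ennreal (?d x powr (-s)) * indicator \<Omega> x \<partial>lborel)"
  have I: "(\<integral>\<^sup>+x. ennreal (?d x powr (-s)) * indicator \<Omega> x \<partial>lborel) = ennreal I" "0 \<le> I"
    using nn_integral_dist_compl_powr_finite[OF \<Omega> s] by (auto simp: I_def)
  show ?thesis
  proof (intro exI[of _ "C / t * I"] conjI allI impI)
    show "0 \<le> C / t * I" using C t I by simp
    fix lam :: real and u :: "'a \<Rightarrow> real"
    assume lam: "0 < lam" and u: "u \<in> frac_sobolev_2 s" "weak_solution s \<Omega> \<mu> lam f u"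
    obtain u\<^sub>0 \<gamma> where u0: "integrable lborel u\<^sub>0" "\<And>x. x \<notin> \<Omega> \<Longrightarrow> u\<^sub>0 x = 0"
      "(\<integral>\<^sup>+x. (\<integral>\<^sup>+y. ennreal (\<bar>u\<^sub>0 x - u\<^sub>0 y\<bar>\<^sup>2 / dist x y powr (DIM('a) + 2 * s)) \<partial>lborel) \<partial>lborel) < \<infinity>"
      and \<gamma>m: "\<gamma> \<in> borel_measurable borel" and \<gamma>0: "\<And>x. 0 \<le> \<gamma> x" and \<gamma>2: "(\<integral>\<^sup>+x. ennreal ((\<gamma> x)\<^sup>2) * indicator \<Omega> x \<partial>lborel) < \<infinity>"
      and est1: "\<And>\<phi>. \<phi> \<in> test_functions \<Omega> \<Longrightarrow> (\<And>x. \<bar>\<phi> x\<bar> \<le> 1) \<Longrightarrow>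
        ennreal \<bar>\<integral>x. u\<^sub>0 x * frac_lap (s / 2) \<phi> x \<partial>lborel\<bar> \<le> (\<integral>\<^sup>+x. ennreal (\<gamma> x) * indicator \<Omega> x \<partial>lborel)"
      and est2: "\<And>\<phi>. \<phi> \<in> test_functions \<Omega> \<Longrightarrow> (\<And>x. 0 \<le> \<phi> x) \<Longrightarrow>
        (\<integral>\<^sup>+x. ennreal (\<mu>\<^sub>1 * (\<gamma> x)\<^sup>2 + lam * f\<^sub>0 x) * ennreal (\<phi> x) * indicator \<Omega> x \<partial>lborel)
        \<le> (\<integral>\<^sup>+x. ennreal (\<bar>u\<^sub>0 x\<bar> * \<bar>frac_lap s \<phi> x\<bar>) * indicator \<Omega> x \<partial>lborel)"
      by (rule weak_solution_borel[OF \<Omega>(1,2) s dim f f0 \<mu> lam u]) (assumption | blast)+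
    note [measurable] = \<gamma>m
    have [measurable]: "u\<^sub>0 \<in> borel_measurable borel" using u0(1) by auto
    let ?A = "\<integral>\<^sup>+x. ennreal (\<gamma> x) * indicator \<Omega> x \<partial>lborel"
    let ?E = "\<integral>\<^sup>+x. ennreal ((\<gamma> x)\<^sup>2 * ?d x powr s) * indicator \<Omega> x \<partial>lborel"
    let ?F = "\<integral>\<^sup>+x. ennreal (f\<^sub>0 x) * ennreal (?d x powr s) * indicator \<Omega> x \<partial>lborel"
    \<comment> \<open>Finiteness of the integral of \<gamma> follows from \<gamma> \<le> 1 +
      \<gamma>^2 on the bounded set \<Omega>. It makes \<open>enn2real ?A\<close> a genuine bound in
      the sign test and later gives finiteness of \<open>?E\<close>.\<close>
    have "?A \<le> (\<integral>\<^sup>+x. indicator \<Omega> x + ennreal ((\<gamma> x)\<^sup>2) * indicator \<Omega> x \<partial>lborel)"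
    proof (rule nn_integral_mono)
      fix x
      have "\<gamma> x \<le> 1 + (\<gamma> x)\<^sup>2" using zero_le_power2[of "\<gamma> x - 1/2"] by (simp add: power2_eq_square algebra_simps)
      then have "ennreal (\<gamma> x) \<le> 1 + ennreal ((\<gamma> x)\<^sup>2)"
        by (metis ennreal_1 ennreal_leI ennreal_plus zero_le_one zero_le_power2)
      then show "ennreal (\<gamma> x) * indicator \<Omega> x \<le> indicator \<Omega> x + ennreal ((\<gamma> x)\<^sup>2) * indicator \<Omega> x"
        by (auto simp: indicator_def)
    qed
    also have "\<dots> = emeasure lborel \<Omega> + (\<integral>\<^sup>+x. ennreal ((\<gamma> x)\<^sup>2) * indicator \<Omega> x \<partial>lborel)"
      by (subst nn_integral_add) auto
    also have "\<dots> < \<infinity>" using \<gamma>2 emeasure_bounded_finite[OF \<Omega>(2)] by simp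
    finally have Afin: "?A < \<infinity>" .
    have Aeq: "ennreal (enn2real ?A) = ?A" using Afin by simp
    have "\<bar>\<integral>x. u\<^sub>0 x * frac_lap (s / 2) \<phi> x \<partial>lborel\<bar> \<le> enn2real ?A" if "\<phi> \<in> test_functions \<Omega>" "\<forall>x. \<bar>\<phi> x\<bar> \<le> 1" for \<phi>
    proof -
      have "ennreal \<bar>\<integral>x. u\<^sub>0 x * frac_lap (s / 2) \<phi> x \<partial>lborel\<bar> \<le> ennreal (enn2real ?A)"
        unfolding Aeq using est1[of \<phi>] that by blast
      then show ?thesis by (simp only: ennreal_le_iff enn2real_nonneg)
    qed
    then have "(\<integral>\<^sup>+x. ennreal (\<bar>u\<^sub>0 x\<bar> * ?d x powr (-s)) * indicator \<Omega> x \<partial>lborel) \<le> ennreal (C\<^sub>1 * enn2real ?A)"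
      using C1'[rule_format, of u\<^sub>0 "enn2real ?A"] u0 by blast
    also have "\<dots> = ennreal C\<^sub>1 * ?A" using C1 Aeq by (simp add: ennreal_mult)
    finally have le1: "(\<integral>\<^sup>+x. ennreal (\<bar>u\<^sub>0 x\<bar> * ?d x powr (-s)) * indicator \<Omega> x \<partial>lborel) \<le> ennreal C\<^sub>1 * ?A" .
    have le2: "(\<integral>\<^sup>+x. ennreal (\<mu>\<^sub>1 * (\<gamma> x)\<^sup>2 + lam * f\<^sub>0 x) * ennreal (?d x powr s) * indicator \<Omega> x \<partial>lborel)
      \<le> ennreal C\<^sub>2 * (\<integral>\<^sup>+x. ennreal (\<bar>u\<^sub>0 x\<bar> * ?d x powr (-s)) * indicator \<Omega> x \<partial>lborel)"
    proof (rule C2'[rule_format])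
      show "(\<lambda>x. ennreal (\<mu>\<^sub>1 * (\<gamma> x)\<^sup>2 + lam * f\<^sub>0 x)) \<in> borel_measurable borel" "u\<^sub>0 \<in> borel_measurable borel" by measurable
      fix x\<^sub>0 r assume "0 < r \<and> cball x\<^sub>0 r \<subseteq> \<Omega>"
      then show "(\<integral>\<^sup>+x. ennreal (\<mu>\<^sub>1 * (\<gamma> x)\<^sup>2 + lam * f\<^sub>0 x) * ennreal (bump ((x - x\<^sub>0) /\<^sub>R r)) * indicator \<Omega> x \<partial>lborel)
        \<le> (\<integral>\<^sup>+x. ennreal (\<bar>u\<^sub>0 x\<bar> * \<bar>frac_lap s (\<lambda>x. bump ((x - x\<^sub>0) /\<^sub>R r)) x\<bar>) * indicator \<Omega> x \<partial>lborel)"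
        by (intro est2 bump_scaled_test_function bump_nonneg) auto
    qed
    have split: "(\<integral>\<^sup>+x. ennreal (\<mu>\<^sub>1 * (\<gamma> x)\<^sup>2 + lam * f\<^sub>0 x) * ennreal (?d x powr s) * indicator \<Omega> x \<partial>lborel) = ennreal \<mu>\<^sub>1 * ?E + ennreal lam * ?F"
    proof -
      have "(\<integral>\<^sup>+x. ennreal (\<mu>\<^sub>1 * (\<gamma> x)\<^sup>2 + lam * f\<^sub>0 x) * ennreal (?d x powr s) * indicator \<Omega> x \<partial>lborel)
        = (\<integral>\<^sup>+x. ennreal \<mu>\<^sub>1 * (ennreal ((\<gamma> x)\<^sup>2 * ?d x powr s) * indicator \<Omega> x) + ennreal lam * (ennreal (f\<^sub>0 x) * ennreal (?d x powr s) * indicator \<Omega> x) \<partial>lborel)"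
      proof (rule nn_integral_cong)
        fix x
        have "ennreal (\<mu>\<^sub>1 * (\<gamma> x)\<^sup>2 + lam * f\<^sub>0 x) = ennreal \<mu>\<^sub>1 * ennreal ((\<gamma> x)\<^sup>2) + ennreal lam * ennreal (f\<^sub>0 x)"
          by (rule ennreal_lincomb') (use \<mu>(2) lam f0(3) in auto)
        then show "ennreal (\<mu>\<^sub>1 * (\<gamma> x)\<^sup>2 + lam * f\<^sub>0 x) * ennreal (?d x powr s) * indicator \<Omega> x
          = ennreal \<mu>\<^sub>1 * (ennreal ((\<gamma> x)\<^sup>2 * ?d x powr s) * indicator \<Omega> x) + ennreal lam * (ennreal (f\<^sub>0 x) * ennreal (?d x powr s) * indicator \<Omega> x)"
          by (simp add: ennreal_mult distrib_right mult.assoc)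
      qed
      also have "\<dots> = ennreal \<mu>\<^sub>1 * ?E + ennreal lam * ?F" by (rule nn_integral_lincomb) measurable
      finally show ?thesis .
    qed
    have main: "ennreal \<mu>\<^sub>1 * ?E + ennreal lam * ?F \<le> ennreal C * ?A"
    proof -
      have "ennreal \<mu>\<^sub>1 * ?E + ennreal lam * ?F \<le> ennreal C\<^sub>2 * (ennreal C\<^sub>1 * ?A)"
        by (rule order_trans[OF le2[unfolded split] mult_left_mono[OF le1 zero_le]])
      then show ?thesis using C1 C2 by (simp add: C_def ennreal_mult mult.assoc)
    qed
    have young: "?A \<le> ennreal t * ?E + ennreal (1 / t) * ennreal I"
    proof -
      have "?A \<le> (\<integral>\<^sup>+x. ennreal t * (ennreal ((\<gamma> x)\<^sup>2 * ?d x powr s) * indicator \<Omega> x) + ennreal (1 / t) * (ennreal (?d x powr (-s)) * indicator \<Omega> x) \<partial>lborel)"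
      proof (rule nn_integral_mono)
        fix x
        show "ennreal (\<gamma> x) * indicator \<Omega> x \<le> ennreal t * (ennreal ((\<gamma> x)\<^sup>2 * ?d x powr s) * indicator \<Omega> x) + ennreal (1 / t) * (ennreal (?d x powr (-s)) * indicator \<Omega> x)"
        proof (cases "x \<in> \<Omega>")
          case True
          let ?p = "t * ?d x powr s"
          have p: "0 < ?p" using t dpos[OF True] by simp
          \<comment> \<open>Expanded, this reads \<gamma> p \<le> \<gamma>^2 p^2 + 1. Division by p
            = t \<delta>^s gives the weighted splitting of \<gamma>.\<close>
          have "0 \<le> (\<gamma> x * ?p - 1)\<^sup>2 + \<gamma> x * ?p" using p \<gamma>0[of x] by simp
          then have "\<gamma> x * ?p \<le> (\<gamma> x)\<^sup>2 * ?p * ?p + 1" by (simp add: power2_eq_square algebra_simps)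
          then have "\<gamma> x \<le> ((\<gamma> x)\<^sup>2 * ?p * ?p + 1) / ?p" using p by (subst pos_le_divide_eq) auto
          also have "\<dots> = (\<gamma> x)\<^sup>2 * ?p + 1 / ?p" using p by (simp only: add_divide_distrib nonzero_mult_div_cancel_right less_imp_neq[symmetric] not_False_eq_True)
          also have "\<dots> = t * ((\<gamma> x)\<^sup>2 * ?d x powr s) + 1 / t * ?d x powr (-s)"
            by (simp add: powr_minus_divide)
          finally have "ennreal (\<gamma> x) \<le> ennreal (t * ((\<gamma> x)\<^sup>2 * ?d x powr s) + 1 / t * ?d x powr (-s))" by (rule ennreal_leI)
          also have "\<dots> = ennreal t * ennreal ((\<gamma> x)\<^sup>2 * ?d x powr s) + ennreal (1 / t) * ennreal (?d x powr (-s))"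
            by (rule ennreal_lincomb') (use t in auto)
          finally show ?thesis using True by simp
        qed simp
      qed
      also have "\<dots> = ennreal t * ?E + ennreal (1 / t) * ennreal I"
        by (subst nn_integral_lincomb) (measurable, simp only: I)
      finally show ?thesis .
    qed
    \<comment> \<open>The term with \<open>?E\<close> can be cancelled from both sides of an
      inequality in \<open>ennreal\<close> only if it is finite.\<close>
    have Efin: "?E < \<infinity>"
    proof -
      have "ennreal \<mu>\<^sub>1 * ?E \<le> ennreal C * ?A" by (rule order_trans[OF add_increasing2[OF zero_le order_refl] main])
      also have "\<dots> < \<infinity>" using Afin by (simp add: ennreal_mult_less_top)
      finally show ?thesis using \<mu>(2) by (auto simp: ennreal_mult_less_top)
    qed
    have "ennreal \<mu>\<^sub>1 * ?E + ennreal lam * ?F \<le> ennreal C * (ennreal t * ?E + ennreal (1 / t) * ennreal I)"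
      by (rule order_trans[OF main mult_left_mono[OF young zero_le]])
    also have "\<dots> = ennreal (C * t) * ?E + ennreal (C / t * I)"
      using C t I by (simp add: distrib_left mult.assoc[symmetric] ennreal_mult[symmetric])
    also have "\<dots> \<le> ennreal \<mu>\<^sub>1 * ?E + ennreal (C / t * I)"
      using t(2) by (intro add_right_mono mult_right_mono ennreal_leI) auto
    finally have fin: "ennreal \<mu>\<^sub>1 * ?E + ennreal lam * ?F \<le> ennreal \<mu>\<^sub>1 * ?E + ennreal (C / t * I)" .
    moreover have "ennreal \<mu>\<^sub>1 * ?E \<noteq> \<infinity>" using Efin by (auto simp: ennreal_mult_eq_top_iff)
    ultimately show "ennreal lam * ?F \<le> ennreal (C / t * I)"
      by (subst (asm) ennreal_add_left_cancel_le) auto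
  qed
qed

section \<open>Choice of the threshold\<close>

theorem theorem1p4:
  fixes \<Omega> :: "(real ^ 'n) set"
    and s m \<mu>\<^sub>1 :: real
    and f \<mu> :: "real ^ 'n \<Rightarrow> real"
  assumes dim: "CARD('n) \<ge> 2"
    and domain: "open \<Omega>" "connected \<Omega>" "bounded \<Omega>" "C2_boundary \<Omega>"
    and s: "0 < s" "s < 1"
    and m: "m > real CARD('n) / s"
    and f_Lm: "f \<in> Lp_space m (lebesgue_on \<Omega>)"
    and f_nonneg: "AE x in lebesgue_on \<Omega>. f x \<ge> 0"
    and f_nonzero: "\<not> (AE x in lebesgue_on \<Omega>. f x = 0)"
    and mu_Linf: "\<mu> \<in> Linf_space (lebesgue_on \<Omega>)"
    and mu_lower: "\<mu>\<^sub>1 > 0" "AE x in lebesgue_on \<Omega>. \<mu> x \<ge> \<mu>\<^sub>1"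
  shows "\<exists>lam_star2 > 0. \<forall>lam > lam_star2.
    \<not> (\<exists>u \<in> frac_sobolev_2 s. weak_solution s \<Omega> \<mu> lam f u)"
proof -
  let ?d = "dist_compl \<Omega>"
  have DIM: "2 \<le> DIM(real ^ 'n)" using dim by simp
  have [measurable]: "\<Omega> \<in> sets borel" using domain by auto
  have [measurable]: "?d \<in> borel_measurable borel"
    by (intro borel_measurable_continuous_onI continuous_intros)
  have "emeasure lborel \<Omega> < \<infinity>" by (rule emeasure_bounded_finite[OF domain(3)])
  then have "finite_measure (lebesgue_on \<Omega>)"
    by (intro finite_measureI) (simp add: emeasure_restrict_space space_restrict_space less_top)
  moreover have "1 \<le> m"
  proof -
    have "1 \<le> real CARD('n) / s" using dim s by (simp add: field_simps)
    then show ?thesis using m by linarith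
  qed
  ultimately have f_int: "integrable (lebesgue_on \<Omega>) f" by (rule Lp_space_finite_measure_integrable[OF _ _ f_Lm])
  obtain f' where f': "f' \<in> borel_measurable borel" "\<And>x. x \<notin> \<Omega> \<Longrightarrow> f' x = 0" "AE x in lborel. x \<in> \<Omega> \<longrightarrow> f' x = f x"
    using lebesgue_on_borel_representative[OF domain(1) borel_measurable_integrable[OF f_int]] by blast
  note [measurable] = f'(1)
  define f\<^sub>0 where "f\<^sub>0 x = max 0 (f' x)" for x
  have f0: "f\<^sub>0 \<in> borel_measurable borel" "AE x in lborel. x \<in> \<Omega> \<longrightarrow> f\<^sub>0 x = f x" "\<And>x. 0 \<le> f\<^sub>0 x"
  proof -
    show "f\<^sub>0 \<in> borel_measurable borel" unfolding f\<^sub>0_def by measurable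
    show "AE x in lborel. x \<in> \<Omega> \<longrightarrow> f\<^sub>0 x = f x"
      using f'(3) f_nonneg[unfolded AE_lebesgue_on_iff[OF domain(1)]] by eventually_elim (auto simp: f\<^sub>0_def)
  qed (simp add: f\<^sub>0_def)
  note [measurable] = f0(1)
  let ?F = "\<integral>\<^sup>+x. ennreal (f\<^sub>0 x) * ennreal (?d x powr s) * indicator \<Omega> x \<partial>lborel"
  have "?F \<noteq> 0"
  proof
    assume "?F = 0"
    then have "AE x in lborel. ennreal (f\<^sub>0 x) * ennreal (?d x powr s) * indicator \<Omega> x = 0"
      by (subst (asm) nn_integral_0_iff_AE) auto
    then have "AE x in lborel. x \<in> \<Omega> \<longrightarrow> f x = 0"
      using f0(2)
    proof eventually_elim
      case (elim x)
      show ?case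
      proof
        assume x: "x \<in> \<Omega>"
        then have "0 < ?d x powr s"
          using dist_compl_pos[OF domain(1) bounded_compl_nonempty[OF domain(3)] x] by simp
        then have "f\<^sub>0 x = 0" using elim(1) x f0(3)[of x] by (auto simp: ennreal_eq_0_iff)
        then show "f x = 0" using elim(2) x by simp
      qed
    qed
    then show False using f_nonzero AE_lebesgue_on_iff[OF domain(1)] by blast
  qed
  \<comment> \<open>The weighted integral of f is positive but handled as an extended real. Its
    minimum with 1 is a positive real lower bound, which is all the threshold requires.\<close>
  define F where "F = enn2real (min ?F 1)"
  have Fmin: "min ?F 1 = ennreal F" unfolding F_def by (rule ennreal_enn2real[symmetric]) (simp add: min_less_iff_disj)
  have F: "0 < F" "ennreal F \<le> ?F"
  proof -
    have "min ?F 1 \<noteq> 0" using \<open>?F \<noteq> 0\<close> by (auto simp: min_def)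
    then show "0 < F" unfolding Fmin by (simp add: ennreal_eq_0_iff not_le)
    show "ennreal F \<le> ?F" unfolding Fmin[symmetric] by simp
  qed
  obtain B where B: "0 \<le> B" "\<And>lam u. 0 < lam \<Longrightarrow> u \<in> frac_sobolev_2 s \<Longrightarrow> weak_solution s \<Omega> \<mu> lam f u \<Longrightarrow> ennreal lam * ?F \<le> ennreal B"
    using lambda_bound[OF domain(1,3,4) s DIM f_int f_nonneg f0 mu_Linf mu_lower] by blast
  show ?thesis
  \<comment> \<open>A solution forces lam \<le> B / F. Adding 1 makes the threshold positive even if
    B = 0.\<close>
  proof (intro exI[of _ "B / F + 1"] conjI allI impI notI)
    show pos: "0 < B / F + 1" using B(1) F(1) by (simp add: add_nonneg_pos)
    fix lam assume lam: "B / F + 1 < lam" and "\<exists>u\<in>frac_sobolev_2 s. weak_solution s \<Omega> \<mu> lam f u"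
    then obtain u where u: "u \<in> frac_sobolev_2 s" "weak_solution s \<Omega> \<mu> lam f u" by blast
    have lam0: "0 < lam" using lam pos by linarith
    have "ennreal (lam * F) = ennreal lam * ennreal F" using lam0 F by (simp add: ennreal_mult)
    also have "\<dots> \<le> ennreal lam * ?F" by (intro mult_left_mono F) simp
    also have "\<dots> \<le> ennreal B" by (rule B(2)[OF lam0 u])
    finally have "lam * F \<le> B" using B(1) by (simp add: ennreal_le_iff)
    then have "lam \<le> B / F" using F by (simp add: pos_le_divide_eq)
    then show False using lam by simp
  qed
qed

end
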